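(* Let $p$ be an odd prime, and let $P$ be a finite $p$-central $p$-group of height $p-1$. Then $P$ determines $p$-nilpotency locally.
   Context: For a finite $p$-group $P$, $\Omega_1(P)=\langle x\in P\mid x^{p}=1\rangle$, and $\zeta_k(P)$ denotes the $k$-th term of the ascending (upper) central series of $P$, with $\zeta_1(P)=\mathrm{Z}(P)$. $P$ is called $p$-central of height $k$ if $\Omega_1(P)\leq\zeta_k(P)$. A finite group is $p$-nilpotent if a Sylow $p$-subgroup has a normal complement. A finite $p$-group $P$ is said to determine $p$-nilpotency locally if the following holds: whenever $G$ is a finite group containing $P$ as a Sylow $p$-subgroup such that $N_G(P)$ is $p$-nilpotent, then $G$ is also $p$-nilpotent. *)

theory Defs
  imports "HOL-Algebra.Algebra"
begin

definition p_group :: "nat \<Rightarrow> ('a, 'm) monoid_scheme \<Rightarrow> bool" where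
  "p_group p P \<longleftrightarrow> group P \<and> finite (carrier P) \<and> (\<exists>n. order P = p ^ n)"

definition sylow_subgroup :: "nat \<Rightarrow> 'a set \<Rightarrow> ('a, 'm) monoid_scheme \<Rightarrow> bool" where
  "sylow_subgroup p S G \<longleftrightarrow>
     subgroup S G \<and> finite (carrier G) \<and> card S = p ^ multiplicity p (order G)"

definition center :: "('a, 'm) monoid_scheme \<Rightarrow> 'a set" where
  "center G = {z \<in> carrier G. \<forall>g \<in> carrier G. z \<otimes>\<^bsub>G\<^esub> g = g \<otimes>\<^bsub>G\<^esub> z}"

text \<open>The successor clause takes the preimage in \<open>G\<close> of the center of
  \<open>G\<close> modulo the previous term; in particular the term with index 1 is the center of \<open>G\<close>.\<close>

primrec upper_central :: "('a, 'm) monoid_scheme \<Rightarrow> nat \<Rightarrow> 'a set" where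
  "upper_central G 0 = {\<one>\<^bsub>G\<^esub>}"
| "upper_central G (Suc k) =
     {x \<in> carrier G. upper_central G k #>\<^bsub>G\<^esub> x \<in> center (G Mod upper_central G k)}"

definition Omega1 :: "nat \<Rightarrow> ('a, 'm) monoid_scheme \<Rightarrow> 'a set" where
  "Omega1 p P = generate P {x \<in> carrier P. x [^]\<^bsub>P\<^esub> p = \<one>\<^bsub>P\<^esub>}"

definition p_central_of_height :: "nat \<Rightarrow> nat \<Rightarrow> ('a, 'm) monoid_scheme \<Rightarrow> bool" where
  "p_central_of_height p k P \<longleftrightarrow> Omega1 p P \<subseteq> upper_central P k"

definition p_nilpotent :: "nat \<Rightarrow> ('a, 'm) monoid_scheme \<Rightarrow> bool" where
  "p_nilpotent p G \<longleftrightarrow>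
     (\<exists>S N. sylow_subgroup p S G \<and> N \<lhd> G \<and> N <#>\<^bsub>G\<^esub> S = carrier G \<and> N \<inter> S = {\<one>\<^bsub>G\<^esub>})"

text \<open>\<open>P\<close> is a Sylow subgroup of \<open>G\<close> up to isomorphism: some Sylow subgroup \<open>S\<close> of \<open>G\<close> is
  isomorphic to \<open>P\<close>. A definition in HOL cannot quantify over all types, so the type of the elements
  of the overgroups is a parameter. Leaving \<open>'b\<close> as a free type variable in a theorem
  makes the theorem range over all finite groups \<open>G\<close>; already every infinite type, such as \<open>nat\<close>,
  contains an isomorphic copy of each of them.\<close>

definition determines_p_nilpotency_locally ::
    "'b itself \<Rightarrow> nat \<Rightarrow> ('a, 'm) monoid_scheme \<Rightarrow> bool" where
  "determines_p_nilpotency_locally (_ :: 'b itself) p P \<longleftrightarrow>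
     (\<forall>(G :: 'b monoid) S.
        group G \<and> finite (carrier G) \<and> sylow_subgroup p S G \<and> P \<cong> G\<lparr>carrier := S\<rparr> \<and>
        p_nilpotent p (G\<lparr>carrier := normalizer G S\<rparr>)
        \<longrightarrow> p_nilpotent p G)"

end

theory Submission
  imports Defs
begin

text \<open>
  Call a \<open>p\<close>-group Engel if \<open>[x, \<dots>, x, w] = 1\<close> (with \<open>p - 1\<close> entries \<open>x\<close>) for all \<open>w\<close> in its \<open>\<Omega>\<^sub>1\<close>. This
  follows from \<open>p\<close>-centrality of height \<open>p - 1\<close> and, unlike the latter, is visibly inherited by subgroups.

  In a counterexample \<open>H\<close> of least order let \<open>U\<close> be a maximal normal \<open>p\<close>-subgroup. All normalizers of
  \<open>p\<close>-subgroups \<open>V > U\<close> are \<open>p\<close>-nilpotent, so by Frobenius' criterion (relative to \<open>U\<close>, by transfer)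
  \<open>H\<close> has a normal subgroup \<open>K\<close> of \<open>p\<close>-power index with Sylow \<open>p\<close>-subgroup \<open>U\<close>. Let \<open>R\<close> be a Sylow
  \<open>r\<close>-subgroup of \<open>K\<close> for a prime \<open>r \<noteq> p\<close> and \<open>T\<close> a Sylow \<open>p\<close>-subgroup of its normalizer. By the Frattini
  argument \<open>UT\<close> is Sylow in \<open>H\<close>, so \<open>C\<^sub>R(T)\<close>, which normalizes \<open>UT\<close>, centralizes \<open>U\<close>. If \<open>R\<close> did not
  centralize \<open>U\<close>, then for minimal \<open>T\<close>-invariant such \<open>R\<close> and minimal \<open>RT\<close>-invariant \<open>W \<le> U\<close> not
  centralized by \<open>R\<close>, the group \<open>W\<close> would be generated by elements of order \<open>p\<close> (this uses \<open>p\<close> odd), so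
  \<open>(x - 1)\<^sup>p\<^sup>-\<^sup>1 = 0\<close> on \<open>W / W'\<close> for all \<open>x \<in> T\<close>. As \<open>R\<close> acts on \<open>U\<close> as an abelian group, the abelian case
  of the Hall--Higman theorem shows that \<open>[R, T]\<close> centralizes \<open>W\<close>, and so does \<open>R = C\<^sub>R(W) C\<^sub>R(T)\<close>, a
  contradiction. Hence \<open>K = U C\<^sub>K(U)\<close>, which has a normal \<open>p\<close>-complement.
\<close>


section \<open>Conjugation in finite groups\<close>

text \<open>The Engel condition need not pass to quotients, so U cannot be factored out. This forces
  a version of Frobenius' criterion relative to U, and an induction over the subgroups of one fixed
  group. The bound p - 1 is decisive: on an elementary abelian section every x of order p satisfies
  (x - 1)^p = x^p - 1 = 0, so height p would say nothing. With p - 1, only conjugation by x, ...,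
  x^(p-1) occurs, and these exponents are prime to p. Hence c = [b, x] acts, for each such j, like a
  commutator with x^j, and the relation collapses to (c - 1)^(p-1) = 0. An element c of order prime
  to p must then act trivially. Oddness makes p divide p(p - 1)/2, the exponent of the commutator in
  the p-th power of a product in class 2. The hypothesis on N_G(P) enters twice: it makes the
  normalizers of the p-subgroups V > U p-nilpotent, and it makes C_R(T) centralize the Sylow
  subgroup UT.\<close>

context group begin

text \<open>The left action of the group on itself. Commutators [g, x] are written out as
  \<open>cj g x \<otimes> inv x\<close>.\<close>

definition cj :: "'a \<Rightarrow> 'a \<Rightarrow> 'a" where
  "cj g x = g \<otimes> x \<otimes> inv g"

text \<open>Only an inclusion, for arbitrary sets; in a finite group it makes each h permute S, by
  \<open>cj_image_eq\<close>.\<close>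

definition normalizes :: "'a set \<Rightarrow> 'a set \<Rightarrow> bool" where
  "normalizes H S \<longleftrightarrow> (\<forall>h\<in>H. \<forall>s\<in>S. cj h s \<in> S)"

definition centralizes :: "'a set \<Rightarrow> 'a set \<Rightarrow> bool" where
  "centralizes H S \<longleftrightarrow> (\<forall>h\<in>H. \<forall>s\<in>S. cj h s = s)"

definition nrm :: "'a set \<Rightarrow> 'a set \<Rightarrow> 'a set" where
  "nrm H S = {h \<in> H. \<forall>s\<in>S. cj h s \<in> S}"

lemma mem_sub: "subgroup H G \<Longrightarrow> x \<in> H \<Longrightarrow> x \<in> carrier G"
  by (rule subgroup.mem_carrier)

lemma inv_cancel_left [simp]:
  assumes "x \<in> carrier G" "y \<in> carrier G"
  shows "inv x \<otimes> (x \<otimes> y) = y" "x \<otimes> (inv x \<otimes> y) = y"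
  using assms by (simp_all flip: m_assoc)

text \<open>With cancellation these reduce words in a group to a normal form, which settles the
  identities between conjugates and commutators below.\<close>

lemmas word_simps = cj_def m_assoc inv_mult_group

lemma cj_closed [simp, intro]: "g \<in> carrier G \<Longrightarrow> x \<in> carrier G \<Longrightarrow> cj g x \<in> carrier G"
  by (simp add: cj_def)

lemma cj_mult: "g \<in> carrier G \<Longrightarrow> x \<in> carrier G \<Longrightarrow> y \<in> carrier G \<Longrightarrow> cj g (x \<otimes> y) = cj g x \<otimes> cj g y"
  by (simp add: word_simps)

lemma cj_cj: "g \<in> carrier G \<Longrightarrow> h \<in> carrier G \<Longrightarrow> x \<in> carrier G \<Longrightarrow> cj g (cj h x) = cj (g \<otimes> h) x"
  by (simp add: word_simps)

lemma cj_one [simp]: "g \<in> carrier G \<Longrightarrow> cj g \<one> = \<one>"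
  by (simp add: word_simps)

lemma cj_by_one [simp]: "x \<in> carrier G \<Longrightarrow> cj \<one> x = x"
  by (simp add: word_simps)

lemma cj_inv: "g \<in> carrier G \<Longrightarrow> x \<in> carrier G \<Longrightarrow> cj g (inv x) = inv (cj g x)"
  by (simp add: word_simps)

lemma cj_inv_cj [simp]:
  assumes "g \<in> carrier G" "x \<in> carrier G"
  shows "cj (inv g) (cj g x) = x" "cj g (cj (inv g) x) = x"
  using assms by (simp_all add: word_simps)

lemma cj_pow:
  assumes "g \<in> carrier G" "x \<in> carrier G"
  shows "cj g (x [^] (n::nat)) = cj g x [^] n"
  using assms by (induction n) (simp_all add: cj_mult)

lemma inj_on_cj: "g \<in> carrier G \<Longrightarrow> A \<subseteq> carrier G \<Longrightarrow> inj_on (cj g) A"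
  by (rule inj_on_inverseI[where g = "cj (inv g)"]) auto

lemma card_cj_image: "g \<in> carrier G \<Longrightarrow> A \<subseteq> carrier G \<Longrightarrow> card (cj g ` A) = card A"
  by (simp add: card_image inj_on_cj)

lemma cj_eq_iff_commute:
  "g \<in> carrier G \<Longrightarrow> x \<in> carrier G \<Longrightarrow> cj g x = x \<longleftrightarrow> g \<otimes> x = x \<otimes> g"
  by (metis cj_def inv_closed inv_solve_right m_assoc m_closed r_cancel)

lemma cj_fixed_sym:
  "g \<in> carrier G \<Longrightarrow> x \<in> carrier G \<Longrightarrow> cj g x = x \<longleftrightarrow> cj x g = g"
  by (metis cj_eq_iff_commute)

lemma subgroup_cj_image:
  assumes "subgroup H G" "g \<in> carrier G"
  shows "subgroup (cj g ` H) G"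
proof (rule subgroupI)
  have sub: "H \<subseteq> carrier G" using assms(1) by (rule subgroup.subset)
  show "cj g ` H \<subseteq> carrier G" using sub assms(2) by auto
  show "cj g ` H \<noteq> {}" using subgroup.one_closed[OF assms(1)] by auto
  show "inv a \<in> cj g ` H" if "a \<in> cj g ` H" for a
    using that sub assms by (auto simp flip: cj_inv intro!: imageI subgroup.m_inv_closed[OF assms(1)])
  show "a \<otimes> b \<in> cj g ` H" if "a \<in> cj g ` H" "b \<in> cj g ` H" for a b
    using that sub assms
    by (auto simp: subset_iff simp flip: cj_mult intro!: imageI subgroup.m_closed[OF assms(1)])
qed

lemma normalizesD: "normalizes H S \<Longrightarrow> h \<in> H \<Longrightarrow> s \<in> S \<Longrightarrow> cj h s \<in> S"
  by (auto simp: normalizes_def)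

lemma normalizes_self: "subgroup H G \<Longrightarrow> normalizes H H"
  by (auto simp: normalizes_def cj_def intro!: subgroup.m_closed subgroup.m_inv_closed)

lemma set_mult_iff: "x \<in> A <#> B \<longleftrightarrow> (\<exists>a\<in>A. \<exists>b\<in>B. x = a \<otimes> b)"
  by (auto simp: set_mult_def)

lemma set_multI: "a \<in> A \<Longrightarrow> b \<in> B \<Longrightarrow> a \<otimes> b \<in> A <#> B"
  by (auto simp: set_mult_def)

lemma subgroup_set_mult:
  assumes A: "subgroup A G" and B: "subgroup B G" and n: "normalizes B A"
  shows "subgroup (A <#> B) G"
proof (rule subgroupI)
  have subs: "a \<in> A \<Longrightarrow> a \<in> carrier G" "b \<in> B \<Longrightarrow> b \<in> carrier G" for a b
    using A B by (simp_all add: mem_sub)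
  show "A <#> B \<subseteq> carrier G" using subs by (auto simp: set_mult_iff)
  show "A <#> B \<noteq> {}" using subgroup.one_closed[OF A] subgroup.one_closed[OF B]
    by (auto simp: set_mult_def)
  show "inv x \<in> A <#> B" if "x \<in> A <#> B" for x
  proof -
    from that obtain a b where x: "a \<in> A" "b \<in> B" "x = a \<otimes> b" by (auto simp: set_mult_iff)
    have "inv x = cj (inv b) (inv a) \<otimes> inv b" using x subs by (simp add: word_simps)
    thus ?thesis using x A B by (auto intro!: set_multI normalizesD[OF n] subgroup.m_inv_closed)
  qed
  show "x \<otimes> y \<in> A <#> B" if "x \<in> A <#> B" "y \<in> A <#> B" for x y
  proof -
    from that obtain a b a' b' where x: "a \<in> A" "b \<in> B" "x = a \<otimes> b" "a' \<in> A" "b' \<in> B" "y = a' \<otimes> b'"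
      by (auto simp: set_mult_iff)
    have "x \<otimes> y = (a \<otimes> cj b a') \<otimes> (b \<otimes> b')" using x subs by (simp add: word_simps)
    thus ?thesis using x A B by (auto intro!: set_multI normalizesD[OF n] subgroup.m_closed)
  qed
qed

lemma set_mult_subset:
  "subgroup H G \<Longrightarrow> A \<subseteq> H \<Longrightarrow> B \<subseteq> H \<Longrightarrow> A <#> B \<subseteq> H"
  by (auto simp: set_mult_def intro: subgroup.m_closed)

lemma subset_set_mult1: "subgroup A G \<Longrightarrow> subgroup B G \<Longrightarrow> A \<subseteq> A <#> B"
  using subgroup.one_closed[of B G] subgroup.mem_carrier[of A G] by (force simp: set_mult_def)

lemma subset_set_mult2: "subgroup A G \<Longrightarrow> subgroup B G \<Longrightarrow> B \<subseteq> A <#> B"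
  using subgroup.one_closed[of A G] subgroup.mem_carrier[of B G] by (force simp: set_mult_def)

lemma subgroup_centralizer:
  assumes H: "subgroup H G" and S: "S \<subseteq> carrier G"
  shows "subgroup {h\<in>H. \<forall>s\<in>S. cj h s = s} G"
proof (rule subgroupI)
  have c: "h \<in> carrier G" if "h \<in> H" for h using H that by (simp add: mem_sub)
  show "{h\<in>H. \<forall>s\<in>S. cj h s = s} \<subseteq> carrier G" using c by auto
  show "{h\<in>H. \<forall>s\<in>S. cj h s = s} \<noteq> {}" using S subgroup.one_closed[OF H] by (auto intro!: exI[of _ \<one>])
  fix a assume a: "a \<in> {h\<in>H. \<forall>s\<in>S. cj h s = s}"
  show "inv a \<in> {h\<in>H. \<forall>s\<in>S. cj h s = s}"
    using a S c by (auto intro!: subgroup.m_inv_closed[OF H]) (metis cj_inv_cj(1) subsetD)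
  fix b assume b: "b \<in> {h\<in>H. \<forall>s\<in>S. cj h s = s}"
  show "a \<otimes> b \<in> {h\<in>H. \<forall>s\<in>S. cj h s = s}"
    using a b S c by (auto intro!: subgroup.m_closed[OF H] simp: subset_iff simp flip: cj_cj)
qed

end

locale fin_group = group +
  assumes fin: "finite (carrier G)"
begin

lemma fin_subset: "A \<subseteq> carrier G \<Longrightarrow> finite A"
  using fin finite_subset by auto

lemma fin_sub: "subgroup H G \<Longrightarrow> finite H"
  by (rule fin_subset) (rule subgroup.subset)

lemma card_sub_pos: "subgroup H G \<Longrightarrow> card H > 0"
  using fin_sub[of H] subgroup.one_closed[of H G] by (auto simp: card_gt_0_iff)

lemma card_sub_dvd:
  assumes "subgroup K G" "subgroup H G" "K \<subseteq> H"
  shows "card K dvd card H"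
proof -
  interpret H: group "G\<lparr>carrier := H\<rparr>" using assms(2) by (rule subgroup_imp_group)
  have "subgroup K (G\<lparr>carrier := H\<rparr>)" using assms by (rule subgroup_incl)
  from H.lagrange[OF this] show ?thesis unfolding order_def by simp (metis dvd_triv_right)
qed

text \<open>The product map from A \<times> B to AB has fibres of equal size: the one over ab
  consists of the pairs (ad, d^-1 b) with d in A \<inter> B.\<close>

lemma card_set_mult:
  assumes A: "subgroup A G" and B: "subgroup B G"
  shows "card (A <#> B) * card (A \<inter> B) = card A * card B"
proof -
  have c: "a \<in> A \<Longrightarrow> a \<in> carrier G" "b \<in> B \<Longrightarrow> b \<in> carrier G" for a b
    using A B by (simp_all add: mem_sub)
  let ?f = "\<lambda>(a, b). a \<otimes> b"
  have fib: "card {z \<in> A \<times> B. ?f z = y} = card (A \<inter> B)" if "y \<in> A <#> B" for y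
  proof -
    from that obtain a b where y: "a \<in> A" "b \<in> B" "y = a \<otimes> b" by (auto simp: set_mult_iff)
    have "bij_betw (\<lambda>d. (a \<otimes> d, inv d \<otimes> b)) (A \<inter> B) {z \<in> A \<times> B. ?f z = y}"
    proof (rule bij_betw_byWitness[where f' = "\<lambda>z. inv a \<otimes> fst z"])
      show "\<forall>d\<in>A \<inter> B. inv a \<otimes> fst (a \<otimes> d, inv d \<otimes> b) = d" using y c by auto
      have *: "inv (inv a \<otimes> a') \<otimes> b = b'" if "a' \<in> A" "b' \<in> B" "a' \<otimes> b' = a \<otimes> b" for a' b'
      proof -
        have "inv (inv a \<otimes> a') \<otimes> b = inv a' \<otimes> (a' \<otimes> b')"
          using that y c by (simp add: inv_mult_group m_assoc)
        thus ?thesis using that c by (metis inv_cancel_left(1))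
      qed
      show "\<forall>z\<in>{z \<in> A \<times> B. ?f z = y}. (a \<otimes> (inv a \<otimes> fst z), inv (inv a \<otimes> fst z) \<otimes> b) = z"
        using y c * by auto
      show "(\<lambda>d. (a \<otimes> d, inv d \<otimes> b)) ` (A \<inter> B) \<subseteq> {z \<in> A \<times> B. ?f z = y}"
      proof (rule image_subsetI)
        fix d assume "d \<in> A \<inter> B"
        thus "(a \<otimes> d, inv d \<otimes> b) \<in> {z \<in> A \<times> B. ?f z = y}"
          using y c subgroup.m_closed[OF A] subgroup.m_closed[OF B] subgroup.m_inv_closed[OF B]
          by (simp add: m_assoc)
      qed
      have **: "inv a \<otimes> a' \<in> B" if "a' \<in> A" "b' \<in> B" "a' \<otimes> b' = a \<otimes> b" for a' b'
      proof -
        have "inv a \<otimes> a' = b \<otimes> inv b'" using that y c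
          by (metis inv_closed inv_solve_left inv_solve_right m_assoc m_closed)
        thus ?thesis using that y subgroup.m_closed[OF B] subgroup.m_inv_closed[OF B] by simp
      qed
      show "(\<lambda>z. inv a \<otimes> fst z) ` {z \<in> A \<times> B. ?f z = y} \<subseteq> A \<inter> B"
      proof (rule image_subsetI)
        fix z assume "z \<in> {z \<in> A \<times> B. ?f z = y}"
        thus "inv a \<otimes> fst z \<in> A \<inter> B"
          using y **[of "fst z" "snd z"] subgroup.m_closed[OF A] subgroup.m_inv_closed[OF A]
          by (simp add: case_prod_beta mem_Times_iff)
      qed
    qed
    from bij_betw_same_card[OF this] show ?thesis by (rule sym)
  qed
  have "card (A \<times> B) = (\<Sum>y\<in>?f ` (A \<times> B). card {z \<in> A \<times> B. ?f z = y})"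
    using sum.image_gen[OF finite_cartesian_product[OF fin_sub[OF A] fin_sub[OF B]], of "\<lambda>_. 1 :: nat" ?f]
    by (simp only: card_eq_sum)
  also have "?f ` (A \<times> B) = A <#> B" by (auto simp: set_mult_def)
  also have "(\<Sum>y\<in>A <#> B. card {z \<in> A \<times> B. ?f z = y}) = card (A <#> B) * card (A \<inter> B)"
    using fib by simp
  finally show ?thesis by (simp add: card_cartesian_product)
qed

lemma cj_image_eq:
  assumes "g \<in> carrier G" "S \<subseteq> carrier G" "\<And>s. s \<in> S \<Longrightarrow> cj g s \<in> S"
  shows "cj g ` S = S"
  using assms by (intro card_subset_eq fin_subset) (auto simp: card_cj_image)

text \<open>Closure under inverses is the point: \<open>nrm\<close> asks only for an inclusion, and
  finiteness turns it into a permutation of S.\<close>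

lemma subgroup_nrm:
  assumes H: "subgroup H G" and S: "S \<subseteq> carrier G"
  shows "subgroup (nrm H S) G"
proof (rule subgroupI)
  have c: "h \<in> carrier G" if "h \<in> H" for h using H that by (simp add: mem_sub)
  show "nrm H S \<subseteq> carrier G" using c by (auto simp: nrm_def)
  show "nrm H S \<noteq> {}" using S subgroup.one_closed[OF H] by (auto simp: nrm_def subset_iff intro!: exI[of _ \<one>])
  fix a assume a: "a \<in> nrm H S"
  have "cj a ` S = S" using a S c by (intro cj_image_eq) (auto simp: nrm_def)
  hence "cj (inv a) s \<in> S" if "s \<in> S" for s   proof -
    from that \<open>cj a ` S = S\<close> obtain s' where "s' \<in> S" "s = cj a s'" by (metis imageE)
    thus ?thesis using a S c by (auto simp: nrm_def)
  qed
  thus "inv a \<in> nrm H S" using a by (auto simp: nrm_def intro: subgroup.m_inv_closed[OF H])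
  fix b assume b: "b \<in> nrm H S"
  show "a \<otimes> b \<in> nrm H S"
    using a b S c by (auto simp: nrm_def subset_iff simp flip: cj_cj intro: subgroup.m_closed[OF H])
qed

lemma nrm_subset: "nrm H S \<subseteq> H" by (auto simp: nrm_def)

lemma normalizes_nrm: "normalizes (nrm H S) S" by (auto simp: nrm_def normalizes_def)

lemma subgroup_subset_nrm: "subgroup S G \<Longrightarrow> S \<subseteq> H \<Longrightarrow> S \<subseteq> nrm H S"
  using normalizes_self[of S] by (auto simp: nrm_def normalizes_def)

end

section \<open>Sylow's theorems\<close>

context fin_group begin

definition pgr :: "nat \<Rightarrow> 'a set \<Rightarrow> bool" where
  "pgr p H \<longleftrightarrow> subgroup H G \<and> (\<exists>n. card H = p ^ n)"

text \<open>An index prime to p, rather than the exact power of p, is asked for: in this form the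
  property passes to intermediate subgroups by divisibility alone.\<close>

definition syl :: "nat \<Rightarrow> 'a set \<Rightarrow> 'a set \<Rightarrow> bool" where
  "syl p S H \<longleftrightarrow> pgr p S \<and> subgroup H G \<and> S \<subseteq> H \<and> \<not> p dvd card H div card S"

lemma pgr_subgroup: "pgr p H \<Longrightarrow> subgroup H G" by (simp add: pgr_def)

lemma pgr_mono:
  assumes "Factorial_Ring.prime p" "pgr p H" "subgroup K G" "K \<subseteq> H"
  shows "pgr p K"
  using assms card_sub_dvd[of K H] by (auto simp: pgr_def divides_primepow_nat)

lemma pgr_set_mult:
  assumes "Factorial_Ring.prime p" "pgr p A" "pgr p B" "normalizes B A"
  shows "pgr p (A <#> B)"
proof -
  have s: "subgroup A G" "subgroup B G" using assms by (auto simp: pgr_def)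
  obtain n m where "card A = p ^ n" "card B = p ^ m" using assms by (auto simp: pgr_def)
  hence "card (A <#> B) dvd p ^ (n + m)"
    using card_set_mult[OF s] by (metis dvd_triv_left power_add)
  thus ?thesis using assms s subgroup_set_mult by (auto simp: pgr_def divides_primepow_nat)
qed

lemma pgr_cj: "pgr p A \<Longrightarrow> g \<in> carrier G \<Longrightarrow> pgr p (cj g ` A)"
  using card_cj_image[of g A] subgroup.subset[of A G] by (auto simp: pgr_def intro: subgroup_cj_image)

text \<open>The set decomposes into double cosets QhS of order |Q||S| / |Q \<inter> hSh^-1|. There
  the intersection is a proper subgroup of the p-group Q, which leaves a factor p. Both the
  conjugacy of Sylow subgroups and the growth of normalizers follow from this one count.\<close>

lemma double_coset_count:
  assumes p: "Factorial_Ring.prime p" and Q: "pgr p Q" and S: "subgroup S G" and H: "subgroup H G"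
    and QH: "Q \<subseteq> H" and SH: "S \<subseteq> H"
  shows "p * card S dvd card (H - {h \<in> H. Q \<subseteq> cj h ` S})"
proof -
  define D where "D h = {q \<otimes> h \<otimes> s |q s. q \<in> Q \<and> s \<in> S}" for h
  let ?X = "H - {h \<in> H. Q \<subseteq> cj h ` S}"
  have Qs: "subgroup Q G" using Q by (rule pgr_subgroup)
  have c: "h \<in> H \<Longrightarrow> h \<in> carrier G" "q \<in> Q \<Longrightarrow> q \<in> carrier G" "s \<in> S \<Longrightarrow> s \<in> carrier G" for h q s
    using H Qs S by (simp_all add: mem_sub)
  have self: "h \<in> D h" if "h \<in> H" for h
    unfolding D_def using that c subgroup.one_closed[OF Qs] subgroup.one_closed[OF S] by force
  have DH: "D h \<subseteq> H" if "h \<in> H" for h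
    using that QH SH by (auto simp: D_def intro!: subgroup.m_closed[OF H])
  have sub: "D g \<subseteq> D h" if "h \<in> H" and g: "g \<in> D h" for g h
  proof
    fix x assume "x \<in> D g"
    then obtain q' s' where "q' \<in> Q" "s' \<in> S" "x = q' \<otimes> g \<otimes> s'" by (auto simp: D_def)
    moreover obtain q s where "q \<in> Q" "s \<in> S" "g = q \<otimes> h \<otimes> s" using g by (auto simp: D_def)
    ultimately have "q \<in> Q" "s \<in> S" "q' \<in> Q" "s' \<in> S" and x: "x = q' \<otimes> (q \<otimes> h \<otimes> s) \<otimes> s'"
      by auto
    moreover from this have "x = (q' \<otimes> q) \<otimes> h \<otimes> (s \<otimes> s')" using that c by (simp add: m_assoc)
    ultimately show "x \<in> D h" using Qs S unfolding D_def by (blast intro: subgroup.m_closed)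
  qed
  have sym: "h \<in> D g" if "h \<in> H" and g: "g \<in> D h" for g h
  proof -
    obtain q s where qs: "q \<in> Q" "s \<in> S" "g = q \<otimes> h \<otimes> s" using g by (auto simp: D_def)
    hence "h = inv q \<otimes> g \<otimes> inv s" using that c by (simp add: m_assoc)
    thus ?thesis using qs Qs S unfolding D_def by (blast intro: subgroup.m_inv_closed)
  qed
  have eq: "D g = D h" if "h \<in> H" "g \<in> D h" for g h
    using sub[OF that] sub[of g h] sym[OF that] DH that by auto
  \<comment> \<open>Replacing h by qhs replaces hSh^-1 by its conjugate under q, and Q is invariant
    under that conjugation; so the set is a union of double cosets.\<close>
  have DX: "D h \<subseteq> ?X" if "h \<in> ?X" for h
  proof
    fix g assume g: "g \<in> D h"
    hence gH: "g \<in> H" using DH that by auto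
    have "\<not> Q \<subseteq> cj g ` S"
    proof
      assume F: "Q \<subseteq> cj g ` S"
      obtain q s where qs: "q \<in> Q" "s \<in> S" "g = q \<otimes> h \<otimes> s" using g by (auto simp: D_def)
      have "Q \<subseteq> cj h ` S"
      proof
        fix y assume y: "y \<in> Q"
        have "cj q y \<in> Q" using normalizesD[OF normalizes_self[OF Qs]] qs y by auto
        then obtain t where t: "t \<in> S" "cj q y = cj g t" using F by auto
        have "cj g t = cj q (cj h (cj s t))" using qs t c that by (auto simp: cj_cj m_assoc)
        have "y = cj (inv q) (cj q y)" using y qs c by simp
        also have "cj q y = cj q (cj h (cj s t))" using t(2) \<open>cj g t = cj q (cj h (cj s t))\<close> by simp
        also have "cj (inv q) (cj q (cj h (cj s t))) = cj h (cj s t)" using qs t c that by simp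
        finally have "y = cj h (cj s t)" .
        moreover have "cj s t \<in> S" using normalizesD[OF normalizes_self[OF S]] qs t by auto
        ultimately show "y \<in> cj h ` S" by auto
      qed
      thus False using that by auto
    qed
    thus "g \<in> ?X" using gH by auto
  qed
  have un: "\<Union>(D ` ?X) = ?X" using self DX by blast
  have card: "p * card S dvd card (D h)" if "h \<in> ?X" for h
  proof -
    have hG: "h \<in> carrier G" using that c by auto
    let ?S = "cj h ` S"
    have sS: "subgroup ?S G" using S hG by (rule subgroup_cj_image)
    have cS: "card ?S = card S" using hG S by (intro card_cj_image) (auto simp: c)
    have "D h = (\<lambda>z. z \<otimes> h) ` (Q <#> ?S)"
      using c hG by (force simp: D_def set_mult_def word_simps image_iff)
    moreover have "inj_on (\<lambda>z. z \<otimes> h) (Q <#> ?S)"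
      using c hG by (intro inj_onI) (auto simp: set_mult_def)
    ultimately have cD: "card (D h) = card (Q <#> ?S)" by (simp add: card_image)
    obtain n where n: "card Q = p ^ n" using Q by (auto simp: pgr_def)
    have sI: "subgroup (Q \<inter> ?S) G" using Qs sS by (rule subgroups_Inter_pair)
    have "card (Q \<inter> ?S) dvd p ^ n" using card_sub_dvd[OF sI Qs] n by auto
    then obtain k where k: "k \<le> n" "card (Q \<inter> ?S) = p ^ k" using p by (auto simp: divides_primepow_nat)
    have "Q \<inter> ?S \<subset> Q" using that by auto
    hence "card (Q \<inter> ?S) < card Q" using fin_sub[OF Qs] by (rule psubset_card_mono[rotated])
    hence "k < n" using k n p prime_gt_1_nat by (metis linorder_not_le power_increasing prime_ge_1_nat)
    then obtain m where m: "n = k + Suc m" using less_imp_Suc_add by fastforce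
    have "card (Q <#> ?S) * p ^ k = p ^ n * card S" using card_set_mult[OF Qs sS] n k cS by simp
    also have "\<dots> = (p * card S * p ^ m) * p ^ k" using m by (simp add: power_add)
    finally have "card (Q <#> ?S) = p * card S * p ^ m" using p by (simp add: prime_gt_0_nat)
    thus ?thesis using cD by simp
  qed
  have "p * card S dvd card (\<Union>(D ` ?X))"
  proof (rule dvd_partition)
    show "finite (\<Union>(D ` ?X))" unfolding un using fin_sub[OF H] by auto
    show "\<forall>c\<in>D ` ?X. p * card S dvd card c" using card by auto
    show "\<forall>c1\<in>D ` ?X. \<forall>c2\<in>D ` ?X. c1 \<noteq> c2 \<longrightarrow> c1 \<inter> c2 = {}" using eq by blast
  qed
  thus ?thesis unfolding un .
qed

text \<open>Otherwise the count would cover all of H and make p divide the index of S.\<close>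

lemma sylow_contains_conjugate:
  assumes p: "Factorial_Ring.prime p" and S: "syl p S H" and Q: "pgr p Q" "Q \<subseteq> H"
  shows "\<exists>h\<in>H. Q \<subseteq> cj h ` S"
proof (rule ccontr)
  assume "\<not> ?thesis"
  hence *: "{h \<in> H. Q \<subseteq> cj h ` S} = {}" by auto
  have s: "subgroup S G" "subgroup H G" "S \<subseteq> H" using S by (auto simp: syl_def pgr_def)
  have "p * card S dvd card H" using double_coset_count[OF p Q(1) s(1,2) Q(2) s(3)] unfolding * by simp
  hence "p dvd card H div card S" using card_sub_pos[OF s(1)] by (auto simp: dvd_def)
  thus False using S by (auto simp: syl_def)
qed

text \<open>The same count with S = Q inside P: the excepted set is the normalizer of Q in P. If it
  were Q, then p|Q| would divide |P| - |Q| and |P|, hence |Q|.\<close>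

lemma normalizer_grows:
  assumes p: "Factorial_Ring.prime p" and P: "pgr p P" and Q: "subgroup Q G" and lt: "Q \<subset> P"
  shows "\<exists>g\<in>P - Q. \<forall>q\<in>Q. cj g q \<in> Q"
proof (rule ccontr)
  assume "\<not> ?thesis"
  hence *: "\<And>g. g \<in> P \<Longrightarrow> (\<forall>q\<in>Q. cj g q \<in> Q) \<Longrightarrow> g \<in> Q" by auto
  have s: "subgroup P G" using P by (rule pgr_subgroup)
  have Qp: "pgr p Q" using p P Q lt by (auto intro: pgr_mono)
  have F: "{h \<in> P. Q \<subseteq> cj h ` Q} = Q"
  proof (intro equalityI subsetI)
    fix h assume h: "h \<in> {h \<in> P. Q \<subseteq> cj h ` Q}"
    hence hG: "h \<in> carrier G" using s mem_sub by auto
    have "Q = cj h ` Q"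
      using h hG Q by (intro card_subset_eq finite_imageI fin_sub) (auto simp: card_cj_image subgroup.subset)
    thus "h \<in> Q" using h by (intro *) auto
  next
    fix h assume h: "h \<in> Q"
    have "cj h ` Q = Q" using h Q normalizesD[OF normalizes_self[OF Q]]
      by (intro cj_image_eq) (auto simp: mem_sub subgroup.subset)
    thus "h \<in> {h \<in> P. Q \<subseteq> cj h ` Q}" using h lt by auto
  qed
  have "p * card Q dvd card (P - Q)"
    using double_coset_count[OF p Qp Q s] lt unfolding F by auto
  moreover have "card (P - Q) = card P - card Q" using lt fin_sub[OF Q] by (intro card_Diff_subset) auto
  moreover have "p * card Q dvd card P"
  proof -
    obtain n m where nm: "card P = p ^ n" "card Q = p ^ m" using P Qp by (auto simp: pgr_def)
    have "card Q < card P" using lt fin_sub[OF s] by (rule psubset_card_mono[rotated])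
    hence "m < n" using nm p by (metis linorder_not_le power_increasing prime_ge_1_nat)
    thus ?thesis using nm by (metis Suc_leI le_imp_power_dvd power_Suc)
  qed
  moreover have "card Q \<le> card P" using lt fin_sub[OF s] by (intro card_mono) auto
  ultimately have "p * card Q dvd card Q" by (metis dvd_diffD1)
  thus False using card_sub_pos[OF Q] prime_gt_1_nat[OF p] by (auto dest!: dvd_imp_le)
qed

lemma syl_exists:
  assumes p: "Factorial_Ring.prime p" and H: "subgroup H G"
  shows "\<exists>S. syl p S H"
proof -
  interpret H: group "G\<lparr>carrier := H\<rparr>" using H by (rule subgroup_imp_group)
  define a where "a = multiplicity p (card H)"
  have nz: "card H \<noteq> 0" using card_sub_pos[OF H] by auto
  obtain m where m: "card H = p ^ a * m" "\<not> p dvd m"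
    using multiplicity_decompose'[of "card H" p] nz p a_def by (metis not_prime_unit)
  have "\<exists>S. subgroup S (G\<lparr>carrier := H\<rparr>) \<and> card S = p ^ a"
    by (rule sylow_thm[OF p H.is_group]) (use m fin_sub[OF H] in \<open>auto simp: order_def\<close>)
  then obtain S where S: "subgroup S (G\<lparr>carrier := H\<rparr>)" "card S = p ^ a" by auto
  have "subgroup S G" using H S(1) by (rule incl_subgroup)
  moreover have "S \<subseteq> H" using subgroup.subset[OF S(1)] by simp
  ultimately have "syl p S H" using S(2) m H p by (auto simp: syl_def pgr_def prime_gt_0_nat)
  thus ?thesis ..
qed

lemma sylD: "syl p S H \<Longrightarrow> pgr p S" "syl p S H \<Longrightarrow> subgroup S G" "syl p S H \<Longrightarrow> subgroup H G"
  "syl p S H \<Longrightarrow> S \<subseteq> H"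
  by (auto simp: syl_def pgr_def)

lemma cj_image_subset:
  "subgroup H G \<Longrightarrow> h \<in> H \<Longrightarrow> A \<subseteq> H \<Longrightarrow> cj h ` A \<subseteq> H"
  using normalizesD[OF normalizes_self[of H]] by blast

lemma syl_cj:
  assumes S: "syl p S H" and h: "h \<in> H"
  shows "syl p (cj h ` S) H"
proof -
  have hG: "h \<in> carrier G" using S h sylD mem_sub by blast
  have "card (cj h ` S) = card S" using hG sylD(2)[OF S] by (simp add: card_cj_image subgroup.subset)
  thus ?thesis using S h hG by (auto simp: syl_def pgr_cj intro: subsetD[OF cj_image_subset])
qed

lemma syl_extends:
  assumes p: "Factorial_Ring.prime p" and Q: "pgr p Q" "Q \<subseteq> H" and H: "subgroup H G"
  shows "\<exists>S. syl p S H \<and> Q \<subseteq> S"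
proof -
  obtain S where S: "syl p S H" using syl_exists[OF p H] by auto
  from sylow_contains_conjugate[OF p S Q] obtain h where "h \<in> H" "Q \<subseteq> cj h ` S" by auto
  thus ?thesis using syl_cj[OF S] by auto
qed

lemma syl_pgr_card_le:
  assumes p: "Factorial_Ring.prime p" and S: "syl p S H" and Q: "pgr p Q" "Q \<subseteq> H"
  shows "card Q \<le> card S"
proof -
  from sylow_contains_conjugate[OF p S Q] obtain h where h: "h \<in> H" "Q \<subseteq> cj h ` S" by auto
  have "card Q \<le> card (cj h ` S)" using h sylD(2)[OF S] by (intro card_mono finite_imageI fin_sub) auto
  also have "\<dots> = card S" using h sylD(2,3)[OF S] by (intro card_cj_image) (auto simp: mem_sub)
  finally show ?thesis .
qed

lemma syl_conjugate:
  assumes p: "Factorial_Ring.prime p" and S: "syl p S H" and S': "syl p S' H"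
  shows "\<exists>h\<in>H. S' = cj h ` S"
proof -
  from sylow_contains_conjugate[OF p S sylD(1)[OF S'] sylD(4)[OF S']]
  obtain h where h: "h \<in> H" "S' \<subseteq> cj h ` S" by auto
  have "card S \<le> card S'" using syl_pgr_card_le[OF p S' sylD(1)[OF S] sylD(4)[OF S]] .
  moreover have "card (cj h ` S) = card S" using h sylD(2,3)[OF S] by (intro card_cj_image) (auto simp: mem_sub)
  ultimately have "S' = cj h ` S"
    using h sylD(2)[OF S] by (intro card_seteq finite_imageI fin_sub) auto
  thus ?thesis using h by auto
qed

lemma syl_of_card:
  "syl p S H \<Longrightarrow> pgr p S' \<Longrightarrow> S' \<subseteq> H \<Longrightarrow> card S' = card S \<Longrightarrow> syl p S' H"
  by (auto simp: syl_def)

lemma syl_subset: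
  assumes S: "syl p S H" and K: "subgroup K G" "K \<subseteq> H" "S \<subseteq> K"
  shows "syl p S K"
proof -
  have d: "card S dvd card K" "card K dvd card H" using S K by (auto intro!: card_sub_dvd simp: sylD)
  hence "card K div card S dvd card H div card S" by (meson div_dvd_div dvd_trans)
  thus ?thesis using S K by (auto simp: syl_def dest: dvd_trans)
qed

lemma normal_syl_contains:
  assumes p: "Factorial_Ring.prime p" and U: "syl p U K" "normalizes K U" and Q: "pgr p Q" "Q \<subseteq> K"
  shows "Q \<subseteq> U"
  using sylow_contains_conjugate[OF p U(1) Q] U(2) by (auto simp: normalizes_def)

text \<open>Conjugation by h carries S to another Sylow subgroup of K, and some element of K moves
  it back.\<close>

lemma frattini:
  assumes p: "Factorial_Ring.prime p" and H: "subgroup H G" and K: "K \<subseteq> H" "normalizes H K"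
    and S: "syl p S K" and h: "h \<in> H"
  shows "\<exists>k\<in>K. k \<otimes> h \<in> nrm H S"
proof -
  have hG: "h \<in> carrier G" using H h mem_sub by auto
  have sc: "s \<in> S \<Longrightarrow> s \<in> carrier G" for s using sylD(2)[OF S] by (simp add: mem_sub)
  have "pgr p (cj h ` S)" using S hG by (simp add: pgr_cj sylD)
  moreover have "cj h ` S \<subseteq> K" using K sylD(4)[OF S] h by (auto simp: normalizes_def)
  moreover have "card (cj h ` S) = card S" using hG sylD(2)[OF S] by (simp add: card_cj_image subgroup.subset)
  ultimately have "syl p (cj h ` S) K" using S syl_of_card by blast
  then obtain k where k: "k \<in> K" "S = cj k ` cj h ` S" using syl_conjugate[OF p _ S] by blast
  have kG: "k \<in> carrier G" using k S sylD(3) mem_sub by blast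
  have "cj (k \<otimes> h) s \<in> S" if "s \<in> S" for s
    using that k hG kG sc by (subst cj_cj[symmetric]) auto
  thus ?thesis using k K h H by (auto simp: nrm_def intro!: bexI[of _ k] subgroup.m_closed[OF H])
qed

end

section \<open>Transfer\<close>

context fin_group begin

text \<open>No transversal and no cycle decomposition is used. A fusion-invariant
  \<open>\<phi>\<close> extends to a function F on H with F(xgy) = \<open>\<phi>\<close> x F(g)
  \<open>\<phi>\<close> y for x, y in P, and V h is the product of F(gh) / F(g) over the cosets Pg.
  Since F(gx) / F(g) = \<open>\<phi>\<close> x for x in P, the value on P is immediate.\<close>

lemma transfer:
  fixes \<phi> :: "'a \<Rightarrow> 'c" and A :: "('c, 'd) monoid_scheme"
  assumes A: "comm_group A" and P: "subgroup P G" and H: "subgroup H G" and PH: "P \<subseteq> H"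
    and \<phi>: "\<And>x. x \<in> P \<Longrightarrow> \<phi> x \<in> carrier A"
    and mult: "\<And>x y. x \<in> P \<Longrightarrow> y \<in> P \<Longrightarrow> \<phi> (x \<otimes> y) = \<phi> x \<otimes>\<^bsub>A\<^esub> \<phi> y"
    and fusion: "\<And>x g. x \<in> P \<Longrightarrow> g \<in> H \<Longrightarrow> cj g x \<in> P \<Longrightarrow> \<phi> (cj g x) = \<phi> x"
  shows "\<exists>V. (\<forall>h\<in>H. V h \<in> carrier A) \<and> (\<forall>g\<in>H. \<forall>h\<in>H. V (g \<otimes> h) = V g \<otimes>\<^bsub>A\<^esub> V h) \<and>
    (\<forall>x\<in>P. V x = \<phi> x [^]\<^bsub>A\<^esub> (card H div card P))"
proof -
  interpret A: comm_group A by (rule A)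
  have c: "x \<in> P \<Longrightarrow> x \<in> carrier G" "g \<in> H \<Longrightarrow> g \<in> carrier G" for x g
    using P H by (simp_all add: mem_sub)
  note Pc = subgroup.m_closed[OF P] subgroup.m_inv_closed[OF P] subgroup.one_closed[OF P]
  note Hc = subgroup.m_closed[OF H] subgroup.m_inv_closed[OF H] subgroup.one_closed[OF H]
  have PHD: "x \<in> H" if "x \<in> P" for x using that PH by auto
  define D where "D g = {x \<otimes> g \<otimes> y |x y. x \<in> P \<and> y \<in> P}" for g
  define r where "r g = (SOME z. z \<in> D g)" for g
  have DI: "x \<otimes> g \<otimes> y \<in> D g" if "x \<in> P" "y \<in> P" for x y g using that by (auto simp: D_def)
  have self: "g \<in> D g" if "g \<in> H" for g using DI[of \<one> \<one> g] that c Pc by simp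
  have Dsub: "D (x \<otimes> g \<otimes> y) \<subseteq> D g" if "x \<in> P" "y \<in> P" "g \<in> H" for x y g
  proof
    fix z assume "z \<in> D (x \<otimes> g \<otimes> y)"
    then obtain x' y' where z: "x' \<in> P" "y' \<in> P" "z = x' \<otimes> (x \<otimes> g \<otimes> y) \<otimes> y'" by (auto simp: D_def)
    hence "z = (x' \<otimes> x) \<otimes> g \<otimes> (y \<otimes> y')" using that c by (simp add: m_assoc)
    thus "z \<in> D g" using z that Pc by (auto intro: DI)
  qed
  have Deq: "D (x \<otimes> g \<otimes> y) = D g" if "x \<in> P" "y \<in> P" "g \<in> H" for x y g
  proof
    have "inv x \<otimes> (x \<otimes> g \<otimes> y) \<otimes> inv y = g" using that c by (simp add: m_assoc)
    moreover have "x \<otimes> g \<otimes> y \<in> H" using that by (simp add: PHD Hc)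
    ultimately show "D g \<subseteq> D (x \<otimes> g \<otimes> y)"
      using Dsub[of "inv x" "inv y" "x \<otimes> g \<otimes> y"] that Pc by auto
  qed (rule Dsub[OF that])
  have r: "r g \<in> D g" if "g \<in> H" for g unfolding r_def by (rule someI) (rule self[OF that])
  have rH: "r g \<in> H" if "g \<in> H" for g using r[OF that] that by (auto simp: D_def PHD Hc)
  have rD: "\<exists>x y. x \<in> P \<and> y \<in> P \<and> g = x \<otimes> r g \<otimes> y" if g: "g \<in> H" for g
  proof -
    obtain x y where xy: "x \<in> P" "y \<in> P" "r g = x \<otimes> g \<otimes> y" using r[OF g] by (auto simp: D_def)
    hence "g = inv x \<otimes> r g \<otimes> inv y" using g c by (simp add: m_assoc)
    thus ?thesis using xy Pc by blast
  qed
  \<comment> \<open>F is 1 at the chosen representative r of a double coset PrP, and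
    \<open>\<phi>\<close> x \<open>\<phi>\<close> y at xry.\<close>
  define F where "F g = (THE a. \<exists>x y. x \<in> P \<and> y \<in> P \<and> g = x \<otimes> r g \<otimes> y \<and> a = \<phi> x \<otimes>\<^bsub>A\<^esub> \<phi> y)" for g
  have inv\<phi>: "\<phi> x \<otimes>\<^bsub>A\<^esub> \<phi> (inv x) = \<one>\<^bsub>A\<^esub>" if "x \<in> P" for x
  proof -
    have "\<phi> \<one> \<otimes>\<^bsub>A\<^esub> \<phi> \<one> = \<phi> \<one>" using mult[of \<one> \<one>] Pc by simp
    hence "\<phi> \<one> = \<one>\<^bsub>A\<^esub>" using \<phi>[of \<one>] Pc by simp
    thus ?thesis using mult[of x "inv x"] that c Pc by simp
  qed
  \<comment> \<open>If xty = x'ty', then x'^-1 x is the conjugate of y' y^-1 under t, so the fusion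
    hypothesis gives both the same value; hence F is well defined.\<close>
  have unique: "\<phi> x \<otimes>\<^bsub>A\<^esub> \<phi> y = \<phi> x' \<otimes>\<^bsub>A\<^esub> \<phi> y'"
    if "x \<in> P" "y \<in> P" "x' \<in> P" "y' \<in> P" "t \<in> H" and eq: "x \<otimes> t \<otimes> y = x' \<otimes> t \<otimes> y'" for x y x' y' t
  proof -
    have "inv x' \<otimes> x = inv x' \<otimes> (x \<otimes> t \<otimes> y) \<otimes> inv y \<otimes> inv t"
      using that(1-5) c by (simp add: m_assoc)
    also have "\<dots> = cj t (y' \<otimes> inv y)"
      unfolding eq using that(1-5) c by (simp add: word_simps)
    finally have e: "inv x' \<otimes> x = cj t (y' \<otimes> inv y)" .
    have "\<phi> (cj t (y' \<otimes> inv y)) = \<phi> (y' \<otimes> inv y)"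
      by (rule fusion) (use that Pc e[symmetric] in auto)
    hence "\<phi> (inv x') \<otimes>\<^bsub>A\<^esub> \<phi> x = \<phi> y' \<otimes>\<^bsub>A\<^esub> \<phi> (inv y)" using e that Pc by (simp flip: mult)
    hence "(\<phi> x' \<otimes>\<^bsub>A\<^esub> \<phi> (inv x')) \<otimes>\<^bsub>A\<^esub> (\<phi> x \<otimes>\<^bsub>A\<^esub> \<phi> y) = (\<phi> y \<otimes>\<^bsub>A\<^esub> \<phi> (inv y)) \<otimes>\<^bsub>A\<^esub> (\<phi> x' \<otimes>\<^bsub>A\<^esub> \<phi> y')"
      using that Pc \<phi> by (smt (verit) A.m_assoc A.m_comm A.m_closed)
    thus ?thesis using that Pc \<phi> by (simp add: inv\<phi>)
  qed
  have F: "F g = \<phi> x \<otimes>\<^bsub>A\<^esub> \<phi> y" if "g \<in> H" "x \<in> P" "y \<in> P" "g = x \<otimes> r g \<otimes> y" for g x y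
    unfolding F_def
  proof (rule the_equality)
    show "\<exists>x' y'. x' \<in> P \<and> y' \<in> P \<and> g = x' \<otimes> r g \<otimes> y' \<and> \<phi> x \<otimes>\<^bsub>A\<^esub> \<phi> y = \<phi> x' \<otimes>\<^bsub>A\<^esub> \<phi> y'"
      using that by blast
    fix a assume "\<exists>x' y'. x' \<in> P \<and> y' \<in> P \<and> g = x' \<otimes> r g \<otimes> y' \<and> a = \<phi> x' \<otimes>\<^bsub>A\<^esub> \<phi> y'"
    then obtain x' y' where "x' \<in> P" "y' \<in> P" "g = x' \<otimes> r g \<otimes> y'" "a = \<phi> x' \<otimes>\<^bsub>A\<^esub> \<phi> y'" by blast
    thus "a = \<phi> x \<otimes>\<^bsub>A\<^esub> \<phi> y" using unique[of x' y' x y "r g"] that rH by simp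
  qed
  have F_eqv: "F (x \<otimes> g \<otimes> y) = \<phi> x \<otimes>\<^bsub>A\<^esub> F g \<otimes>\<^bsub>A\<^esub> \<phi> y" if "x \<in> P" and gH: "g \<in> H" and "y \<in> P" for x g y
  proof -
    obtain a b where ab: "a \<in> P" "b \<in> P" "g = a \<otimes> r g \<otimes> b" using rD[OF gH] by blast
    have req: "r (x \<otimes> g \<otimes> y) = r g" unfolding r_def using Deq that by simp
    have "x \<otimes> g \<otimes> y = x \<otimes> (a \<otimes> r g \<otimes> b) \<otimes> y" using ab(3) by simp
    also have "\<dots> = (x \<otimes> a) \<otimes> r (x \<otimes> g \<otimes> y) \<otimes> (b \<otimes> y)"
      unfolding req using that ab(1,2) rH[OF that(2)] c by (simp add: m_assoc)
    finally have "F (x \<otimes> g \<otimes> y) = \<phi> (x \<otimes> a) \<otimes>\<^bsub>A\<^esub> \<phi> (b \<otimes> y)"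
      using that ab by (intro F) (auto simp: Pc Hc PHD)
    also have "\<dots> = \<phi> x \<otimes>\<^bsub>A\<^esub> (\<phi> a \<otimes>\<^bsub>A\<^esub> \<phi> b) \<otimes>\<^bsub>A\<^esub> \<phi> y"
      using that ab \<phi> by (simp add: mult A.m_assoc)
    also have "\<phi> a \<otimes>\<^bsub>A\<^esub> \<phi> b = F g" using F[OF that(2) ab] by simp
    finally show ?thesis .
  qed
  have FA: "F g \<in> carrier A" if "g \<in> H" for g
    using rD[OF that] F[OF that] \<phi> by fastforce
  have F1: "F (x \<otimes> g) = \<phi> x \<otimes>\<^bsub>A\<^esub> F g" if "x \<in> P" "g \<in> H" for x g
  proof -
    have "\<phi> \<one> = \<one>\<^bsub>A\<^esub>" using inv\<phi>[of \<one>] Pc mult[of \<one> \<one>] by simp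
    thus ?thesis using F_eqv[of x g \<one>] that Pc c FA \<phi> by simp
  qed
  have F2: "F (g \<otimes> y) = F g \<otimes>\<^bsub>A\<^esub> \<phi> y" if "y \<in> P" "g \<in> H" for y g
  proof -
    have "\<phi> \<one> = \<one>\<^bsub>A\<^esub>" using inv\<phi>[of \<one>] Pc mult[of \<one> \<one>] by simp
    thus ?thesis using F_eqv[of \<one> g y] that Pc c FA \<phi> by simp
  qed
  define C where "C = (\<lambda>g. P #> g) ` H"
  define rep where "rep W = (SOME g. g \<in> W)" for W :: "'a set"
  have rep: "\<exists>x\<in>P. rep (P #> g) = x \<otimes> g" if "g \<in> H" for g
  proof -
    have "rep (P #> g) \<in> P #> g" unfolding rep_def
      by (rule someI[of _ g]) (use that P c in \<open>auto intro: rcos_self\<close>)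
    thus ?thesis by (auto simp: r_coset_def)
  qed
  \<comment> \<open>Replacing g by xg with x in P multiplies both values of F by
    \<open>\<phi>\<close> x, which cancels in the commutative A; so any element of the coset may
    serve as \<open>rep\<close>.\<close>
  define q where "q h W = F (rep W \<otimes> h) \<otimes>\<^bsub>A\<^esub> inv\<^bsub>A\<^esub> F (rep W)" for h W
  have q: "q h (P #> g) = F (g \<otimes> h) \<otimes>\<^bsub>A\<^esub> inv\<^bsub>A\<^esub> F g" if gH: "g \<in> H" and "h \<in> H" for g h
  proof -
    obtain x where x: "x \<in> P" "rep (P #> g) = x \<otimes> g" using rep[OF gH] by auto
    have gh: "g \<otimes> h \<in> H" using that Hc by auto
    have "q h (P #> g) = F (x \<otimes> (g \<otimes> h)) \<otimes>\<^bsub>A\<^esub> inv\<^bsub>A\<^esub> F (x \<otimes> g)"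
      unfolding q_def x(2) using x that c by (simp add: m_assoc)
    also have "\<dots> = \<phi> x \<otimes>\<^bsub>A\<^esub> F (g \<otimes> h) \<otimes>\<^bsub>A\<^esub> (inv\<^bsub>A\<^esub> F g \<otimes>\<^bsub>A\<^esub> inv\<^bsub>A\<^esub> \<phi> x)"
      using x that gh FA \<phi> by (simp add: F1 A.inv_mult_group)
    also have "\<dots> = F (g \<otimes> h) \<otimes>\<^bsub>A\<^esub> inv\<^bsub>A\<^esub> F g"
      using x that gh FA \<phi> by (simp add: A.m_comm[of "\<phi> x"] A.m_assoc A.m_comm[of _ "inv\<^bsub>A\<^esub> \<phi> x"])
    finally show ?thesis .
  qed
  have qA: "q h W \<in> carrier A" if "h \<in> H" "W \<in> C" for h W
    using that by (auto simp: C_def q FA Hc)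
  define V where "V h = finprod A (q h) C" for h
  have perm: "(\<lambda>W. W #> h) ` C = C" "inj_on (\<lambda>W. W #> h) C" if "h \<in> H" for h
  proof -
    have sub: "(\<lambda>W. W #> k) ` C \<subseteq> C" if "k \<in> H" for k
      using that c P by (auto simp: C_def coset_mult_assoc subgroup.subset intro!: Hc)
    have undo: "W #> k #> inv k = W" if "k \<in> H" "W \<in> C" for k W
      using that c P by (auto simp: C_def coset_mult_assoc subgroup.subset m_assoc)
    show "inj_on (\<lambda>W. W #> h) C" using undo[OF that] by (rule inj_on_inverseI)
    show "(\<lambda>W. W #> h) ` C = C"
    proof (rule subset_antisym[OF sub[OF that]], rule subsetI)
      fix W assume W: "W \<in> C"
      have "inv h \<in> H" "inv (inv h) = h" using that Hc c by auto
      thus "W \<in> (\<lambda>W. W #> h) ` C" using undo[of "inv h" W] sub[of "inv h"] W by (metis (no_types, lifting) image_eqI image_subset_iff)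
    qed
  qed
  have Cg: "W #> g \<in> C" if "g \<in> H" "W \<in> C" for g W
    using perm(1)[OF that(1)] that(2) by blast
  have "V (g \<otimes> h) = V g \<otimes>\<^bsub>A\<^esub> V h" if "g \<in> H" "h \<in> H" for g h
  proof -
    \<comment> \<open>A telescoping quotient: F(tgh) / F(t) is F(tg) / F(t) times F(tgh) / F(tg).
      Right multiplication by g permutes the cosets, so the product over all of them splits.\<close>
    have split: "q (g \<otimes> h) W = q g W \<otimes>\<^bsub>A\<^esub> q h (W #> g)" if W: "W \<in> C" for W
    proof -
      obtain t where t: "t \<in> H" "W = P #> t" using W by (auto simp: C_def)
      have "W #> g = P #> (t \<otimes> g)" using t c P \<open>g \<in> H\<close> by (simp add: coset_mult_assoc subgroup.subset)
      hence "q h (W #> g) = F (t \<otimes> g \<otimes> h) \<otimes>\<^bsub>A\<^esub> inv\<^bsub>A\<^esub> F (t \<otimes> g)" using q t \<open>g \<in> H\<close> \<open>h \<in> H\<close> Hc by simp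
      moreover have "F (t \<otimes> g) \<in> carrier A" "F (t \<otimes> g \<otimes> h) \<in> carrier A" "F t \<in> carrier A"
        using t \<open>g \<in> H\<close> \<open>h \<in> H\<close> Hc FA by auto
      ultimately show ?thesis using t \<open>g \<in> H\<close> \<open>h \<in> H\<close> Hc q[of t g] q[of t "g \<otimes> h"] c
        by (simp add: A.m_comm[of "F (t \<otimes> g)"] A.m_comm[of "F (t \<otimes> g \<otimes> h)"] m_assoc[symmetric] A.m_assoc)
    qed
    have "V (g \<otimes> h) = finprod A (\<lambda>W. q g W \<otimes>\<^bsub>A\<^esub> q h (W #> g)) C"
      unfolding V_def using split that by (intro A.finprod_cong') (auto simp: Pi_def qA Hc Cg)
    also have "\<dots> = V g \<otimes>\<^bsub>A\<^esub> finprod A (\<lambda>W. q h (W #> g)) C"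
      unfolding V_def using that by (intro A.finprod_multf) (auto simp: Pi_def qA Cg)
    also have "finprod A (\<lambda>W. q h (W #> g)) C = finprod A (q h) ((\<lambda>W. W #> g) ` C)"
      using that perm[OF that(1)] by (intro A.finprod_reindex[symmetric]) (auto simp: Pi_def qA)
    finally show ?thesis unfolding V_def perm(1)[OF that(1)] .
  qed
  moreover have "V h \<in> carrier A" if "h \<in> H" for h
    unfolding V_def using qA that by (intro A.finprod_closed) (auto simp: Pi_def)
  moreover have "V x = \<phi> x [^]\<^bsub>A\<^esub> (card H div card P)" if x: "x \<in> P" for x
  proof -
    have xH: "x \<in> H" using x PH by auto
    have "q x W = \<phi> x" if W: "W \<in> C" for W
    proof -
      obtain t where t: "t \<in> H" "W = P #> t" using W by (auto simp: C_def)
      have "q x W = F t \<otimes>\<^bsub>A\<^esub> \<phi> x \<otimes>\<^bsub>A\<^esub> inv\<^bsub>A\<^esub> F t" using q[OF t(1) xH] F2[OF x t(1)] t by simp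
      thus ?thesis using FA[OF t(1)] \<phi>[OF x] by (simp add: A.m_comm[of _ "\<phi> x"] A.m_assoc)
    qed
    hence "V x = finprod A (\<lambda>_. \<phi> x) C"
      unfolding V_def using \<phi>[OF x] by (intro A.finprod_cong') auto
    also have "\<dots> = \<phi> x [^]\<^bsub>A\<^esub> card C" using \<phi>[OF x] by (rule A.finprod_const)
    also have "card C = card H div card P"
    proof -
      interpret H: group "G\<lparr>carrier := H\<rparr>" using H by (rule subgroup_imp_group)
      have "subgroup P (G\<lparr>carrier := H\<rparr>)" using P H PH by (rule subgroup_incl)
      moreover have "rcosets\<^bsub>G\<lparr>carrier := H\<rparr>\<^esub> P = C" by (auto simp: C_def RCOSETS_def r_coset_def)
      ultimately have "card C * card P = card H" using H.lagrange[of P] by (simp add: order_def)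
      thus ?thesis using card_sub_pos[OF P] by (metis nonzero_mult_div_cancel_right not_gr_zero)
    qed
    finally show ?thesis .
  qed
  ultimately show ?thesis by blast
qed

section \<open>Maximal subgroups of p-groups and normal subgroups of p-power index\<close>

lemma subgroup_commutator_into:
  assumes P: "subgroup P G" and M: "subgroup M G" "M \<subseteq> P" "normalizes P M" and b: "b \<in> P"
  shows "subgroup {a \<in> P. cj a b \<otimes> inv b \<in> M} G"
proof (rule subgroupI)
  have c: "x \<in> carrier G" if "x \<in> P" for x using that P by (simp add: mem_sub)
  have cM: "x \<in> carrier G" if "x \<in> M" for x using that M c by auto
  note Pc = subgroup.m_closed[OF P] subgroup.m_inv_closed[OF P]
  note Mc = subgroup.m_closed[OF M(1)] subgroup.m_inv_closed[OF M(1)]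
  show "{a \<in> P. cj a b \<otimes> inv b \<in> M} \<subseteq> carrier G" using c by auto
  have "\<one> \<in> {a \<in> P. cj a b \<otimes> inv b \<in> M}"
    using b c subgroup.one_closed[OF P] subgroup.one_closed[OF M(1)] by simp
  thus "{a \<in> P. cj a b \<otimes> inv b \<in> M} \<noteq> {}" by blast
  fix a assume a: "a \<in> {a \<in> P. cj a b \<otimes> inv b \<in> M}"
  have "cj (inv a) b \<otimes> inv b = inv (cj (inv a) (cj a b \<otimes> inv b))"
    using a b c by (simp add: word_simps)
  moreover have "\<dots> \<in> M" using a Pc by (auto intro!: Mc normalizesD[OF M(3)])
  ultimately show "inv a \<in> {a \<in> P. cj a b \<otimes> inv b \<in> M}" using a Pc by simp
  fix a' assume a': "a' \<in> {a \<in> P. cj a b \<otimes> inv b \<in> M}"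
  \<comment> \<open>Mapping a to [a, b] is a crossed homomorphism; as P normalizes M, being sent
    into M is preserved by products.\<close>
  have "cj (a \<otimes> a') b \<otimes> inv b = cj a (cj a' b \<otimes> inv b) \<otimes> (cj a b \<otimes> inv b)"
    using a a' b c by (simp add: word_simps)
  moreover have "\<dots> \<in> M" using a a' Pc by (auto intro!: Mc normalizesD[OF M(3)])
  ultimately show "a \<otimes> a' \<in> {a \<in> P. cj a b \<otimes> inv b \<in> M}" using a a' Pc by simp
qed

text \<open>M is maximal among the proper subgroups above U, hence normal because normalizers grow.
  That P / M is abelian is seen without the quotient: P is generated by M and one g; [g, g] = 1 puts
  all [b, g] into M, inverting gives all [g, b], and generation by M and g then gives all
  [a, b].\<close>

lemma pgr_maximal_normal:
  assumes p: "Factorial_Ring.prime p" and P: "pgr p P" and U: "subgroup U G" "U \<subset> P"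
  shows "\<exists>M. subgroup M G \<and> U \<subseteq> M \<and> M \<subset> P \<and> normalizes P M \<and> (\<forall>a\<in>P. \<forall>b\<in>P. cj a b \<otimes> inv b \<in> M)"
proof -
  have Ps: "subgroup P G" using P by (rule pgr_subgroup)
  have c: "x \<in> carrier G" if "x \<in> P" for x using that Ps by (simp add: mem_sub)
  let ?Q = "\<lambda>M. subgroup M G \<and> U \<subseteq> M \<and> M \<subset> P"
  have "finite {M. ?Q M}" using fin_sub[OF Ps] by (auto intro: finite_subset[of _ "Pow P"])
  moreover have "U \<in> {M. ?Q M}" using U by auto
  ultimately obtain M where M: "M \<in> {M. ?Q M}" and max: "\<forall>N\<in>{M. ?Q M}. M \<subseteq> N \<longrightarrow> M = N"
    using finite_has_maximal[of "{M. ?Q M}"] by blast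
  have Ms: "subgroup M G" and MP: "M \<subset> P" "M \<subseteq> P" using M by auto
  have top: "N = P" if "subgroup N G" "N \<subseteq> P" "M \<subset> N" for N using that max M by blast
  obtain g where g: "g \<in> P" "g \<notin> M" "\<forall>m\<in>M. cj g m \<in> M"
    using normalizer_grows[OF p P Ms MP(1)] by auto
  have "nrm P M = P"
  proof (rule top)
    show "subgroup (nrm P M) G" by (rule subgroup_nrm[OF Ps subgroup.subset[OF Ms]])
    show "M \<subset> nrm P M" using subgroup_subset_nrm[OF Ms MP(2)] g by (auto simp: nrm_def)
  qed (rule nrm_subset)
  hence norm: "normalizes P M" using normalizes_nrm by metis
  have inM: "cj m b \<otimes> inv b \<in> M" if "m \<in> M" "b \<in> P" for m b
  proof -
    have "cj m b \<otimes> inv b = m \<otimes> cj b (inv m)" using that MP c by (auto simp: word_simps)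
    also have "\<dots> \<in> M" using that
      by (auto intro!: subgroup.m_closed[OF Ms] subgroup.m_inv_closed[OF Ms] normalizesD[OF norm])
    finally show ?thesis .
  qed
  have gen: "{a \<in> P. cj a b \<otimes> inv b \<in> M} = P" if "b \<in> P" "cj g b \<otimes> inv b \<in> M" for b
    using that inM MP g by (intro top subgroup_commutator_into[OF Ps Ms MP(2) norm]) auto
  have gg: "cj g g \<otimes> inv g \<in> M" using g c subgroup.one_closed[OF Ms] by (simp add: word_simps)
  have "cj g b \<otimes> inv b \<in> M" if "b \<in> P" for b
  proof -
    have "cj b g \<otimes> inv g \<in> M" using gen[OF g(1) gg] that by blast
    hence "inv (cj b g \<otimes> inv g) \<in> M" by (rule subgroup.m_inv_closed[OF Ms])
    moreover have "inv (cj b g \<otimes> inv g) = cj g b \<otimes> inv b" using g that c by (simp add: word_simps)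
    ultimately show ?thesis by simp
  qed
  hence "cj a b \<otimes> inv b \<in> M" if "a \<in> P" "b \<in> P" for a b using gen that by blast
  thus ?thesis using Ms M norm by blast
qed

text \<open>\<open>N\<close> is the kernel of the transfer from \<open>H\<close> into \<open>P / M\<close>.\<close>

lemma normal_subgroup_of_fusion:
  assumes p: "Factorial_Ring.prime p" and P: "syl p P H" and M: "subgroup M G" "M \<subseteq> P" "normalizes P M"
    and ab: "\<And>a b. a \<in> P \<Longrightarrow> b \<in> P \<Longrightarrow> cj a b \<otimes> inv b \<in> M"
    and fusion: "\<And>x g. x \<in> P \<Longrightarrow> g \<in> H \<Longrightarrow> cj g x \<in> P \<Longrightarrow> cj g x \<otimes> inv x \<in> M"
  shows "\<exists>N. subgroup N G \<and> N \<subseteq> H \<and> normalizes H N \<and> M \<subseteq> N \<and> N \<inter> P = M \<and> card H * card M = card N * card P"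
proof -
  have Ps: "subgroup P G" and Hs: "subgroup H G" and PH: "P \<subseteq> H" using sylD[OF P] by auto
  have c: "x \<in> carrier G" if "x \<in> H" for x using that Hs by (simp add: mem_sub)
  note Hc = subgroup.m_closed[OF Hs] subgroup.m_inv_closed[OF Hs] subgroup.one_closed[OF Hs]
  note Pc = subgroup.m_closed[OF Ps] subgroup.m_inv_closed[OF Ps] subgroup.one_closed[OF Ps]
  let ?P = "G\<lparr>carrier := P\<rparr>"
  interpret P: group ?P using Ps by (rule subgroup_imp_group)
  have invP: "inv\<^bsub>?P\<^esub> x = inv x" if "x \<in> P" for x using m_inv_consistent[OF Ps that] .
  have Mn: "M \<lhd> ?P"
  proof (rule P.normal_invI)
    show "subgroup M ?P" using M Ps by (intro subgroup_incl) auto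
    show "x \<otimes>\<^bsub>?P\<^esub> h \<otimes>\<^bsub>?P\<^esub> inv\<^bsub>?P\<^esub> x \<in> M" if "x \<in> carrier ?P" "h \<in> M" for x h
      using normalizesD[OF M(3), of x h] that invP[of x] by (simp add: cj_def)
  qed
  interpret M: normal M ?P by (rule Mn)
  let ?A = "?P Mod M"
  define \<phi> where "\<phi> x = M #> x" for x
  have one: "\<one>\<^bsub>?A\<^esub> = M" by simp
  have \<phi>A: "\<phi> x \<in> carrier ?A" if "x \<in> P" for x
    using that by (auto simp: \<phi>_def carrier_FactGroup)
  have Ae: "\<exists>x\<in>P. a = \<phi> x" if "a \<in> carrier ?A" for a
    using that by (auto simp: \<phi>_def carrier_FactGroup)
  have mult: "\<phi> (x \<otimes> y) = \<phi> x \<otimes>\<^bsub>?A\<^esub> \<phi> y" if "x \<in> P" "y \<in> P" for x y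
    using M.rcos_sum[of x y] that by (simp add: \<phi>_def)
  have Mc: "x \<in> carrier G" if "x \<in> M" for x using that M PH c by auto
  have \<phi>M: "\<phi> x = M \<longleftrightarrow> x \<in> M" if "x \<in> P" for x
    using that PH c M(1) unfolding \<phi>_def
    by (metis coset_join1 coset_join2 in_mono subgroup.subset)
  have \<phi>eq: "\<phi> x = \<phi> y" if "x \<in> P" "y \<in> P" "x \<otimes> inv y \<in> M" for x y
  proof -
    have "x = (x \<otimes> inv y) \<otimes> y" using that(1,2) PH c by (simp add: m_assoc subsetD)
    hence "x \<in> M #> y" using that(3) unfolding r_coset_def by blast
    thus ?thesis unfolding \<phi>_def using that PH c M(1) by (metis repr_independence in_mono)
  qed
  have comm: "comm_group ?A"
  proof (rule group.group_comm_groupI)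
    show "group ?A" by (rule M.factorgroup_is_group)
    fix u v assume "u \<in> carrier ?A" "v \<in> carrier ?A"
    then obtain x y where xy: "x \<in> P" "y \<in> P" "u = \<phi> x" "v = \<phi> y" using Ae by blast
    have "x \<in> carrier G" "y \<in> carrier G" using xy PH c by auto
    hence "x \<otimes> y \<otimes> inv (y \<otimes> x) = cj x y \<otimes> inv y" by (simp add: word_simps)
    hence "\<phi> (x \<otimes> y) = \<phi> (y \<otimes> x)" using xy Pc ab by (intro \<phi>eq) auto
    thus "u \<otimes>\<^bsub>?A\<^esub> v = v \<otimes>\<^bsub>?A\<^esub> u" using xy by (simp add: mult del: mult_FactGroup)
  qed
  interpret A: comm_group ?A by (rule comm)
  have fus: "\<phi> (cj g x) = \<phi> x" if "x \<in> P" "g \<in> H" "cj g x \<in> P" for x g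
    using fusion[OF that] that by (intro \<phi>eq) auto
  have "\<exists>V. (\<forall>h\<in>H. V h \<in> carrier ?A) \<and> (\<forall>g\<in>H. \<forall>h\<in>H. V (g \<otimes> h) = V g \<otimes>\<^bsub>?A\<^esub> V h) \<and>
    (\<forall>x\<in>P. V x = \<phi> x [^]\<^bsub>?A\<^esub> (card H div card P))"
    by (rule transfer[where \<phi> = \<phi>, OF comm Ps Hs PH \<phi>A mult fus])
  then obtain V where *: "(\<forall>h\<in>H. V h \<in> carrier ?A) \<and> (\<forall>g\<in>H. \<forall>h\<in>H. V (g \<otimes> h) = V g \<otimes>\<^bsub>?A\<^esub> V h) \<and>
    (\<forall>x\<in>P. V x = \<phi> x [^]\<^bsub>?A\<^esub> (card H div card P))" ..
  have V: "\<And>h. h \<in> H \<Longrightarrow> V h \<in> carrier ?A"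
     "\<And>g h. g \<in> H \<Longrightarrow> h \<in> H \<Longrightarrow> V (g \<otimes> h) = V g \<otimes>\<^bsub>?A\<^esub> V h"
     "\<And>x. x \<in> P \<Longrightarrow> V x = \<phi> x [^]\<^bsub>?A\<^esub> (card H div card P)"
    using * by (blast, blast, blast)
  let ?n = "card H div card P"
  have V1: "V \<one> = \<one>\<^bsub>?A\<^esub>"
    using V(1)[of \<one>] V(2)[of \<one> \<one>] Hc by (simp del: mult_FactGroup one_FactGroup)
  have Vinv: "V (inv h) = inv\<^bsub>?A\<^esub> V h" if "h \<in> H" for h
    using V(2)[of "inv h" h] V1 V(1) that Hc c by (intro A.inv_equality[symmetric]) (auto simp del: mult_FactGroup one_FactGroup)
  define N where "N = {h \<in> H. V h = \<one>\<^bsub>?A\<^esub>}"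
  have Ns: "subgroup N G"
  proof (rule subgroupI)
    show "N \<subseteq> carrier G" using c by (auto simp: N_def)
    show "N \<noteq> {}" using V1 Hc by (auto simp: N_def)
    show "inv a \<in> N" if "a \<in> N" for a using that Vinv Hc by (simp add: N_def del: one_FactGroup)
    show "a \<otimes> b \<in> N" if "a \<in> N" "b \<in> N" for a b
      using that V(2) Hc by (simp add: N_def del: one_FactGroup mult_FactGroup)
  qed
  have Nn: "normalizes H N"
    unfolding normalizes_def
  proof (intro ballI)
    fix h n assume h: "h \<in> H" and n: "n \<in> N"
    have nH: "n \<in> H" and Vn: "V n = \<one>\<^bsub>?A\<^esub>" using n by (auto simp: N_def)
    have "V (cj h n) = V h \<otimes>\<^bsub>?A\<^esub> V n \<otimes>\<^bsub>?A\<^esub> V (inv h)"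
      using V(2) h nH Hc by (simp add: cj_def del: mult_FactGroup)
    also have "\<dots> = \<one>\<^bsub>?A\<^esub>"
      unfolding Vn Vinv[OF h] using V(1)[OF h] by (simp del: one_FactGroup mult_FactGroup)
    finally show "cj h n \<in> N" using h nH Hc by (simp add: N_def cj_def del: one_FactGroup)
  qed
  obtain k where k: "card P = p ^ k" using sylD(1)[OF P] by (auto simp: pgr_def)
  have ordA: "order ?A dvd p ^ k"
  proof -
    have "order ?A * card M = card P" using P.lagrange[OF M.is_subgroup] by (simp add: order_def FactGroup_def)
    thus ?thesis unfolding k[symmetric] by (rule dvdI[OF sym])
  qed
  have powk: "a [^]\<^bsub>?A\<^esub> (p ^ k) = \<one>\<^bsub>?A\<^esub>" if "a \<in> carrier ?A" for a
  proof -
    obtain t where "p ^ k = order ?A * t" using ordA by auto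
    thus ?thesis using that A.pow_order_eq_1[OF that] by (simp add: A.nat_pow_pow[symmetric] del: one_FactGroup)
  qed
  have cop: "coprime ?n (p ^ k)"
    using P p unfolding syl_def by (metis coprime_commute coprime_power_right_iff prime_imp_coprime)
  moreover have "?n \<noteq> 0" using P unfolding syl_def by (metis dvd_0_right)
  \<comment> \<open>m inverts the index \<open>?n\<close> modulo p ^ k, so m-th powers undo
    \<open>?n\<close>-th powers in P / M.\<close>
  ultimately obtain m y where m: "?n * m = p ^ k * y + 1" using bezout_nat[of ?n "p ^ k"] by auto
  have root: "(a [^]\<^bsub>?A\<^esub> ?n) [^]\<^bsub>?A\<^esub> m = a" if a: "a \<in> carrier ?A" for a
  proof -
    have "a [^]\<^bsub>?A\<^esub> (p ^ k * y) = \<one>\<^bsub>?A\<^esub>"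
      using powk[OF a] a by (simp add: A.nat_pow_pow[symmetric] del: one_FactGroup)
    hence "a [^]\<^bsub>?A\<^esub> (?n * m) = a"
      unfolding m using A.nat_pow_mult[OF a, of "p ^ k * y" 1] a by (simp del: mult_FactGroup one_FactGroup)
    thus ?thesis using a by (simp add: A.nat_pow_pow)
  qed
  have NP: "N \<inter> P = M"
  proof
    show "N \<inter> P \<subseteq> M"
    proof
      fix x assume x: "x \<in> N \<inter> P"
      have "\<phi> x = (\<phi> x [^]\<^bsub>?A\<^esub> ?n) [^]\<^bsub>?A\<^esub> m" using root \<phi>A x by simp
      also have "\<phi> x [^]\<^bsub>?A\<^esub> ?n = \<one>\<^bsub>?A\<^esub>" using x V(3) by (auto simp: N_def)
      finally have "\<phi> x = M" by (simp add: A.nat_pow_one del: one_FactGroup) (simp add: one)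
      thus "x \<in> M" using \<phi>M x by auto
    qed
    show "M \<subseteq> N \<inter> P"
    proof
      fix x assume x: "x \<in> M"
      hence "\<phi> x = \<one>\<^bsub>?A\<^esub>" using \<phi>M[of x] M by auto
      hence "V x = \<one>\<^bsub>?A\<^esub>" using V(3)[of x] x M by (auto simp del: one_FactGroup)
      thus "x \<in> N \<inter> P" using x M PH by (auto simp: N_def)
    qed
  qed
  have "H \<subseteq> N <#> P"
  proof
    fix h assume h: "h \<in> H"
    obtain y where y: "y \<in> P" "V h = \<phi> y" using Ae[OF V(1)[OF h]] by auto
    have pw: "y [^] j \<in> P \<and> \<phi> (y [^] j) = \<phi> y [^]\<^bsub>?A\<^esub> j" for j :: nat
    proof (induction j)
      case 0
      have "\<phi> \<one> = M" using \<phi>M Pc subgroup.one_closed[OF M(1)] by blast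
      thus ?case using Pc by simp
    next
      case (Suc j)
      thus ?case using y Pc by (simp add: mult del: mult_FactGroup)
    qed
    \<comment> \<open>The transfer of this power of y is \<open>\<phi>\<close> y again, so V takes
      each of its values already on P; hence H = NP.\<close>
    let ?x = "y [^] m"
    have "V ?x = (\<phi> y [^]\<^bsub>?A\<^esub> m) [^]\<^bsub>?A\<^esub> ?n" using V(3) pw by simp
    also have "\<dots> = (\<phi> y [^]\<^bsub>?A\<^esub> ?n) [^]\<^bsub>?A\<^esub> m" using \<phi>A[OF y(1)] by (simp add: A.nat_pow_pow mult.commute)
    also have "\<dots> = V h" using root \<phi>A y by simp
    finally have Vx: "V ?x = V h" .
    have xH: "?x \<in> H" "?x \<in> P" using pw PH by auto
    have "V (h \<otimes> inv ?x) = \<one>\<^bsub>?A\<^esub>"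
      using V(2)[of h "inv ?x"] Vinv[of ?x] Vx V(1)[OF h] h xH Hc by (simp del: mult_FactGroup one_FactGroup)
    hence "h \<otimes> inv ?x \<in> N" using h xH Hc by (simp add: N_def)
    moreover have "h = (h \<otimes> inv ?x) \<otimes> ?x" using h xH c by (simp add: m_assoc)
    ultimately show "h \<in> N <#> P" using xH by (auto simp: set_mult_iff)
  qed
  moreover have "N <#> P \<subseteq> H" using PH by (intro set_mult_subset[OF Hs]) (auto simp: N_def)
  ultimately have "N <#> P = H" by auto
  hence "card H * card M = card N * card P" using card_set_mult[OF Ns Ps] NP by simp
  thus ?thesis using Ns Nn NP by (auto simp: N_def intro!: exI[of _ N])
qed

end

section \<open>Frobenius' criterion relative to a normal subgroup\<close>

context fin_group begin

text \<open>For \<open>U = {\<one>}\<close> the subgroup \<open>K\<close> is a normal \<open>p\<close>-complement of \<open>H\<close>.\<close>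

definition rel_complement :: "nat \<Rightarrow> 'a set \<Rightarrow> 'a set \<Rightarrow> 'a set \<Rightarrow> bool" where
  "rel_complement p U K H \<longleftrightarrow> subgroup H G \<and> K \<subseteq> H \<and> normalizes H K \<and> syl p U K \<and>
     (\<exists>n. card H = card K * p ^ n)"

definition pnil :: "nat \<Rightarrow> 'a set \<Rightarrow> bool" where
  "pnil p H \<longleftrightarrow> (\<exists>K. rel_complement p {\<one>} K H)"

lemma pgr_one: "pgr p {\<one>}"
  by (auto simp: pgr_def triv_subgroup intro: exI[of _ 0])

lemma syl_one_iff: "syl p {\<one>} K \<longleftrightarrow> subgroup K G \<and> \<not> p dvd card K"
  by (auto simp: syl_def pgr_one subgroup.one_closed)

lemma rel_complementD:
  assumes "rel_complement p U K H"
  shows "subgroup H G" "subgroup K G" "K \<subseteq> H" "normalizes H K" "syl p U K" "subgroup U G" "U \<subseteq> K" "pgr p U"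
  using assms by (auto simp: rel_complement_def dest: sylD)

lemma normalizes_mono: "normalizes H S \<Longrightarrow> L \<subseteq> H \<Longrightarrow> normalizes L S"
  by (auto simp: normalizes_def)

text \<open>H / K is a p-group, and L / (K \<inter> L) embeds in it as KL / K; p ^ m is their common
  order.\<close>

lemma normal_p_index_product:
  assumes p: "Factorial_Ring.prime p" and K: "subgroup K G" "K \<subseteq> H" "normalizes H K"
    and H: "subgroup H G" "card H = card K * p ^ n" and L: "subgroup L G" "L \<subseteq> H"
  shows "\<exists>m. card L = p ^ m * card (K \<inter> L) \<and> card (K <#> L) = card K * p ^ m"
proof -
  have KL: "subgroup (K <#> L) G" using K L by (intro subgroup_set_mult normalizes_mono[OF K(3)])
  have "card (K <#> L) dvd card H"
    using K L H KL by (intro card_sub_dvd set_mult_subset) auto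
  moreover have "card K dvd card (K <#> L)"
    using K L KL by (intro card_sub_dvd subset_set_mult1) auto
  then obtain t where t: "card (K <#> L) = card K * t" by auto
  ultimately have "t dvd p ^ n" using H card_sub_pos[OF K(1)] by simp
  then obtain m where "t = p ^ m" using p by (auto simp: divides_primepow_nat)
  moreover have "card K * (t * card (K \<inter> L)) = card K * card L"
    using card_set_mult[OF K(1) L(1)] t by (simp add: mult.assoc)
  ultimately show ?thesis using t card_sub_pos[OF K(1)] by (intro exI[of _ m]) auto
qed

text \<open>The index of K \<inter> L in L is a power of p and divides the index of U in L, so it is
  1. Thus K is the largest subgroup of H above U in which U has index prime to p, and is determined
  by U.\<close>

lemma subset_rel_complement:
  assumes p: "Factorial_Ring.prime p" and K: "rel_complement p U K H"
    and L: "subgroup L G" "L \<subseteq> H" "U \<subseteq> L" "\<not> p dvd card L div card U"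
  shows "L \<subseteq> K"
proof -
  obtain n where "card H = card K * p ^ n" using K by (auto simp: rel_complement_def)
  then obtain m where m: "card L = p ^ m * card (K \<inter> L)"
    using normal_p_index_product[OF p rel_complementD(2-4)[OF K] rel_complementD(1)[OF K] _ L(1,2)] by blast
  have sI: "subgroup (K \<inter> L) G" using rel_complementD(2)[OF K] L(1) by (rule subgroups_Inter_pair)
  have "card U dvd card (K \<inter> L)"
    using rel_complementD[OF K] L sI by (intro card_sub_dvd) auto
  then obtain s where s: "card (K \<inter> L) = card U * s" by auto
  have "card L div card U = p ^ m * s"
    using m s card_sub_pos[OF rel_complementD(6)[OF K]] by (simp add: mult.left_commute)
  hence "m = 0" using L(4) by (cases m) auto
  hence "card (K \<inter> L) = card L" using m by simp
  hence "K \<inter> L = L" using fin_sub[OF L(1)] by (intro card_subset_eq) auto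
  thus ?thesis by auto
qed

text \<open>A conjugate of K under H again contains U with index prime to p, hence lies in
  K.\<close>

lemma rel_complement_normal_extend:
  assumes p: "Factorial_Ring.prime p" and K: "rel_complement p U K N"
    and H: "subgroup H G" "N \<subseteq> H" "normalizes H N" "normalizes H U" "card H = card N * p ^ n"
  shows "rel_complement p U K H"
proof -
  note Kd = rel_complementD[OF K]
  have "normalizes H K"
    unfolding normalizes_def
  proof (intro ballI)
    fix h k assume h: "h \<in> H" and k: "k \<in> K"
    have hG: "h \<in> carrier G" using h H mem_sub by auto
    have cs: "card (cj h ` K) = card K" using hG Kd by (simp add: card_cj_image subgroup.subset)
    have "cj h ` U = U" using hG Kd H h by (intro cj_image_eq) (auto simp: subgroup.subset normalizes_def)
    hence "U \<subseteq> cj h ` K" using Kd(7) by (metis image_mono)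
    hence "cj h ` K \<subseteq> K"
      using Kd H h hG cs by (intro subset_rel_complement[OF p K] subgroup_cj_image)
        (auto simp: syl_def normalizes_def)
    thus "cj h k \<in> K" using k by auto
  qed
  moreover obtain m where "card N = card K * p ^ m" using K by (auto simp: rel_complement_def)
  hence "card H = card K * p ^ (m + n)" using H by (simp add: power_add)
  ultimately show ?thesis using Kd H unfolding rel_complement_def by blast
qed

lemma pnil_extend:
  assumes p: "Factorial_Ring.prime p" and N: "pnil p N"
    and H: "subgroup H G" "N \<subseteq> H" "normalizes H N" "card H = card N * p ^ n"
  shows "pnil p H"
proof -
  obtain K where "rel_complement p {\<one>} K N" using N by (auto simp: pnil_def)
  moreover have "normalizes H {\<one>}" using H(1) by (auto simp: normalizes_def mem_sub)
  ultimately have "rel_complement p {\<one>} K H"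
    using rel_complement_normal_extend[OF p _ H(1-3) _ H(4)] by blast
  thus ?thesis by (auto simp: pnil_def)
qed

lemma pnil_mono:
  assumes p: "Factorial_Ring.prime p" and H: "pnil p H" and L: "subgroup L G" "L \<subseteq> H"
  shows "pnil p L"
proof -
  obtain K where K: "rel_complement p {\<one>} K H" using H by (auto simp: pnil_def)
  note Kd = rel_complementD[OF K]
  obtain n where "card H = card K * p ^ n" using K by (auto simp: rel_complement_def)
  then obtain m where m: "card L = p ^ m * card (K \<inter> L)"
    using normal_p_index_product[OF p Kd(2-4) Kd(1) _ L(1,2)] by blast
  have sI: "subgroup (K \<inter> L) G" using Kd(2) L(1) by (rule subgroups_Inter_pair)
  have "card (K \<inter> L) dvd card K" using sI Kd by (intro card_sub_dvd) auto
  moreover have "\<not> p dvd card K" using Kd(5) by (simp add: syl_one_iff)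
  ultimately have "\<not> p dvd card (K \<inter> L)" by (meson dvd_trans)
  moreover have "normalizes L (K \<inter> L)"
    using Kd(4) L normalizes_self[OF L(1)] by (auto simp: normalizes_def)
  ultimately have "rel_complement p {\<one>} (K \<inter> L) L"
    using L sI m by (auto simp: rel_complement_def syl_one_iff mult.commute)
  thus ?thesis by (auto simp: pnil_def)
qed

lemma subgroup_inter_trivial:
  assumes "subgroup A G" "subgroup B G" "coprime (card A) (card B)" "x \<in> A" "x \<in> B"
  shows "x = \<one>"
proof -
  have s: "subgroup (A \<inter> B) G" using assms by (intro subgroups_Inter_pair)
  have "card (A \<inter> B) dvd card A" "card (A \<inter> B) dvd card B" using s assms by (auto intro!: card_sub_dvd)
  hence "card (A \<inter> B) = 1" using assms(3) by (metis coprime_common_divisor nat_dvd_1_iff_1)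
  then obtain z where "A \<inter> B = {z}" by (auto simp: card_1_singleton_iff)
  thus ?thesis using subgroup.one_closed[OF s] assms(4,5) by (metis IntI singletonD)
qed

lemma pgr_coprime:
  assumes "Factorial_Ring.prime p" "pgr p A" "\<not> p dvd n"
  shows "coprime n (card A)"
  using assms by (auto simp: pgr_def) (metis coprime_commute coprime_power_right_iff prime_imp_coprime)

text \<open>K and D are normal in N and of coprime orders, so [K, D] lies in K \<inter> D =
  1.\<close>

lemma complement_centralizes:
  assumes p: "Factorial_Ring.prime p" and K: "rel_complement p {\<one>} K N"
    and D: "pgr p D" "D \<subseteq> N" "normalizes N D" and k: "k \<in> K" and d: "d \<in> D"
  shows "cj k d = d"
proof -
  note Kd = rel_complementD[OF K]
  have Ds: "subgroup D G" using D by (simp add: pgr_def)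
  have c: "k \<in> carrier G" "d \<in> carrier G" using k d Ds Kd mem_sub by blast+
  have "cj k d \<otimes> inv d = k \<otimes> cj d (inv k)" using c by (simp add: word_simps)
  moreover have "k \<otimes> cj d (inv k) \<in> K"
    using k d D Kd by (auto intro!: subgroup.m_closed[OF Kd(2)] normalizesD[OF Kd(4)] subgroup.m_inv_closed[OF Kd(2)])
  moreover have "cj k d \<otimes> inv d \<in> D"
    using k d D Kd by (auto intro!: subgroup.m_closed[OF Ds] normalizesD[OF D(3)] subgroup.m_inv_closed[OF Ds])
  moreover have "coprime (card K) (card D)" using Kd(5) p D by (intro pgr_coprime) (auto simp: syl_one_iff)
  ultimately have "cj k d \<otimes> inv d = \<one>" using subgroup_inter_trivial[OF Kd(2) Ds] by metis
  thus ?thesis using c by (metis cj_closed inv_closed inv_equality inv_inv)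
qed

lemma pnil_centralizes:
  assumes p: "Factorial_Ring.prime p" and N: "pnil p N" and R: "subgroup R G" "R \<subseteq> N" "\<not> p dvd card R"
    and D: "pgr p D" "D \<subseteq> N" "normalizes N D" and k: "k \<in> R" and d: "d \<in> D"
  shows "cj k d = d"
proof -
  obtain K where K: "rel_complement p {\<one>} K N" using N by (auto simp: pnil_def)
  have "R \<subseteq> K" using R subgroup.one_closed[OF R(1)] by (intro subset_rel_complement[OF p K]) auto
  thus ?thesis using complement_centralizes[OF p K D] k d by auto
qed

text \<open>The form in which p-nilpotency enters fusion arguments: N = KS by orders, and the
  complement K centralizes D, so N acts on D through S.\<close>

lemma pnil_factor:
  assumes p: "Factorial_Ring.prime p" and N: "pnil p N" and S: "syl p S N"
    and D: "pgr p D" "D \<subseteq> N" "normalizes N D" and n: "n \<in> N"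
  shows "\<exists>k\<in>N. \<exists>s\<in>S. n = k \<otimes> s \<and> (\<forall>d\<in>D. cj k d = d)"
proof -
  obtain K where K: "rel_complement p {\<one>} K N" using N by (auto simp: pnil_def)
  note Kd = rel_complementD[OF K]
  obtain t where t: "card N = card K * p ^ t" using K by (auto simp: rel_complement_def)
  then obtain m where m: "card S = p ^ m * card (K \<inter> S)" "card (K <#> S) = card K * p ^ m"
    using normal_p_index_product[OF p Kd(2-4) Kd(1) _ sylD(2,4)[OF S]] by blast
  have cop: "coprime (card K) (card S)" using Kd(5) p sylD(1)[OF S] by (intro pgr_coprime) (auto simp: syl_one_iff)
  have "K \<inter> S = {\<one>}"
    using subgroup_inter_trivial[OF Kd(2) sylD(2)[OF S] cop] subgroup.one_closed[OF Kd(2)]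
      subgroup.one_closed[OF sylD(2)[OF S]] by blast
  hence mS: "card S = p ^ m" using m by simp
  have "m \<ge> t"
  proof (rule ccontr)
    assume "\<not> m \<ge> t"
    then obtain j where "t = m + Suc j" by (metis add_Suc_right less_imp_Suc_add not_le)
    hence "card N div card S = p * (card K * p ^ j)" using t mS p by (simp add: power_add prime_gt_0_nat mult.left_commute)
    thus False using S by (auto simp: syl_def)
  qed
  hence "card N \<le> card (K <#> S)" using t m p by (auto intro!: power_increasing simp: prime_ge_1_nat Suc_leI prime_gt_0_nat)
  moreover have "K <#> S \<subseteq> N" using Kd sylD[OF S] by (intro set_mult_subset) auto
  ultimately have "K <#> S = N" using fin_sub[OF Kd(1)] by (intro card_seteq) auto
  then obtain k s where "k \<in> K" "s \<in> S" "n = k \<otimes> s" using n by (auto simp: set_mult_iff)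
  thus ?thesis using complement_centralizes[OF p K D] Kd by blast
qed

section \<open>Fusion modulo a normal p-subgroup\<close>

lemma normal_pgr_subset_syl:
  assumes p: "Factorial_Ring.prime p" and U: "pgr p U" "U \<subseteq> H" "normalizes H U" and S: "syl p S H"
  shows "U \<subseteq> S"
proof -
  obtain h where h: "h \<in> H" "U \<subseteq> cj h ` S" using sylow_contains_conjugate[OF p S U(1,2)] by auto
  have Hs: "subgroup H G" using S by (rule sylD)
  have c: "h \<in> carrier G" "\<And>s. s \<in> S \<Longrightarrow> s \<in> carrier G" using h Hs sylD(2)[OF S] by (auto simp: mem_sub)
  show ?thesis
  proof
    fix u assume u: "u \<in> U"
    have uG: "u \<in> carrier G" using u U Hs mem_sub by blast
    have "cj h u \<in> U" using U h u by (auto simp: normalizes_def)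
    then obtain s where s: "s \<in> S" "cj h u = cj h s" using h by auto
    hence "u = s" using c uG by (metis cj_inv_cj(1))
    thus "u \<in> S" using s by simp
  qed
qed

text \<open>For \<open>U = {\<one>}\<close> this is the key step in the proof of Frobenius' criterion.\<close>

lemma syl_conjugate_fixing_inter:
  assumes p: "Factorial_Ring.prime p" and H: "subgroup H G"
    and U: "pgr p U" "U \<subseteq> H" "normalizes H U"
    and loc: "\<And>V. pgr p V \<Longrightarrow> U \<subset> V \<Longrightarrow> V \<subseteq> H \<Longrightarrow> pnil p (nrm H V)"
  shows "syl p P H \<Longrightarrow> syl p Q H \<Longrightarrow> \<exists>c\<in>H. Q = cj c ` P \<and> (\<forall>d\<in>P \<inter> Q. cj c d \<otimes> inv d \<in> U)"
proof (induction "card P - card (P \<inter> Q)" arbitrary: P Q rule: less_induct)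
  case less
  note P = less.prems(1) and Q = less.prems(2)
  have c: "x \<in> carrier G" if "x \<in> H" for x using that H by (simp add: mem_sub)
  have Us: "subgroup U G" using U by (simp add: pgr_def)
  note Uc = subgroup.m_closed[OF Us] subgroup.one_closed[OF Us]
  define D where "D = P \<inter> Q"
  have Ps: "subgroup P G" "P \<subseteq> H" and Qs: "subgroup Q G" "Q \<subseteq> H" using P Q sylD by auto
  have Ds: "subgroup D G" unfolding D_def using Ps Qs by (intro subgroups_Inter_pair)
  have DH: "D \<subseteq> H" using Ps by (auto simp: D_def)
  have Dp: "pgr p D" using pgr_mono[OF p sylD(1)[OF P] Ds] by (auto simp: D_def)
  have UD: "U \<subseteq> D" using normal_pgr_subset_syl[OF p U] P Q by (auto simp: D_def)
  have cardeq: "card S = card P" if "syl p S H" for S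
    using syl_pgr_card_le[OF p P] syl_pgr_card_le[OF p that] that P sylD by (meson le_antisym)
  \<comment> \<open>The elements acting trivially on D modulo U. They are closed under products
    since H normalizes U, so the conjugating element can be assembled from pieces.\<close>
  define E where "E = {c\<in>H. \<forall>d\<in>D. cj c d \<otimes> inv d \<in> U}"
  have E_mult: "a \<otimes> b \<in> E" if "a \<in> E" "b \<in> E" for a b
  proof -
    have "cj (a \<otimes> b) d \<otimes> inv d \<in> U" if d: "d \<in> D" for d
    proof -
      have "cj (a \<otimes> b) d \<otimes> inv d = cj a (cj b d \<otimes> inv d) \<otimes> (cj a d \<otimes> inv d)"
        using \<open>a \<in> E\<close> \<open>b \<in> E\<close> d DH c by (simp add: word_simps E_def subset_iff)
      moreover have "cj a (cj b d \<otimes> inv d) \<in> U" "cj a d \<otimes> inv d \<in> U"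
        using \<open>a \<in> E\<close> \<open>b \<in> E\<close> d by (auto simp: E_def intro!: normalizesD[OF U(3)])
      ultimately show ?thesis by (simp add: Uc)
    qed
    thus ?thesis using that by (auto simp: E_def intro: subgroup.m_closed[OF H])
  qed
  have EI: "a \<in> E" if "a \<in> H" "\<forall>d\<in>D. cj a d = d" for a
    using that DH c Uc by (auto simp: E_def subset_iff)
  \<comment> \<open>For D = P the two Sylow subgroups coincide, and for D = U triviality modulo U is
    automatic. Only for D strictly in between is local p-nilpotency needed.\<close>
  consider "D = P" | "D = U" | "D \<noteq> P" "D \<noteq> U" by blast
  thus ?case
  proof cases
    case 1
    hence "P = Q" using cardeq[OF Q] fin_sub[OF Qs(1)] by (intro card_subset_eq) (auto simp: D_def)
    thus ?thesis using subgroup.one_closed[OF H] Uc c Ps by (intro bexI[of _ \<one>]) (auto simp: subset_iff image_def)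
  next
    case 2
    obtain a where a: "a \<in> H" "Q = cj a ` P" using syl_conjugate[OF p P Q] by auto
    have "cj a d \<otimes> inv d \<in> U" if "d \<in> U" for d
      using that a by (auto intro!: Uc normalizesD[OF U(3)] subgroup.m_inv_closed[OF Us])
    moreover have "P \<inter> Q = U" using 2 by (simp add: D_def)
    ultimately show ?thesis using a by (intro bexI[of _ a]) simp_all
  next
    case 3
    define N where "N = nrm H D"
    have Ns: "subgroup N G" unfolding N_def using H Ds by (auto intro!: subgroup_nrm subgroup.subset)
    have NH: "N \<subseteq> H" unfolding N_def by (rule nrm_subset)
    have DN: "D \<subseteq> N" unfolding N_def by (rule subgroup_subset_nrm[OF Ds DH])
    have Nn: "normalizes N D" unfolding N_def by (rule normalizes_nrm)
    have pN: "pnil p N" unfolding N_def using Dp UD DH 3 by (intro loc) auto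
    have nP: "pgr p (nrm S D)" "nrm S D \<subseteq> N" "D \<subset> nrm S D" if S: "syl p S H" "D \<subseteq> S" "D \<noteq> S" for S
    proof -
      have "subgroup (nrm S D) G" using sylD(2)[OF S(1)] Ds by (auto intro!: subgroup_nrm subgroup.subset)
      thus "pgr p (nrm S D)" using pgr_mono[OF p sylD(1)[OF S(1)]] nrm_subset by blast
      show "nrm S D \<subseteq> N" using sylD(4)[OF S(1)] by (auto simp: N_def nrm_def)
      have "D \<subseteq> nrm S D" using Ds S by (intro subgroup_subset_nrm)
      moreover obtain g where "g \<in> S - D" "\<forall>q\<in>D. cj g q \<in> D"
        using normalizer_grows[OF p sylD(1)[OF S(1)] Ds] S by auto
      ultimately show "D \<subset> nrm S D" by (auto simp: nrm_def)
    qed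
    have DQ: "D \<noteq> Q"
    proof
      assume "D = Q"
      hence "Q = P" using cardeq[OF Q] fin_sub[OF Ps(1)] by (intro card_subset_eq) (auto simp: D_def)
      thus False using \<open>D = Q\<close> 3 by auto
    qed
    have nrmP: "pgr p (nrm P D)" "nrm P D \<subseteq> N" "D \<subset> nrm P D" using nP[OF P] 3 by (auto simp: D_def)
    have nrmQ: "pgr p (nrm Q D)" "nrm Q D \<subseteq> N" "D \<subset> nrm Q D" using nP[OF Q] DQ by (auto simp: D_def)
    \<comment> \<open>The normalizers of D in P and in Q both exceed D. Sylow subgroups S and T of N
      above them are conjugate by some k centralizing D; so a Sylow subgroup R above S meets P, and
      its conjugate R' under k meets Q, in more than D. The induction hypothesis for (P, R) and for
      (R', Q), joined by k, links P to Q.\<close>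
    obtain S where S: "syl p S N" "nrm P D \<subseteq> S" using syl_extends[OF p nrmP(1,2) Ns] by auto
    obtain T where T: "syl p T N" "nrm Q D \<subseteq> T" using syl_extends[OF p nrmQ(1,2) Ns] by auto
    obtain R where R: "syl p R H" "S \<subseteq> R"
      using syl_extends[OF p sylD(1)[OF S(1)] _ H] sylD(4)[OF S(1)] NH by blast
    obtain n where n: "n \<in> N" "T = cj n ` S" using syl_conjugate[OF p S(1) T(1)] by auto
    obtain k s where k: "k \<in> N" "s \<in> S" "n = k \<otimes> s" "\<forall>d\<in>D. cj k d = d"
      using pnil_factor[OF p pN S(1) Dp DN Nn n(1)] by auto
    have kG: "k \<in> carrier G" "s \<in> carrier G" using k NH c sylD(4)[OF S(1)] by auto
    have Sc: "x \<in> carrier G" if "x \<in> S" for x using that sylD(4)[OF S(1)] NH c by auto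
    have "cj s ` S = S"
      using Sc k by (intro cj_image_eq) (auto intro: normalizesD[OF normalizes_self[OF sylD(2)[OF S(1)]]])
    have "T = cj k ` S"
    proof -
      have "T = (\<lambda>x. cj k (cj s x)) ` S" unfolding n(2) k(3) using kG Sc by (intro image_cong) (auto simp: cj_cj)
      also have "\<dots> = cj k ` cj s ` S" by (simp add: image_image)
      finally show ?thesis using \<open>cj s ` S = S\<close> by simp
    qed
    define R' where "R' = cj k ` R"
    have R': "syl p R' H" unfolding R'_def using R k NH by (intro syl_cj) auto
    have TR': "T \<subseteq> R'" unfolding R'_def \<open>T = cj k ` S\<close> using R by auto
    have finP: "finite P" "finite Q" "finite R'" using fin_sub Ps Qs sylD(2)[OF R'] by auto
    have lt1: "D \<subset> P \<inter> R"
      using nrmP(3) S(2) R(2) nrm_subset[of P D] by blast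
    have lt2: "D \<subset> R' \<inter> Q"
      using nrmQ(3) T(2) TR' nrm_subset[of Q D] by blast
    have l1: "card D < card (P \<inter> R)" "card (P \<inter> R) \<le> card P" "card D < card (R' \<inter> Q)" "card (R' \<inter> Q) \<le> card R'"
      using lt1 lt2 finP by (auto intro!: psubset_card_mono card_mono)
    have "card P - card (P \<inter> R) < card P - card (P \<inter> Q)" using l1 by (simp add: D_def)
    from less.hyps[OF this P R(1)] obtain c1 where c1: "c1 \<in> H" "R = cj c1 ` P"
      "\<forall>d\<in>P \<inter> R. cj c1 d \<otimes> inv d \<in> U" by auto
    have "card R' - card (R' \<inter> Q) < card P - card (P \<inter> Q)" using l1 cardeq[OF R'] by (simp add: D_def)
    from less.hyps[OF this R' Q] obtain c2 where c2: "c2 \<in> H" "Q = cj c2 ` R'"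
      "\<forall>d\<in>R' \<inter> Q. cj c2 d \<otimes> inv d \<in> U" by auto
    have "c1 \<in> E" "c2 \<in> E" using c1 c2 lt1 lt2 by (auto simp: E_def)
    moreover have "k \<in> E" using k NH by (intro EI) auto
    ultimately have "c2 \<otimes> (k \<otimes> c1) \<in> E" by (intro E_mult)
    moreover have "Q = cj (c2 \<otimes> (k \<otimes> c1)) ` P"
    proof -
      have "Q = (\<lambda>x. cj c2 (cj k (cj c1 x))) ` P" by (simp add: c2(2) R'_def c1(2) image_image)
      also have "\<dots> = cj (c2 \<otimes> (k \<otimes> c1)) ` P"
        using c1(1) c2(1) kG c Ps by (intro image_cong) (auto simp: cj_cj subset_iff)
      finally show ?thesis .
    qed
    ultimately show ?thesis by (auto simp: E_def D_def)
  qed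
qed

text \<open>Both gPg^-1 and P contain gxg^-1, so the preceding lemma gives an a that acts on it
  trivially modulo U and makes ag normalize P. As N_H(P) is p-nilpotent, ag = ks with k centralizing
  P; hence sxs^-1 is the conjugate of gxg^-1 under a. In short, P controls its own fusion modulo
  U.\<close>

lemma fusion_modulo_normal_pgr:
  assumes p: "Factorial_Ring.prime p" and H: "subgroup H G"
    and U: "pgr p U" "U \<subseteq> H" "normalizes H U"
    and loc: "\<And>V. pgr p V \<Longrightarrow> U \<subset> V \<Longrightarrow> V \<subseteq> H \<Longrightarrow> pnil p (nrm H V)"
    and P: "syl p P H" "U \<subset> P" and x: "x \<in> P" and g: "g \<in> H" and y: "cj g x \<in> P"
  shows "\<exists>s\<in>P. cj g x \<otimes> inv (cj s x) \<in> U"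
proof -
  have c: "x \<in> carrier G" if "x \<in> H" for x using that H by (simp add: mem_sub)
  have Us: "subgroup U G" using U by (simp add: pgr_def)
  have Ps: "subgroup P G" "P \<subseteq> H" using sylD[OF P(1)] by auto
  have Pc: "z \<in> carrier G" if "z \<in> P" for z using that Ps c by auto
  let ?y = "cj g x"
  obtain a where a: "a \<in> H" "P = cj a ` cj g ` P" "\<forall>d\<in>cj g ` P \<inter> P. cj a d \<otimes> inv d \<in> U"
    using syl_conjugate_fixing_inter[OF p H U loc syl_cj[OF P(1) g] P(1)] by blast
  have aG: "a \<in> carrier G" "g \<in> carrier G" using a g c by auto
  define N where "N = nrm H P"
  have Ns: "subgroup N G" unfolding N_def using H Ps by (auto intro!: subgroup_nrm subgroup.subset)
  have PN: "P \<subseteq> N" unfolding N_def using Ps by (rule subgroup_subset_nrm)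
  have NH: "N \<subseteq> H" unfolding N_def by (rule nrm_subset)
  have pN: "pnil p N" unfolding N_def using P sylD[OF P(1)] by (intro loc) auto
  have "cj (a \<otimes> g) z \<in> P" if "z \<in> P" for z
    using that aG Pc by (subst a(2)) (auto simp flip: cj_cj)
  hence "a \<otimes> g \<in> N" using a g by (auto simp: N_def nrm_def intro: subgroup.m_closed[OF H])
  then obtain k s where k: "k \<in> N" "s \<in> P" "a \<otimes> g = k \<otimes> s" "\<forall>d\<in>P. cj k d = d"
    using pnil_factor[OF p pN syl_subset[OF P(1) Ns NH PN] sylD(1)[OF P(1)] PN] normalizes_nrm
    by (metis N_def)
  have sx: "cj s x \<in> P" using k x normalizesD[OF normalizes_self[OF Ps(1)]] by auto
  have kG: "k \<in> carrier G" using k NH c by auto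
  have "cj a ?y = cj (k \<otimes> s) x" using aG x Pc k(3) by (simp add: cj_cj)
  also have "\<dots> = cj k (cj s x)" using k(2) kG x Pc by (simp add: cj_cj)
  also have "\<dots> = cj s x" using k(4) sx by auto
  finally have "cj s x \<otimes> inv ?y \<in> U" using a(3) x y by (metis IntI imageI)
  hence "inv (cj s x \<otimes> inv ?y) \<in> U" by (rule subgroup.m_inv_closed[OF Us])
  moreover have "inv (cj s x \<otimes> inv ?y) = ?y \<otimes> inv (cj s x)"
    using Pc[OF sx] Pc[OF y] by (simp add: inv_mult_group)
  ultimately show ?thesis using k(2) by auto
qed

text \<open>If U is not Sylow, choose M \<ge> U of P with P / M abelian and nontrivial. Fusion
  controlled by P modulo U becomes trivial modulo M, so transfer yields a proper normal subgroup N
  of p-power index. The local hypothesis passes to N, and the K found there is invariant under H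
  because U determines it.\<close>

theorem rel_complement_exists:
  assumes p: "Factorial_Ring.prime p" and U: "pgr p U"
  shows "subgroup H G \<Longrightarrow> U \<subseteq> H \<Longrightarrow> normalizes H U \<Longrightarrow>
    (\<And>V. pgr p V \<Longrightarrow> U \<subset> V \<Longrightarrow> V \<subseteq> H \<Longrightarrow> pnil p (nrm H V)) \<Longrightarrow> \<exists>K. rel_complement p U K H"
proof (induction "card H" arbitrary: H rule: less_induct)
  case less
  note H = less.prems(1) and UH = less.prems(2,3) and loc = less.prems(4)
  have Us: "subgroup U G" using U by (simp add: pgr_def)
  obtain P where P: "syl p P H" "U \<subseteq> P" using syl_extends[OF p U UH(1) H] by auto
  have Ps: "subgroup P G" "P \<subseteq> H" using sylD[OF P(1)] by auto
  show ?case
  proof (cases "U = P")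
    case True
    hence "rel_complement p U H H"
      using H P UH by (auto simp: rel_complement_def normalizes_self intro: exI[of _ 0])
    thus ?thesis ..
  next
    case False
    hence UP: "U \<subset> P" using P by auto
    obtain M where M: "subgroup M G" "U \<subseteq> M" "M \<subset> P" "normalizes P M"
      "\<forall>a\<in>P. \<forall>b\<in>P. cj a b \<otimes> inv b \<in> M"
      using pgr_maximal_normal[OF p sylD(1)[OF P(1)] Us UP] by blast
    have fus: "cj g x \<otimes> inv x \<in> M" if x: "x \<in> P" and gH: "g \<in> H" and y: "cj g x \<in> P" for x g
    proof -
      obtain s where s: "s \<in> P" "cj g x \<otimes> inv (cj s x) \<in> U"
        using fusion_modulo_normal_pgr[OF p H U UH loc P(1) UP x gH y] by auto
      have G: "x \<in> carrier G" "s \<in> carrier G" "g \<in> carrier G" using x s \<open>g \<in> H\<close> Ps H by (auto simp: mem_sub)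
      have "(cj g x \<otimes> inv (cj s x)) \<otimes> (cj s x \<otimes> inv x) \<in> M"
        using s x by (intro subgroup.m_closed[OF M(1)] subsetD[OF M(2)] M(5)[rule_format])
      moreover have "(cj g x \<otimes> inv (cj s x)) \<otimes> (cj s x \<otimes> inv x) = cj g x \<otimes> inv x"
        using G by (simp add: word_simps)
      ultimately show ?thesis by simp
    qed
    obtain N where N: "subgroup N G" "N \<subseteq> H" "normalizes H N" "M \<subseteq> N" "card H * card M = card N * card P"
      using normal_subgroup_of_fusion[OF p P(1) M(1) _ M(4)] M(3,5) fus by blast
    have "pgr p M" using pgr_mono[OF p sylD(1)[OF P(1)] M(1)] M(3) by auto
    then obtain a b where ab: "card P = p ^ a" "card M = p ^ b"
      using sylD(1)[OF P(1)] by (auto simp: pgr_def)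
    have "card M < card P" using M(3) fin_sub[OF Ps(1)] by (rule psubset_card_mono[rotated])
    hence "b < a" using ab p by (metis linorder_not_le power_increasing prime_ge_1_nat)
    then obtain j where j: "a = b + Suc j" using less_imp_Suc_add by fastforce
    have "card H * p ^ b = (card N * p ^ Suc j) * p ^ b" using N(5) ab j by (auto simp: power_add)
    hence cH: "card H = card N * p ^ Suc j" using p by (simp add: prime_gt_0_nat)
    have "1 < p ^ Suc j" using prime_gt_1_nat[OF p] by (intro one_less_power) auto
    hence lt: "card N < card H" using cH card_sub_pos[OF N(1)] by simp
    have "\<exists>K. rel_complement p U K N"
    proof (rule less.hyps[OF lt N(1)])
      show "U \<subseteq> N" using M N by blast
      show "normalizes N U" using normalizes_mono[OF UH(2) N(2)] .
      fix V assume V: "pgr p V" "U \<subset> V" "V \<subseteq> N"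
      show "pnil p (nrm N V)"
      proof (rule pnil_mono[OF p])
        show "pnil p (nrm H V)" using V N by (intro loc) auto
        show "subgroup (nrm N V) G"
          using N V by (auto intro!: subgroup_nrm subgroup.subset simp: pgr_def)
        show "nrm N V \<subseteq> nrm H V" using N by (auto simp: nrm_def)
      qed
    qed
    then obtain K where "rel_complement p U K N" ..
    hence "rel_complement p U K H" using rel_complement_normal_extend[OF p _ H N(2,3) UH(2) cH] by auto
    thus ?thesis ..
  qed
qed

end

section \<open>The abelian case of the Hall--Higman theorem\<close>

context group begin

lemma cj_fixedI:
  assumes "g \<in> carrier G" "x \<in> carrier G" "cj g x \<otimes> inv x = \<one>"
  shows "cj g x = x"
  using assms by (metis cj_closed inv_closed inv_equality inv_inv)

text \<open>The iterated commutator [x, ..., x, w] with k entries x; on an abelian section, written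
  additively, it is (x - 1)^k w.\<close>

primrec ecom :: "'a \<Rightarrow> nat \<Rightarrow> 'a \<Rightarrow> 'a" where
  "ecom x 0 w = w"
| "ecom x (Suc k) w = cj x (ecom x k w) \<otimes> inv (ecom x k w)"

lemma ecom_shift: "ecom x k (cj x w \<otimes> inv w) = ecom x (Suc k) w"
  by (induction k) simp_all

text \<open>The product of the n + 1 factors f 0, ..., f n in this order; the ambient group need not
  be commutative.\<close>

primrec seq_prod :: "(nat \<Rightarrow> 'a) \<Rightarrow> nat \<Rightarrow> 'a" where
  "seq_prod f 0 = f 0"
| "seq_prod f (Suc n) = seq_prod f n \<otimes> f (Suc n)"

lemma seq_prod_cong: "(\<And>i. i \<le> n \<Longrightarrow> f i = g i) \<Longrightarrow> seq_prod f n = seq_prod g n"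
  by (induction n) simp_all

lemma seq_prod_in:
  assumes "subgroup V G" "\<And>i. i \<le> n \<Longrightarrow> f i \<in> V"
  shows "seq_prod f n \<in> V"
  using assms(2) by (induction n) (simp_all add: subgroup.m_closed[OF assms(1)])

lemma seq_prod_shift:
  assumes "\<And>i. i \<le> Suc n \<Longrightarrow> f i \<in> carrier G"
  shows "seq_prod f (Suc n) = f 0 \<otimes> seq_prod (\<lambda>i. f (Suc i)) n"
proof -
  have "seq_prod (\<lambda>i. f (Suc i)) m \<in> carrier G" if "m \<le> n" for m
    using that assms by (intro seq_prod_in subgroup_self) auto
  thus ?thesis using assms
  proof (induction n)
    case (Suc n)
    have "seq_prod f (Suc (Suc n)) = f 0 \<otimes> seq_prod (\<lambda>i. f (Suc i)) n \<otimes> f (Suc (Suc n))"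
      using Suc by simp
    also have "\<dots> = f 0 \<otimes> seq_prod (\<lambda>i. f (Suc i)) (Suc n)"
      using Suc.prems(1)[of n] Suc.prems(2)[of 0] Suc.prems(2)[of "Suc (Suc n)"] by (simp add: m_assoc)
    finally show ?case .
  qed simp
qed

lemma cj_seq_prod:
  assumes "a \<in> carrier G" "\<And>i. i \<le> n \<Longrightarrow> f i \<in> carrier G"
  shows "cj a (seq_prod f n) = seq_prod (\<lambda>i. cj a (f i)) n"
  using assms(2)
proof (induction n)
  case (Suc n)
  have "seq_prod f n \<in> carrier G" using Suc by (intro seq_prod_in subgroup_self) auto
  thus ?case using Suc assms(1) by (simp add: cj_mult)
qed simp

end

section \<open>Elements of order prime to p acting on p-groups\<close>

context fin_group begin

text \<open>Put d = [c, w]. As c fixes d, conjugating w by c^j gives d^j w; j = n yields d^n = 1,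
  and d lies in a p-group while n is prime to p. This replaces the general theory of coprime
  action.\<close>

lemma coprime_fixed:
  assumes p: "Factorial_Ring.prime p" and W: "pgr p W" and c: "c \<in> carrier G" "c [^] (n::nat) = \<one>" "\<not> p dvd n"
    and w: "w \<in> W" "cj c w \<in> W" "cj c (cj c w \<otimes> inv w) = cj c w \<otimes> inv w"
  shows "cj c w = w"
proof -
  define d where "d = cj c w \<otimes> inv w"
  have Ws: "subgroup W G" using W by (rule pgr_subgroup)
  have wG: "w \<in> carrier G" using w Ws by (simp add: mem_sub)
  have dW: "d \<in> W" unfolding d_def using w by (simp add: subgroup.m_closed[OF Ws] subgroup.m_inv_closed[OF Ws])
  have dG: "d \<in> carrier G" using dW Ws by (simp add: mem_sub)
  have cd: "cj c d = d" using w(3) by (simp add: d_def)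
  have cw: "cj c w = d \<otimes> w" using wG c by (simp add: d_def m_assoc)
  have "cj (c [^] j) w = d [^] j \<otimes> w" for j :: nat
  proof (induction j)
    case (Suc j)
    have "cj (c [^] Suc j) w = cj c (cj (c [^] j) w)"
      using c wG by (simp add: cj_cj flip: nat_pow_Suc2)
    also have "\<dots> = d [^] j \<otimes> (d \<otimes> w)"
      using Suc c wG dG cd by (simp add: cj_mult cj_pow cw)
    finally show ?case using dG wG by (simp add: m_assoc)
  qed (use wG in simp)
  from this[of n] have "d [^] n = \<one>" using c wG dG by (metis cj_by_one l_cancel_one' nat_pow_closed one_closed r_cancel_one')
  hence o1: "ord d dvd n" using pow_eq_id[OF dG] by simp
  interpret W: group "G\<lparr>carrier := W\<rparr>" using Ws by (rule subgroup_imp_group)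
  obtain k where k: "card W = p ^ k" using W by (auto simp: pgr_def)
  have "d [^] card W = \<one>"
    using W.pow_order_eq_1[of d] dW by (simp add: order_def nat_pow_consistent[symmetric])
  hence "ord d dvd p ^ k" using pow_eq_id[OF dG] k by simp
  moreover have "coprime n (p ^ k)" using c(3) p
    by (metis coprime_commute coprime_power_right_iff prime_imp_coprime)
  ultimately have "ord d = 1" using o1 by (metis coprime_common_divisor nat_dvd_1_iff_1)
  hence "d = \<one>" using dG ord_eq_1 by simp
  thus ?thesis using cw wG by simp
qed

text \<open>A unipotent action of an element of order prime to p is trivial: if (c - 1)^(k+1)
  vanishes on V with k > 0, then \<open>coprime_fixed\<close>, applied to (c - 1)^(k-1) v, shows
  that (c - 1)^k vanishes already.\<close>

lemma ecom_coprime: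
  assumes p: "Factorial_Ring.prime p" and V: "pgr p V" and c: "c \<in> carrier G" "c [^] (n::nat) = \<one>" "\<not> p dvd n"
    and n: "normalizes {c} V"
  shows "(\<And>v. v \<in> V \<Longrightarrow> ecom c k v = \<one>) \<Longrightarrow> v \<in> V \<Longrightarrow> cj c v = v"
proof (induction k)
  case 0
  thus ?case using c by (metis cj_one ecom.simps(1))
next
  case (Suc k)
  have Vs: "subgroup V G" using V by (rule pgr_subgroup)
  have VG: "u \<in> carrier G" if "u \<in> V" for u using that Vs by (simp add: mem_sub)
  have cV: "cj c u \<in> V" if "u \<in> V" for u using that n by (auto simp: normalizes_def)
  have eV: "ecom c j u \<in> V" if "u \<in> V" for j u
    using that by (induction j) (simp_all add: cV subgroup.m_closed[OF Vs] subgroup.m_inv_closed[OF Vs])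
  show ?case
  proof (cases k)
    case 0
    hence "cj c v \<otimes> inv v = \<one>" using Suc.prems(1)[OF Suc.prems(2)] by simp
    thus ?thesis using c VG[OF Suc.prems(2)] by (intro cj_fixedI)
  next
    case (Suc j)
    have "ecom c k u = \<one>" if u: "u \<in> V" for u
    proof -
      let ?w = "ecom c j u"
      have d: "ecom c k u = cj c ?w \<otimes> inv ?w" by (simp add: Suc)
      have kG: "ecom c k u \<in> carrier G" using eV u VG by blast
      have "cj c (ecom c k u) \<otimes> inv (ecom c k u) = \<one>" using Suc.prems(1)[OF u] by simp
      hence "cj c (ecom c k u) = ecom c k u" using kG c by (intro cj_fixedI)
      hence "cj c (cj c ?w \<otimes> inv ?w) = cj c ?w \<otimes> inv ?w" unfolding d .
      hence "cj c ?w = ?w" by (rule coprime_fixed[OF p V c eV[OF u] cV[OF eV[OF u]]])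
      thus ?thesis unfolding d using VG[OF eV[OF u]] by simp
    qed
    thus ?thesis using Suc.IH Suc.prems(2) by blast
  qed
qed

text \<open>Applying \<open>(x - 1)\<^sup>n = 0\<close> to \<open>a \<cdot> v\<close> yields a
  relation \<open>\<Sum>\<^sub>i (x\<^sup>i a x\<^sup>-\<^sup>i) \<cdot> y\<^sub>i = 0\<close> for all \<open>a \<in> R\<close> with \<open>y\<^sub>0 = \<plusminus>v\<close>, from which the terms with \<open>i > 0\<close>
  are eliminated as in Dedekind's proof of the independence of characters.\<close>

context
  fixes V R :: "'a set" and x :: 'a
  assumes V: "subgroup V G" and comm: "\<And>u v. u \<in> V \<Longrightarrow> v \<in> V \<Longrightarrow> u \<otimes> v = v \<otimes> u"
    and R: "subgroup R G" and RV: "normalizes R V" and x: "x \<in> carrier G"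
    and xV: "\<And>v. v \<in> V \<Longrightarrow> cj x v \<in> V" and xR: "\<And>a. a \<in> R \<Longrightarrow> cj x a \<in> R"
    and actcomm: "\<And>a b v. a \<in> R \<Longrightarrow> b \<in> R \<Longrightarrow> v \<in> V \<Longrightarrow> cj a (cj b v) = cj b (cj a v)"
begin

lemma VG: "v \<in> V \<Longrightarrow> v \<in> carrier G" using V by (simp add: mem_sub)
lemma RG: "a \<in> R \<Longrightarrow> a \<in> carrier G" using R by (simp add: mem_sub)
lemma RVD: "a \<in> R \<Longrightarrow> v \<in> V \<Longrightarrow> cj a v \<in> V" using RV by (auto simp: normalizes_def)
lemmas Vc = subgroup.m_closed[OF V] subgroup.m_inv_closed[OF V] subgroup.one_closed[OF V]
lemmas Rc = subgroup.m_closed[OF R] subgroup.m_inv_closed[OF R] subgroup.one_closed[OF R]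

lemma lcomm: "u \<in> V \<Longrightarrow> v \<in> V \<Longrightarrow> w \<in> V \<Longrightarrow> u \<otimes> (v \<otimes> w) = v \<otimes> (u \<otimes> w)"
  using comm VG by (metis m_assoc)

lemma seq_prod_mult:
  assumes "\<And>i. i \<le> n \<Longrightarrow> f i \<in> V" "\<And>i. i \<le> n \<Longrightarrow> g i \<in> V"
  shows "seq_prod (\<lambda>i. f i \<otimes> g i) n = seq_prod f n \<otimes> seq_prod g n"
  using assms
proof (induction n)
  case (Suc n)
  have "seq_prod f n \<in> V" "seq_prod g n \<in> V" using Suc by (auto intro!: seq_prod_in[OF V])
  thus ?case using Suc VG by (simp add: m_assoc lcomm)
qed simp

lemma seq_prod_inv:
  assumes "\<And>i. i \<le> n \<Longrightarrow> f i \<in> V"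
  shows "seq_prod (\<lambda>i. inv (f i)) n = inv (seq_prod f n)"
  using assms
proof (induction n)
  case (Suc n)
  have "seq_prod f n \<in> V" using Suc by (auto intro!: seq_prod_in[OF V])
  thus ?case using Suc VG by (simp add: inv_mult_group comm Vc)
qed simp

text \<open>What a becomes when moved past a power of x:
  \<open>x [^] i \<otimes> a = tw i a \<otimes> x [^] i\<close>. The actions of the
  \<open>tw i a\<close> on V play the part of the characters in Dedekind's argument.\<close>

definition tw :: "nat \<Rightarrow> 'a \<Rightarrow> 'a" where "tw i a = cj (x [^] i) a"

lemma tw_R: "a \<in> R \<Longrightarrow> tw i a \<in> R"
proof (induction i)
  case 0 thus ?case using RG by (simp add: tw_def)
next
  case (Suc i)
  have "tw (Suc i) a = cj x (tw i a)" using Suc.prems RG x by (simp add: tw_def cj_cj flip: nat_pow_Suc2)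
  thus ?case using Suc xR by simp
qed

lemma tw_Suc: "a \<in> R \<Longrightarrow> tw (Suc i) a = cj x (tw i a)"
  using RG x by (simp add: tw_def cj_cj flip: nat_pow_Suc2)

lemma tw_0: "a \<in> R \<Longrightarrow> tw 0 a = a" using RG by (simp add: tw_def)

lemma tw_mult: "a \<in> R \<Longrightarrow> b \<in> R \<Longrightarrow> tw i (a \<otimes> b) = tw i a \<otimes> tw i b"
  using RG x by (simp add: tw_def cj_mult)

lemma ecom_expansion:
  assumes v: "v \<in> V"
  shows "\<exists>y. (\<forall>i. y i \<in> V) \<and> y 0 = (if even n then v else inv v) \<and> (\<forall>i>n. y i = \<one>) \<and>
    (\<forall>a\<in>R. ecom x n (cj a v) = seq_prod (\<lambda>i. cj (tw i a) (y i)) n)"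
proof (induction n)
  case 0
  show ?case using v by (intro exI[of _ "\<lambda>i. if i = 0 then v else \<one>"]) (auto simp: tw_0 Vc)
next
  case (Suc n)
  then obtain y where y: "\<And>i. y i \<in> V" "y 0 = (if even n then v else inv v)" "\<And>i. i > n \<Longrightarrow> y i = \<one>"
    "\<And>a. a \<in> R \<Longrightarrow> ecom x n (cj a v) = seq_prod (\<lambda>i. cj (tw i a) (y i)) n" by blast
  \<comment> \<open>The effect of x - 1 on the sum of the \<open>tw i a\<close> y_i: x turns the
    i-th term into the twist i + 1 applied to x y_i. So the new coefficients are - y_0 and x y_j -
    y_(j+1), and the sign of the first one alternates. The values \<one> beyond n allow the sum to
    be read with one more term.\<close>
  define y' where "y' i = (case i of 0 \<Rightarrow> inv (y 0) | Suc j \<Rightarrow> cj x (y j) \<otimes> inv (y (Suc j)))" for i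
  have y'V: "y' i \<in> V" for i using y(1) xV by (auto simp: y'_def Vc split: nat.split)
  have "ecom x (Suc n) (cj a v) = seq_prod (\<lambda>i. cj (tw i a) (y' i)) (Suc n)" if a: "a \<in> R" for a
  proof -
    let ?S = "seq_prod (\<lambda>i. cj (tw i a) (y i)) n"
    have in1: "cj (tw i a) (y j) \<in> V" for i j using a y(1) by (simp add: RVD tw_R)
    have G: "tw i a \<in> carrier G" "y i \<in> carrier G" for i using a y(1) tw_R RG VG by auto
    have "cj x ?S = seq_prod (\<lambda>i. cj x (cj (tw i a) (y i))) n"
      using x G by (intro cj_seq_prod) auto
    also have "\<dots> = seq_prod (\<lambda>i. cj (tw (Suc i) a) (cj x (y i))) n"
      using x G by (intro seq_prod_cong) (simp add: tw_Suc[OF a] word_simps)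
    finally have 1: "cj x ?S = seq_prod (\<lambda>i. cj (tw (Suc i) a) (cj x (y i))) n" .
    have SV: "seq_prod (\<lambda>i. cj (tw i a) (y (f i))) n \<in> V" "seq_prod (\<lambda>i. cj (tw (Suc i) a) (y (f i))) n \<in> V" for f
      by (intro seq_prod_in[OF V] in1)+
    have "?S = seq_prod (\<lambda>i. cj (tw i a) (y i)) (Suc n)"
      using y(3)[of "Suc n"] G SV(1)[of "\<lambda>i. i"] by (simp add: VG)
    also have "\<dots> = cj (tw 0 a) (y 0) \<otimes> seq_prod (\<lambda>i. cj (tw (Suc i) a) (y (Suc i))) n"
      using G by (intro seq_prod_shift) auto
    finally have "inv ?S = inv (seq_prod (\<lambda>i. cj (tw (Suc i) a) (y (Suc i))) n) \<otimes> inv (cj (tw 0 a) (y 0))"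
      using G SV(2)[of Suc] VG by (simp add: inv_mult_group)
    also have "inv (seq_prod (\<lambda>i. cj (tw (Suc i) a) (y (Suc i))) n) =
        seq_prod (\<lambda>i. inv (cj (tw (Suc i) a) (y (Suc i)))) n"
      using in1 by (intro seq_prod_inv[symmetric]) auto
    finally have 2: "inv ?S = seq_prod (\<lambda>i. inv (cj (tw (Suc i) a) (y (Suc i)))) n \<otimes> inv (cj (tw 0 a) (y 0))" .
    have "seq_prod (\<lambda>i. cj (tw i a) (y' i)) (Suc n) =
        cj (tw 0 a) (y' 0) \<otimes> seq_prod (\<lambda>i. cj (tw (Suc i) a) (y' (Suc i))) n"
      using G y'V VG by (intro seq_prod_shift) auto
    also have "seq_prod (\<lambda>i. cj (tw (Suc i) a) (y' (Suc i))) n =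
        seq_prod (\<lambda>i. cj (tw (Suc i) a) (cj x (y i)) \<otimes> inv (cj (tw (Suc i) a) (y (Suc i)))) n"
      using G x by (intro seq_prod_cong) (simp add: y'_def cj_mult cj_inv)
    also have "\<dots> = cj x ?S \<otimes> seq_prod (\<lambda>i. inv (cj (tw (Suc i) a) (y (Suc i)))) n"
      unfolding 1 using in1 a xV[OF y(1)] by (intro seq_prod_mult) (simp_all add: RVD tw_R Vc)
    also have "cj (tw 0 a) (y' 0) = inv (cj (tw 0 a) (y 0))" using G by (simp add: y'_def cj_inv)
    finally have "seq_prod (\<lambda>i. cj (tw i a) (y' i)) (Suc n) = inv (cj (tw 0 a) (y 0)) \<otimes>
       (cj x ?S \<otimes> seq_prod (\<lambda>i. inv (cj (tw (Suc i) a) (y (Suc i)))) n)" .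
    also have "\<dots> = cj x ?S \<otimes> inv ?S"
    proof -
      have "seq_prod (\<lambda>i. inv (cj (tw (Suc i) a) (y (Suc i)))) n \<in> V" "?S \<in> V" "inv (cj (tw 0 a) (y 0)) \<in> V"
        using in1 by (auto intro!: seq_prod_in[OF V] Vc)
      thus ?thesis unfolding 2 using xV by (simp add: lcomm comm Vc)
    qed
    finally show ?thesis using y(4)[OF a] by simp
  qed
  moreover have "y' 0 = (if even (Suc n) then v else inv v)" using y(2) v VG by (auto simp: y'_def)
  moreover have "y' i = \<one>" if "i > Suc n" for i
    using that y(3) x by (cases i) (auto simp: y'_def)
  ultimately show ?case using y'V by (intro exI[of _ y']) auto
qed

text \<open>The operator b - \<open>tw j b\<close> on V: what one elimination step does to the
  coefficient of index 0 when it removes the term of index j.\<close>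

definition dl :: "nat \<Rightarrow> 'a \<Rightarrow> 'a \<Rightarrow> 'a" where
  "dl j b v = cj b v \<otimes> inv (cj (tw j b) v)"

primrec dlprod :: "(nat \<Rightarrow> 'a) \<Rightarrow> nat \<Rightarrow> 'a \<Rightarrow> 'a" where
  "dlprod b 0 v = v"
| "dlprod b (Suc k) v = dlprod b k (dl (Suc k) (b (Suc k)) v)"

lemma cj_RR: "a \<in> R \<Longrightarrow> b \<in> R \<Longrightarrow> v \<in> V \<Longrightarrow> cj (a \<otimes> b) v = cj a (cj b v)"
  using RG VG by (simp add: cj_cj)

text \<open>Take the relation for the product of a and b = \<open>b (Suc k)\<close>, and subtract
  from it the relation for a acted on by \<open>tw (Suc k) b\<close>. As the actions of R on V
  commute, the last term cancels and y_i becomes (\<open>tw i b\<close> -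
  \<open>tw (Suc k) b\<close>) y_i. Repetition leaves the term of index 0 alone.\<close>

lemma dedekind_elimination:
  assumes "\<And>i. y i \<in> V" "\<And>a. a \<in> R \<Longrightarrow> seq_prod (\<lambda>i. cj (tw i a) (y i)) k = \<one>" and b: "\<And>j. b j \<in> R"
  shows "dlprod b k (y 0) = \<one>"
  using assms(1,2)
proof (induction k arbitrary: y)
  case 0
  from 0(2)[of \<one>] show ?case using 0(1)[of 0] VG Rc by (simp add: tw_0)
next
  case (Suc k)
  let ?b = "b (Suc k)"
  define z where "z i = cj (tw i ?b) (y i) \<otimes> inv (cj (tw (Suc k) ?b) (y i))" for i
  have yV: "y i \<in> V" for i using Suc.prems(1) .
  have tR: "tw i a \<in> R" if "a \<in> R" for i a using that by (rule tw_R)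
  have zV: "z i \<in> V" for i using yV tR[OF b] by (simp add: z_def Vc RVD)
  have "seq_prod (\<lambda>i. cj (tw i a) (z i)) k = \<one>" if a: "a \<in> R" for a
  proof -
    define f g where "f i = cj (tw i (a \<otimes> ?b)) (y i)" and "g i = cj (tw (Suc k) ?b) (cj (tw i a) (y i))" for i
    have aV: "cj (tw i a) (y j) \<in> V" for i j using yV tR[OF a] by (simp add: RVD)
    have fV: "f i \<in> V" and gV: "g i \<in> V" for i
      using yV aV tR a b Rc by (simp_all add: f_def g_def RVD)
    have "cj (tw i a) (z i) = f i \<otimes> inv (g i)" for i
    proof -
      have "cj (tw i a) (z i) = cj (tw i a) (cj (tw i ?b) (y i)) \<otimes> inv (cj (tw i a) (cj (tw (Suc k) ?b) (y i)))"
        using yV[of i] tR[OF b] tR[OF a] VG RG RVD by (simp add: z_def cj_mult cj_inv)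
      also have "cj (tw i a) (cj (tw i ?b) (y i)) = f i"
        using yV tR a b by (simp add: f_def tw_mult cj_RR)
      also have "cj (tw i a) (cj (tw (Suc k) ?b) (y i)) = g i"
        unfolding g_def by (rule actcomm[OF tR[OF a] tR[OF b] yV])
      finally show ?thesis .
    qed
    note eq = this
    have "seq_prod (\<lambda>i. cj (tw i a) (z i)) (Suc k) = seq_prod f (Suc k) \<otimes> seq_prod (\<lambda>i. inv (g i)) (Suc k)"
      unfolding eq using fV gV by (intro seq_prod_mult) (auto intro: Vc)
    also have "seq_prod f (Suc k) = \<one>"
      unfolding f_def using Suc.prems(2)[of "a \<otimes> ?b"] a b Rc by blast
    also have "seq_prod (\<lambda>i. inv (g i)) (Suc k) = inv (seq_prod g (Suc k))"
      using gV by (intro seq_prod_inv)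
    also have "seq_prod g (Suc k) = cj (tw (Suc k) ?b) (seq_prod (\<lambda>i. cj (tw i a) (y i)) (Suc k))"
      unfolding g_def using tR[OF b] RG aV VG by (intro cj_seq_prod[symmetric]) auto
    also have "\<dots> = \<one>" unfolding Suc.prems(2)[OF a] using tR[OF b] RG by simp
    finally have 1: "seq_prod (\<lambda>i. cj (tw i a) (z i)) (Suc k) = \<one>" by simp
    have "f (Suc k) = g (Suc k)"
      unfolding f_def g_def using actcomm[OF tR[OF a] tR[OF b] yV] tR a b yV by (simp add: tw_mult cj_RR)
    hence "cj (tw (Suc k) a) (z (Suc k)) = \<one>" using eq VG[OF gV] by simp
    moreover have "seq_prod (\<lambda>i. cj (tw i a) (z i)) k \<in> V"
      using zV tR[OF a] by (intro seq_prod_in[OF V]) (simp add: RVD)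
    ultimately show ?thesis using 1 VG by simp
  qed
  from Suc.IH[OF zV this] show ?case using b by (simp add: z_def dl_def tw_0)
qed

text \<open>On V each factor b_j - \<open>tw j\<close> b_j equals (c - 1) \<open>tw j\<close> b_j.
  The actions commute, so the composite is (c - 1)^k times the invertible product a of the
  twists.\<close>

lemma dlprod_eq_ecom:
  assumes b: "\<And>j. b j \<in> R" and c: "c \<in> R"
    and bc: "\<And>j v. 1 \<le> j \<Longrightarrow> j \<le> k \<Longrightarrow> v \<in> V \<Longrightarrow> cj (b j \<otimes> inv (tw j (b j))) v = cj c v"
  shows "\<exists>a\<in>R. \<forall>v\<in>V. dlprod b k v = ecom c k (cj a v)"
  using bc
proof (induction k)
  case 0
  show ?case using Rc VG by (intro bexI[of _ \<one>]) auto
next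
  case (Suc k)
  then obtain a where a: "a \<in> R" "\<And>v. v \<in> V \<Longrightarrow> dlprod b k v = ecom c k (cj a v)" by auto
  let ?t = "tw (Suc k) (b (Suc k))"
  have t: "?t \<in> R" using b by (rule tw_R)
  have "dlprod b (Suc k) v = ecom c (Suc k) (cj (a \<otimes> ?t) v)" if v: "v \<in> V" for v
  proof -
    let ?u = "cj ?t v"
    have u: "?u \<in> V" using t v by (rule RVD)
    have "cj c ?u = cj (b (Suc k)) v"
      using Suc.prems[of "Suc k" ?u] u v t b VG RG by (simp add: cj_cj m_assoc)
    hence "dl (Suc k) (b (Suc k)) v = cj c ?u \<otimes> inv ?u" by (simp add: dl_def)
    hence "dlprod b (Suc k) v = ecom c k (cj a (cj c ?u \<otimes> inv ?u))"
      using u c by (simp add: a(2) RVD Vc)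
    also have "cj a (cj c ?u \<otimes> inv ?u) = cj c (cj a ?u) \<otimes> inv (cj a ?u)"
      using actcomm[OF a(1) c u] a(1) c u VG RG RVD by (simp add: cj_mult cj_inv)
    also have "ecom c k \<dots> = ecom c (Suc k) (cj a ?u)" by (rule ecom_shift)
    also have "cj a ?u = cj (a \<otimes> ?t) v" using a t v by (simp add: cj_RR)
    finally show ?thesis .
  qed
  thus ?case using a t Rc by blast
qed

text \<open>The witness is b times its twists by j, 2j, ..., (m - 1)j; its quotient by its own j-th
  twist telescopes. So a commutator with x^(jm) acts like a commutator with x^j.\<close>

lemma commutator_with_power:
  assumes b: "b \<in> R"
  shows "\<exists>\<beta>\<in>R. \<forall>v\<in>V. cj (\<beta> \<otimes> inv (tw j \<beta>)) v = cj (b \<otimes> inv (tw (j * m) b)) v"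
proof (induction m)
  case 0
  show ?case using Rc RG[OF b] VG by (intro bexI[of _ \<one>]) (auto simp: tw_def x)
next
  case (Suc m)
  then obtain \<beta> where \<beta>: "\<beta> \<in> R" "\<And>v. v \<in> V \<Longrightarrow> cj (\<beta> \<otimes> inv (tw j \<beta>)) v = cj (b \<otimes> inv (tw (j * m) b)) v"
    by auto
  let ?B = "tw (j * m) b" and ?B' = "tw (j * Suc m) b" and ?t = "tw j \<beta>"
  have mem: "?B \<in> R" "?B' \<in> R" "?t \<in> R" "inv ?B \<in> R" "inv ?B' \<in> R" "inv ?t \<in> R" using b \<beta> by (auto intro: tw_R Rc)
  have B': "tw j ?B = ?B'" using RG[OF b] x by (simp add: tw_def cj_cj nat_pow_mult)
  have "cj ((\<beta> \<otimes> ?B) \<otimes> inv (tw j (\<beta> \<otimes> ?B))) v = cj (b \<otimes> inv ?B') v" if v: "v \<in> V" for v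
  proof -
    let ?w = "cj (inv ?B') v"
    have w: "?w \<in> V" using mem v by (intro RVD)
    have "(\<beta> \<otimes> ?B) \<otimes> inv (tw j (\<beta> \<otimes> ?B)) = (\<beta> \<otimes> ?B) \<otimes> (inv ?B' \<otimes> inv ?t)"
      using \<beta>(1) mem RG by (simp add: tw_mult B' inv_mult_group)
    hence "cj ((\<beta> \<otimes> ?B) \<otimes> inv (tw j (\<beta> \<otimes> ?B))) v = cj \<beta> (cj ?B (cj (inv ?B') (cj (inv ?t) v)))"
      using \<beta>(1) mem v by (simp add: cj_RR RVD Rc)
    also have "cj (inv ?B') (cj (inv ?t) v) = cj (inv ?t) ?w" using mem v by (intro actcomm)
    also have "cj ?B (cj (inv ?t) ?w) = cj (inv ?t) (cj ?B ?w)" using mem w by (intro actcomm)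
    also have "cj \<beta> (cj (inv ?t) (cj ?B ?w)) = cj (\<beta> \<otimes> inv ?t) (cj ?B ?w)"
      using \<beta>(1) mem w by (simp add: cj_RR RVD)
    also have "\<dots> = cj (b \<otimes> inv ?B) (cj ?B ?w)" by (rule \<beta>(2)[OF RVD[OF mem(1) w]])
    also have "\<dots> = cj b ?w" using mem w b VG RG by (simp add: cj_cj m_assoc)
    also have "\<dots> = cj (b \<otimes> inv ?B') v" using mem v b by (simp add: cj_RR)
    finally show ?thesis .
  qed
  thus ?case using \<beta>(1) mem Rc by blast
qed

text \<open>For suitable elements b_j the elimination turns (x - 1)^(p-1) = 0 into (c - 1)^(p-1) = 0
  on V, where c = [b, x]. Since the order of c is prime to p, its action is trivial.\<close>

lemma hall_higman_abelian:
  assumes p: "Factorial_Ring.prime p" and Vp: "pgr p V" and xp: "x [^] (p ^ e) = \<one>"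
    and engel: "\<And>v. v \<in> V \<Longrightarrow> ecom x (p - 1) v = \<one>"
    and Rp: "\<not> p dvd card R" and b: "b \<in> R" and v: "v \<in> V"
  shows "cj (b \<otimes> inv (cj x b)) v = v"
proof -
  define c where "c = b \<otimes> inv (cj x b)"
  have cR: "c \<in> R" unfolding c_def using b xR Rc by simp
  \<comment> \<open>Here the height p - 1 matters: 0 < j < p gives an m with jm = 1 modulo p ^ e, so
    x = (x^j)^m, and [b, x] acts like a commutator with x^j.\<close>
  have "\<exists>\<beta>\<in>R. \<forall>v\<in>V. cj (\<beta> \<otimes> inv (tw j \<beta>)) v = cj c v" if j: "1 \<le> j" "j \<le> p - 1" for j
  proof -
    have "\<not> p dvd j" using j by (auto dest: dvd_imp_le)
    hence "coprime j (p ^ e)" using p by (metis coprime_commute coprime_power_right_iff prime_imp_coprime)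
    then obtain m t where m: "j * m = p ^ e * t + 1" using bezout_nat[of j "p ^ e"] j by auto
    have "x [^] (j * m) = x" unfolding m using x xp
      by (simp add: nat_pow_mult[symmetric] nat_pow_pow[symmetric])
    hence "tw (j * m) b = cj x b" by (simp add: tw_def)
    thus ?thesis using commutator_with_power[OF b, of j m] by (simp add: c_def)
  qed
  then obtain \<beta> where \<beta>: "\<And>j. 1 \<le> j \<Longrightarrow> j \<le> p - 1 \<Longrightarrow> \<beta> j \<in> R \<and> (\<forall>v\<in>V. cj (\<beta> j \<otimes> inv (tw j (\<beta> j))) v = cj c v)"
    by metis
  \<comment> \<open>The default \<one> keeps \<open>B j\<close> in R for every j.\<close>
  define B where "B j = (if 1 \<le> j \<and> j \<le> p - 1 then \<beta> j else \<one>)" for j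
  have BR: "B j \<in> R" for j using \<beta> Rc by (auto simp: B_def)
  have Bc: "cj (B j \<otimes> inv (tw j (B j))) v = cj c v" if "1 \<le> j" "j \<le> p - 1" "v \<in> V" for j v
    using \<beta>[OF that(1,2)] that by (simp add: B_def)
  have "\<exists>a\<in>R. \<forall>v\<in>V. dlprod B (p - 1) v = ecom c (p - 1) (cj a v)"
    by (rule dlprod_eq_ecom[OF BR cR Bc])
  then obtain a where a: "a \<in> R" "\<And>v. v \<in> V \<Longrightarrow> dlprod B (p - 1) v = ecom c (p - 1) (cj a v)"
    by blast
  have zero: "dlprod B (p - 1) u = \<one>" if u: "u \<in> V" for u
  proof -
    \<comment> \<open>The expansion begins with y_0 = \<plusminus>v; this sign makes y_0 equal to
      u.\<close>
    let ?u = "if even (p - 1) then u else inv u"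
    have uV: "?u \<in> V" using u Vc by simp
    obtain y where y: "\<And>i. y i \<in> V" "y 0 = (if even (p - 1) then ?u else inv ?u)"
      "\<And>a. a \<in> R \<Longrightarrow> ecom x (p - 1) (cj a ?u) = seq_prod (\<lambda>i. cj (tw i a) (y i)) (p - 1)"
      using ecom_expansion[OF uV, of "p - 1"] by auto
    have "dlprod B (p - 1) (y 0) = \<one>"
      using y(3) engel RVD uV by (intro dedekind_elimination y(1) BR) auto
    thus ?thesis using y(2) u VG by (auto split: if_splits)
  qed
  \<comment> \<open>a acts invertibly on V, so evaluating at its preimage of u removes it.\<close>
  have "ecom c (p - 1) u = \<one>" if u: "u \<in> V" for u
  proof -
    have "cj (inv a) u \<in> V" using a u Rc by (intro RVD) auto
    thus ?thesis using a zero[of "cj (inv a) u"] u VG RG by simp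
  qed
  moreover have "c [^] card R = \<one>"
  proof -
    interpret R: group "G\<lparr>carrier := R\<rparr>" using R by (rule subgroup_imp_group)
    show ?thesis using R.pow_order_eq_1[of c] cR by (simp add: order_def nat_pow_consistent[symmetric])
  qed
  moreover have "normalizes {c} V" using cR RVD by (auto simp: normalizes_def)
  ultimately show ?thesis unfolding c_def[symmetric] using ecom_coprime[OF p Vp RG[OF cR] _ Rp] v by blast
qed

end

end

section \<open>From abelian groups to abelian sections\<close>

context group begin

lemma cj_generate:
  assumes g: "g \<in> carrier G" and S: "S \<subseteq> carrier G" and gS: "\<And>s. s \<in> S \<Longrightarrow> cj g s \<in> S"
    and z: "z \<in> generate G S"
  shows "cj g z \<in> generate G S"
  using z
proof induction
  case one
  show ?case using g by (simp add: generate.one)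
next
  case (incl h)
  thus ?case using gS by (auto intro: generate.incl)
next
  case (inv h)
  thus ?case using gS g S by (auto simp: cj_inv subset_iff intro: generate.inv)
next
  case (eng h1 h2)
  have "h1 \<in> carrier G" "h2 \<in> carrier G" using eng generate_in_carrier[OF S] by auto
  thus ?case using eng g by (simp add: cj_mult generate.eng)
qed

text \<open>Collecting the factors a on the left moves them past 0, 1, ..., n - 1 factors b; each
  exchange leaves a z that commutes with everything present.\<close>

lemma class_two_power:
  assumes a: "a \<in> carrier G" and b: "b \<in> carrier G" and z: "z \<in> carrier G" "b \<otimes> a = a \<otimes> b \<otimes> z"
    and za: "z \<otimes> a = a \<otimes> z" and zb: "z \<otimes> b = b \<otimes> z"
  shows "b [^] (n::nat) \<otimes> a = a \<otimes> b [^] n \<otimes> z [^] n"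
    and "(a \<otimes> b) [^] n = a [^] n \<otimes> b [^] n \<otimes> z [^] (n * (n - 1) div 2)"
proof -
  have comm_pow: "u [^] m \<otimes> v = v \<otimes> u [^] m" if "u \<in> carrier G" "v \<in> carrier G" "u \<otimes> v = v \<otimes> u" for u v and m :: nat
    using that by (metis group_commutes_pow)
  have zpow: "z [^] m \<otimes> a = a \<otimes> z [^] m" "z [^] m \<otimes> b = b \<otimes> z [^] m" for m :: nat
    using comm_pow a b z za zb by auto
  have 1: "b [^] n \<otimes> a = a \<otimes> b [^] n \<otimes> z [^] n" for n :: nat
  proof (induction n)
    case (Suc n)
    have "b [^] Suc n \<otimes> a = b [^] n \<otimes> (b \<otimes> a)" using a b by (simp add: m_assoc)
    also have "\<dots> = (b [^] n \<otimes> a) \<otimes> (b \<otimes> z)" using a b z by (simp add: m_assoc)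
    also have "\<dots> = a \<otimes> b [^] n \<otimes> (z [^] n \<otimes> b) \<otimes> z" using Suc a b z by (simp add: m_assoc)
    also have "\<dots> = a \<otimes> b [^] Suc n \<otimes> z [^] Suc n" unfolding zpow(2) using a b z by (simp add: m_assoc)
    finally show ?case .
  qed (use a in simp)
  show "b [^] n \<otimes> a = a \<otimes> b [^] n \<otimes> z [^] n" by (rule 1)
  show "(a \<otimes> b) [^] n = a [^] n \<otimes> b [^] n \<otimes> z [^] (n * (n - 1) div 2)"
  proof (induction n)
    case (Suc n)
    let ?k = "n * (n - 1) div 2"
    have k: "n + ?k = Suc n * (Suc n - 1) div 2"
    proof -
      have "Suc n * (Suc n - 1) = n * (n - 1) + n * 2" by (cases n) (auto simp: algebra_simps)
      thus ?thesis by simp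
    qed
    have "(a \<otimes> b) [^] Suc n = a [^] n \<otimes> b [^] n \<otimes> (z [^] ?k \<otimes> a) \<otimes> b" using Suc a b z by (simp add: m_assoc)
    also have "\<dots> = a [^] n \<otimes> (b [^] n \<otimes> a) \<otimes> (z [^] ?k \<otimes> b)" unfolding zpow(1) using a b z by (simp add: m_assoc)
    also have "\<dots> = a [^] n \<otimes> (a \<otimes> b [^] n \<otimes> z [^] n) \<otimes> (b \<otimes> z [^] ?k)" unfolding zpow(2) 1 ..
    also have "\<dots> = a [^] n \<otimes> a \<otimes> b [^] n \<otimes> (z [^] n \<otimes> b) \<otimes> z [^] ?k" using a b z by (simp add: m_assoc)
    also have "\<dots> = a [^] Suc n \<otimes> b [^] Suc n \<otimes> z [^] (n + ?k)"
      unfolding zpow(2) using a b z by (simp add: m_assoc nat_pow_mult[symmetric])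
    finally show ?case unfolding k .
  qed simp
qed

end

context fin_group begin

lemma pow_card_subgroup:
  assumes "subgroup R G" "c \<in> R"
  shows "c [^] card R = \<one>"
proof -
  interpret R: group "G\<lparr>carrier := R\<rparr>" using assms(1) by (rule subgroup_imp_group)
  show ?thesis using R.pow_order_eq_1[of c] assms(2) by (simp add: order_def nat_pow_consistent[symmetric])
qed

lemma hall_higman_abelian_section:
  assumes p: "Factorial_Ring.prime p" and W: "pgr p W" and D: "subgroup D G" "D \<subseteq> W" "normalizes W D"
    and ab: "\<And>u v. u \<in> W \<Longrightarrow> v \<in> W \<Longrightarrow> cj u v \<otimes> inv v \<in> D"
    and R: "subgroup R G" "normalizes R W" "normalizes R D" "\<not> p dvd card R"
    and x: "x \<in> carrier G" "x [^] (p ^ e) = \<one>"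
    and xW: "\<And>w. w \<in> W \<Longrightarrow> cj x w \<in> W" and xD: "\<And>w. w \<in> D \<Longrightarrow> cj x w \<in> D"
    and xR: "\<And>a. a \<in> R \<Longrightarrow> cj x a \<in> R"
    and actcomm: "\<And>a b w. a \<in> R \<Longrightarrow> b \<in> R \<Longrightarrow> w \<in> W \<Longrightarrow> cj a (cj b w) = cj b (cj a w)"
    and engel: "\<And>w. w \<in> W \<Longrightarrow> ecom x (p - 1) w \<in> D"
    and b: "b \<in> R" and w: "w \<in> W"
  shows "cj (b \<otimes> inv (cj x b)) w \<otimes> inv w \<in> D"
proof -
  have Ws: "subgroup W G" using W by (rule pgr_subgroup)
  \<comment> \<open>W, R and x all normalize D, so the whole configuration maps to N_G(D) / D, with
    h as the projection.\<close>
  define N where "N = nrm (carrier G) D"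
  have Ns: "subgroup N G" unfolding N_def using D by (intro subgroup_nrm subgroup_self subgroup.subset)
  have NG: "g \<in> carrier G" if "g \<in> N" for g using that Ns by (simp add: mem_sub)
  note Nc = subgroup.m_closed[OF Ns] subgroup.m_inv_closed[OF Ns] subgroup.one_closed[OF Ns]
  have WN: "W \<subseteq> N" using D(3) Ws by (auto simp: N_def nrm_def normalizes_def mem_sub)
  have RN: "R \<subseteq> N" using R by (auto simp: N_def nrm_def normalizes_def mem_sub)
  have xN: "x \<in> N" using x xD by (auto simp: N_def nrm_def)
  have DN: "D \<subseteq> N" using D WN by auto
  let ?N = "G\<lparr>carrier := N\<rparr>"
  interpret N: group ?N using Ns by (rule subgroup_imp_group)
  have invN: "inv\<^bsub>?N\<^esub> g = inv g" if "g \<in> N" for g using m_inv_consistent[OF Ns that] .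
  have "D \<lhd> ?N"
  proof (rule N.normal_invI)
    show "subgroup D ?N" using D Ns DN by (intro subgroup_incl) auto
    show "g \<otimes>\<^bsub>?N\<^esub> h \<otimes>\<^bsub>?N\<^esub> inv\<^bsub>?N\<^esub> g \<in> D" if "g \<in> carrier ?N" "h \<in> D" for g h
      using that invN[of g] by (simp add: cj_def N_def nrm_def)
  qed
  then interpret D: normal D ?N .
  define Q where "Q = ?N Mod D"
  define h where "h g = D #> g" for g
  have hQ: "h g \<in> carrier Q" if "g \<in> N" for g using that by (auto simp: h_def Q_def carrier_FactGroup)
  have "group Q" unfolding Q_def by (rule D.factorgroup_is_group)
  moreover have "finite (carrier Q)" unfolding Q_def using fin_sub[OF Ns] by (simp add: carrier_FactGroup)
  ultimately interpret Q: fin_group Q by (simp add: fin_group_def fin_group_axioms_def)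
  have hmult: "h (g \<otimes> k) = h g \<otimes>\<^bsub>Q\<^esub> h k" if "g \<in> N" "k \<in> N" for g k
    using D.rcos_sum[of g k] that by (simp add: h_def Q_def)
  have hone: "h \<one> = \<one>\<^bsub>Q\<^esub>" using subgroup.subset[OF D(1)] by (simp add: h_def Q_def)
  have hinv: "h (inv g) = inv\<^bsub>Q\<^esub> h g" if "g \<in> N" for g
    using that hmult[of "inv g" g] hone hQ Nc NG by (intro Q.inv_equality[symmetric]) auto
  have heq: "h g = h k \<longleftrightarrow> g \<otimes> inv k \<in> D" if "g \<in> N" "k \<in> N" for g k
  proof
    assume "h g = h k"
    hence "g \<in> D #> k" using rcos_self[OF NG[OF that(1)] D(1)] by (simp add: h_def)
    then obtain d where "d \<in> D" "g = d \<otimes> k" by (auto simp: r_coset_def)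
    thus "g \<otimes> inv k \<in> D" using that NG DN by (auto simp: m_assoc subset_iff)
  next
    assume d: "g \<otimes> inv k \<in> D"
    have "g = (g \<otimes> inv k) \<otimes> k" using that NG by (simp add: m_assoc)
    hence "g \<in> D #> k" using d unfolding r_coset_def by blast
    thus "h g = h k" unfolding h_def using repr_independence[OF _ NG[OF that(2)] D(1)] by simp
  qed
  have cjN: "cj g k \<in> N" if "g \<in> N" "k \<in> N" for g k using that by (simp add: cj_def Nc)
  have hcj: "Q.cj (h g) (h k) = h (cj g k)" if "g \<in> N" "k \<in> N" for g k
    using that Nc by (simp add: cj_def Q.cj_def hmult hinv)
  have hsub: "subgroup (h ` L) Q" if L: "subgroup L G" "L \<subseteq> N" for L
  proof (rule Q.subgroupI)
    show "h ` L \<subseteq> carrier Q" using hQ L by auto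
    show "h ` L \<noteq> {}" using subgroup.one_closed[OF L(1)] by auto
    show "inv\<^bsub>Q\<^esub> a \<in> h ` L" if "a \<in> h ` L" for a
      using that L by (auto simp: hinv[symmetric] subset_iff intro!: imageI subgroup.m_inv_closed[OF L(1)])
    show "a \<otimes>\<^bsub>Q\<^esub> b \<in> h ` L" if "a \<in> h ` L" "b \<in> h ` L" for a b
      using that L by (auto simp: hmult[symmetric] subset_iff intro!: imageI subgroup.m_closed[OF L(1)])
  qed
  \<comment> \<open>Counting the cosets of D in DL; this makes the image of W a p-group and keeps
    the order of the image of R prime to p.\<close>
  have hcard: "card (h ` L) * card (D \<inter> L) = card L" if L: "subgroup L G" "L \<subseteq> N" for L
  proof -
    have LD: "normalizes L D" using L by (auto simp: N_def nrm_def normalizes_def)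
    have DL: "subgroup (D <#> L) G" using D(1) L(1) LD by (rule subgroup_set_mult)
    interpret DL: group "G\<lparr>carrier := D <#> L\<rparr>" using DL by (rule subgroup_imp_group)
    have "subgroup D (G\<lparr>carrier := D <#> L\<rparr>)"
      using D(1) DL subset_set_mult1[OF D(1) L(1)] by (rule subgroup_incl)
    hence "card (rcosets\<^bsub>G\<lparr>carrier := D <#> L\<rparr>\<^esub> D) * card D = card (D <#> L)"
      using DL.lagrange by (simp add: order_def)
    moreover have "rcosets\<^bsub>G\<lparr>carrier := D <#> L\<rparr>\<^esub> D = h ` L"
    proof -
      have "rcosets\<^bsub>G\<lparr>carrier := D <#> L\<rparr>\<^esub> D = h ` (D <#> L)" by (auto simp: RCOSETS_def h_def r_coset_def)
      also have "\<dots> = h ` L"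
      proof
        show "h ` L \<subseteq> h ` (D <#> L)" using subset_set_mult2[OF D(1) L(1)] by auto
        show "h ` (D <#> L) \<subseteq> h ` L"
        proof clarify
          fix y assume "y \<in> D <#> L"
          then obtain d l where y: "d \<in> D" "l \<in> L" "y = d \<otimes> l" by (auto simp: set_mult_iff)
          hence "h y = h l" using DN L NG Nc by (subst heq) (auto simp: m_assoc subset_iff)
          thus "h y \<in> h ` L" using y by auto
        qed
      qed
      finally show ?thesis .
    qed
    ultimately have "card D * (card (h ` L) * card (D \<inter> L)) = card D * card L"
      using card_set_mult[OF D(1) L(1)] by (metis mult.assoc mult.commute)
    thus ?thesis using card_sub_pos[OF D(1)] by simp
  qed
  have Vp: "Q.pgr p (h ` W)"
  proof -
    obtain n where "card W = p ^ n" using W by (auto simp: pgr_def)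
    hence "card (h ` W) dvd p ^ n" using hcard[OF Ws WN] by (metis dvd_triv_left)
    thus ?thesis using p hsub[OF Ws WN] by (auto simp: Q.pgr_def divides_primepow_nat)
  qed
  have hR: "\<not> p dvd card (h ` R)" using hcard[OF R(1) RN] R(4) by (metis dvd_mult2)
  have cjW: "cj u v \<in> W" if "u \<in> R \<or> u = x" "v \<in> W" for u v
    using that R(2) xW by (auto simp: normalizes_def)
  have hecom: "Q.ecom (h x) k (h u) = h (ecom x k u) \<and> ecom x k u \<in> W" if "u \<in> W" for k u
  proof (induction k)
    case (Suc k)
    moreover have "cj x (ecom x k u) \<in> W" using Suc xW by auto
    ultimately show ?case using xN WN Nc subgroup.m_closed[OF Ws] subgroup.m_inv_closed[OF Ws]
      by (simp add: hcj hinv hmult cjN subset_iff)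
  qed (use that in simp)
  have hpow: "h (x [^] k) = h x [^]\<^bsub>Q\<^esub> k \<and> x [^] k \<in> N" for k :: nat
    by (induction k) (simp_all add: hone hmult xN Nc)
  have "Q.cj (h b \<otimes>\<^bsub>Q\<^esub> inv\<^bsub>Q\<^esub> Q.cj (h x) (h b)) (h w) = h w"
  proof (rule Q.hall_higman_abelian[where V = "h ` W" and R = "h ` R" and e = e, OF _ _ _ _ _ _ _ _ p Vp _ _ hR])
    show "subgroup (h ` W) Q" using Ws WN by (rule hsub)
    show "subgroup (h ` R) Q" using R(1) RN by (rule hsub)
    show "u \<otimes>\<^bsub>Q\<^esub> v = v \<otimes>\<^bsub>Q\<^esub> u" if uvW: "u \<in> h ` W" "v \<in> h ` W" for u v
    proof -
      obtain u' v' where uv: "u' \<in> W" "u = h u'" "v' \<in> W" "v = h v'" using uvW by auto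
      have G: "u' \<in> carrier G" "v' \<in> carrier G" "u' \<in> N" "v' \<in> N" using uv WN NG by auto
      have "(u' \<otimes> v') \<otimes> inv (v' \<otimes> u') = cj u' v' \<otimes> inv v'" using G by (simp add: word_simps)
      hence "h (u' \<otimes> v') = h (v' \<otimes> u')" using G ab[OF uv(1,3)] Nc by (subst heq) auto
      thus ?thesis using uv G by (simp add: hmult)
    qed
    show "Q.normalizes (h ` R) (h ` W)"
      unfolding Q.normalizes_def using RN WN cjW by (auto simp: hcj subset_iff)
    show "h x \<in> carrier Q" using xN by (rule hQ)
    show "Q.cj (h x) v \<in> h ` W" if "v \<in> h ` W" for v using that WN xN xW by (auto simp: hcj subset_iff)
    show "Q.cj (h x) v \<in> h ` R" if "v \<in> h ` R" for v using that RN xN xR by (auto simp: hcj subset_iff)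
    show "Q.cj a (Q.cj c v) = Q.cj c (Q.cj a v)" if acv: "a \<in> h ` R" "c \<in> h ` R" "v \<in> h ` W" for a c v
    proof -
      obtain a' c' v' where "a' \<in> R" "a = h a'" "c' \<in> R" "c = h c'" "v' \<in> W" "v = h v'" using acv by auto
      thus ?thesis using RN WN actcomm[of a' c' v'] by (simp add: hcj cjN subset_iff)
    qed
    show "h x [^]\<^bsub>Q\<^esub> (p ^ e) = \<one>\<^bsub>Q\<^esub>" using hpow[of "p ^ e"] x(2) hone by simp
    show "Q.ecom (h x) (p - 1) v = \<one>\<^bsub>Q\<^esub>" if v: "v \<in> h ` W" for v
    proof -
      obtain v' where v': "v' \<in> W" "v = h v'" using v by auto
      have G: "ecom x (p - 1) v' \<in> N" "ecom x (p - 1) v' \<in> carrier G" using hecom[OF v'(1)] WN NG by auto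
      have "h (ecom x (p - 1) v') = h \<one>" using engel[OF v'(1)] G Nc by (subst heq) auto
      thus ?thesis using hecom[OF v'(1)] v' hone by simp
    qed
    show "h b \<in> h ` R" "h w \<in> h ` W" using b w by auto
  qed
  moreover have mem: "b \<in> N" "w \<in> N" "cj x b \<in> N" using b w RN WN xR by auto
  ultimately have "h (cj (b \<otimes> inv (cj x b)) w) = h w"
    using Nc xN by (simp add: hcj hinv[symmetric] hmult[symmetric])
  thus ?thesis using mem Nc by (subst (asm) heq) (auto intro: cjN)
qed

end

section \<open>Coprime action and the Engel condition\<close>

context fin_group begin

definition engel :: "nat \<Rightarrow> 'a set \<Rightarrow> bool" where
  "engel p P \<longleftrightarrow> (\<forall>w\<in>generate G {y \<in> P. y [^] p = \<one>}. \<forall>x\<in>P. ecom x (p - 1) w = \<one>)"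

lemma minimal_subgroup:
  assumes "subgroup U G" "Q U"
  obtains W where "subgroup W G" "W \<subseteq> U" "Q W"
    "\<And>D. subgroup D G \<Longrightarrow> D \<subset> W \<Longrightarrow> \<not> Q D"
proof -
  let ?S = "{W. subgroup W G \<and> W \<subseteq> U \<and> Q W}"
  have "finite ?S" using fin_sub[OF assms(1)] by (auto intro: finite_subset[of _ "Pow U"])
  moreover have "U \<in> ?S" using assms by auto
  ultimately obtain W where W: "W \<in> ?S" "\<forall>D\<in>?S. D \<subseteq> W \<longrightarrow> W = D"
    using finite_has_minimal[of ?S] by blast
  show thesis
  proof (rule that)
    show "\<not> Q D" if "subgroup D G" "D \<subset> W" for D using that W by blast
  qed (use W in auto)
qed

text \<open>The commutator subgroup and the subgroup generated by it and all \<open>p\<close>-th powers are proper and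
  therefore centralised by \<open>R\<close>; hence \<open>W\<close> has class at most 2, the \<open>p\<close>-th power map on \<open>W\<close> is a
  homomorphism into a subgroup centralised by \<open>R\<close>, and every generator \<open>[g, w]\<close> has order \<open>p\<close>.\<close>

lemma minimal_noncentralized_subgroup:
  assumes p: "Factorial_Ring.prime p" "odd p" and U: "pgr p U" and R: "subgroup R G" "\<not> p dvd card R"
    and T: "T \<subseteq> carrier G" and TU: "normalizes T U" and TR: "normalizes T R" and RU: "normalizes R U"
    and nc: "\<not> centralizes R U"
  obtains W D where "pgr p W" "W \<subseteq> U" "normalizes T W" "normalizes R W" "\<not> centralizes R W"
    "subgroup D G" "D \<subseteq> W" "normalizes W D" "normalizes T D" "normalizes R D" "centralizes R D"
    "\<And>u v. u \<in> W \<Longrightarrow> v \<in> W \<Longrightarrow> cj u v \<otimes> inv v \<in> D" "W \<subseteq> generate G {y \<in> U. y [^] p = \<one>}"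
proof -
  have "subgroup U G" using U by (rule pgr_subgroup)
  then obtain W where W: "subgroup W G" "W \<subseteq> U" "normalizes R W \<and> normalizes T W \<and> \<not> centralizes R W"
    and min: "\<And>D. subgroup D G \<Longrightarrow> D \<subset> W \<Longrightarrow> \<not> (normalizes R D \<and> normalizes T D \<and> \<not> centralizes R D)"
    using minimal_subgroup[of U "\<lambda>W. normalizes R W \<and> normalizes T W \<and> \<not> centralizes R W"] TU RU nc by blast
  have RW: "normalizes R W" and TW: "normalizes T W" and ncW: "\<not> centralizes R W" using W by auto
  have Wp: "pgr p W" using pgr_mono[OF p(1) U W(1,2)] .
  have c: "w \<in> carrier G" if "w \<in> W" for w using that W by (simp add: mem_sub)
  have cR: "g \<in> carrier G" if "g \<in> R" for g using that R by (simp add: mem_sub)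
  note Wc = subgroup.m_closed[OF W(1)] subgroup.m_inv_closed[OF W(1)] subgroup.one_closed[OF W(1)]
  have cjW: "cj g w \<in> W" if "g \<in> W \<or> g \<in> R \<or> g \<in> T" "w \<in> W" for g w
    using that RW TW normalizes_self[OF W(1)] by (auto simp: normalizes_def)
  have proper: "cj g d = d"
    if "subgroup D G" "D \<subset> W" "normalizes R D" "normalizes T D" "g \<in> R" "d \<in> D" for D g d
    using min[of D] that by (auto simp: centralizes_def)
  define S where "S = {cj g w \<otimes> inv w |g w. g \<in> R \<and> w \<in> W}"
  have SW: "S \<subseteq> W" unfolding S_def using cjW by (auto intro!: Wc)
  have SG: "S \<subseteq> carrier G" using SW c by auto
  have S_cj: "cj t s \<in> S" if t: "t \<in> T \<or> t \<in> R" and s: "s \<in> S" for t s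
  proof -
    have tG: "t \<in> carrier G" using t T cR by auto
    obtain g w where gw: "g \<in> R" "w \<in> W" "s = cj g w \<otimes> inv w" using s by (auto simp: S_def)
    have "cj t s = cj (cj t g) (cj t w) \<otimes> inv (cj t w)" using gw tG cR c by (simp add: word_simps)
    moreover have "cj t g \<in> R" "cj t w \<in> W"
      using t gw TR normalizes_self[OF R(1)] cjW by (auto simp: normalizes_def)
    ultimately show ?thesis unfolding S_def by blast
  qed
  \<comment> \<open>W = [R, W]: otherwise R would centralize the proper subgroup generated by S,
    hence every [g, w], and then every w by \<open>coprime_fixed\<close>.\<close>
  have genS: "generate G S = W"
  proof (rule ccontr)
    assume ne: "generate G S \<noteq> W"
    have sub: "generate G S \<subseteq> W" using SW W(1) by (rule generate_subgroup_incl)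
    have gS: "subgroup (generate G S) G" using SG by (rule generate_is_subgroup)
    have norm: "normalizes R (generate G S)" "normalizes T (generate G S)"
      unfolding normalizes_def using cR T S_cj SG by (auto intro!: cj_generate)
    have "centralizes R W" unfolding centralizes_def
    proof (intro ballI)
      fix g w assume g: "g \<in> R" and w: "w \<in> W"
      have "cj g w \<otimes> inv w \<in> generate G S" using g w by (auto simp: S_def intro!: generate.incl)
      hence "cj g (cj g w \<otimes> inv w) = cj g w \<otimes> inv w"
        using proper[OF gS _ norm g] sub ne by blast
      thus "cj g w = w" using coprime_fixed[OF p(1) Wp cR[OF g] pow_card_subgroup[OF R(1) g] R(2) w] cjW g w by blast
    qed
    thus False using ncW by blast
  qed
  \<comment> \<open>The three subgroups argument: R centralizes D and W normalizes D, so the actions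
    of g in R and w in W on D commute, and [g, w] centralizes D. These commutators generate
    W.\<close>
  have central: "cj w d = d"
    if D: "subgroup D G" "D \<subset> W" "normalizes R D" "normalizes T D" "normalizes W D" and w: "w \<in> W" and d: "d \<in> D"
    for D w d
  proof -
    have DG: "d \<in> carrier G" if "d \<in> D" for d using that D c by auto
    let ?C = "{w \<in> W. \<forall>d\<in>D. cj w d = d}"
    have C: "subgroup ?C G" using DG W(1) by (intro subgroup_centralizer) auto
    have "S \<subseteq> ?C"
    proof
      fix s assume "s \<in> S"
      then obtain g w where gw: "g \<in> R" "w \<in> W" "s = cj g w \<otimes> inv w" by (auto simp: S_def)
      have "cj s d = d" if d: "d \<in> D" for d
      proof -
        have dG: "d \<in> carrier G" using d DG by blast
        have d': "cj (inv w) d \<in> D" using D gw d by (auto simp: normalizes_def intro!: Wc)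
        have "cj s d = cj (cj g w) (cj (inv w) d)" using gw dG c cR by (simp add: cj_cj)
        also have "\<dots> = cj (cj g w) (cj g (cj (inv w) d))" using proper[OF D(1-4) gw(1) d'] by simp
        also have "\<dots> = cj g d" using gw dG c cR by (simp add: word_simps)
        also have "\<dots> = d" using proper[OF D(1-4) gw(1) d] .
        finally show ?thesis .
      qed
      thus "s \<in> ?C" using gw cjW by (auto intro!: Wc)
    qed
    hence "generate G S \<subseteq> ?C" using C by (rule generate_subgroup_incl)
    thus ?thesis using w d genS by auto
  qed
  have "{\<one>} \<subset> W"
  proof -
    have "W \<noteq> {\<one>}" using ncW cR by (auto simp: centralizes_def)
    thus ?thesis using Wc by auto
  qed
  \<comment> \<open>M supplies the properness of the commutator subgroup D, which it
    contains.\<close>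
  then obtain M where M: "subgroup M G" "M \<subset> W" "\<forall>a\<in>W. \<forall>b\<in>W. cj a b \<otimes> inv b \<in> M"
    using pgr_maximal_normal[OF p(1) Wp triv_subgroup] by blast
  define K where "K = {cj a b \<otimes> inv b |a b. a \<in> W \<and> b \<in> W}"
  define D where "D = generate G K"
  have KW: "K \<subseteq> W" unfolding K_def using cjW by (auto intro!: Wc)
  have KG: "K \<subseteq> carrier G" using KW c by auto
  have Ds: "subgroup D G" unfolding D_def using KG by (rule generate_is_subgroup)
  have "D \<subseteq> M" unfolding D_def using M by (intro generate_subgroup_incl) (auto simp: K_def)
  hence DW: "D \<subset> W" using M by auto
  have K_cj: "cj t s \<in> K" if t: "t \<in> W \<or> t \<in> R \<or> t \<in> T" and s: "s \<in> K" for t s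
  proof -
    have tG: "t \<in> carrier G" using t T cR c by auto
    obtain a b where ab: "a \<in> W" "b \<in> W" "s = cj a b \<otimes> inv b" using s by (auto simp: K_def)
    have "cj t s = cj (cj t a) (cj t b) \<otimes> inv (cj t b)" using ab tG c by (simp add: word_simps)
    moreover have "cj t a \<in> W" "cj t b \<in> W" using t ab cjW by auto
    ultimately show ?thesis unfolding K_def by blast
  qed
  have nD: "normalizes R D" "normalizes T D" "normalizes W D"
    unfolding normalizes_def D_def using cR T c K_cj KG by (auto intro!: cj_generate)
  have DI: "cj a b \<otimes> inv b \<in> D" if "a \<in> W" "b \<in> W" for a b
    unfolding D_def using that by (auto simp: K_def intro!: generate.incl)
  have Dcent: "d \<otimes> w = w \<otimes> d" if "d \<in> D" "w \<in> W" for d w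
    using central[OF Ds DW nD that(2,1)] that c DW cj_eq_iff_commute[of w d] by auto
  note Dc = subgroup.m_closed[OF Ds] subgroup.m_inv_closed[OF Ds] subgroup.one_closed[OF Ds]
  have Dp: "d [^] n \<in> D" if "d \<in> D" for d and n :: nat using that by (induction n) (auto intro: Dc)
  have Wpow: "w [^] n \<in> W" if "w \<in> W" for w and n :: nat using that by (induction n) (auto intro: Wc)
  define z where "z a b = inv (a \<otimes> b) \<otimes> (b \<otimes> a)" for a b
  have z: "z a b \<in> D" "b \<otimes> a = a \<otimes> b \<otimes> z a b" if "a \<in> W" "b \<in> W" for a b
  proof -
    have "z a b = cj (inv b) (inv a) \<otimes> inv (inv a)" using that c by (simp add: z_def word_simps)
    thus "z a b \<in> D" using that by (auto intro!: DI Wc)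
    show "b \<otimes> a = a \<otimes> b \<otimes> z a b" using that c by (simp add: z_def m_assoc inv_mult_group)
  qed
  have class2: "b [^] n \<otimes> a = a \<otimes> b [^] n \<otimes> z a b [^] n"
    "(a \<otimes> b) [^] n = a [^] n \<otimes> b [^] n \<otimes> z a b [^] (n * (n - 1) div 2)"
    if "a \<in> W" "b \<in> W" for a b and n :: nat
  proof -
    have "z a b \<in> carrier G" using z(1)[OF that] DW c by auto
    note * = class_two_power[OF c[OF that(1)] c[OF that(2)] this z(2)[OF that]
        Dcent[OF z(1)[OF that] that(1)] Dcent[OF z(1)[OF that] that(2)]]
    show "b [^] n \<otimes> a = a \<otimes> b [^] n \<otimes> z a b [^] n" by (rule *(1))
    show "(a \<otimes> b) [^] n = a [^] n \<otimes> b [^] n \<otimes> z a b [^] (n * (n - 1) div 2)" by (rule *(2))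
  qed
  \<comment> \<open>This is W^p D. In class 2 the p-th power map is multiplicative up to elements of
    D, so these products form a subgroup.\<close>
  define E where "E = {w [^] p \<otimes> d |w d. w \<in> W \<and> d \<in> D}"
  have EI: "w [^] p \<otimes> d \<in> E" if "w \<in> W" "d \<in> D" for w d using that by (auto simp: E_def)
  have Es: "subgroup E G"
  proof (rule subgroupI)
    show "E \<subseteq> carrier G" unfolding E_def using c DW by auto
    show "E \<noteq> {}" using EI[OF Wc(3) Dc(3)] by blast
    fix a assume "a \<in> E"
    then obtain w d where wd: "w \<in> W" "d \<in> D" "a = w [^] p \<otimes> d" by (auto simp: E_def)
    have G: "w \<in> carrier G" "d \<in> carrier G" using wd c DW by auto
    have "inv a = inv d \<otimes> inv w [^] p" using G wd by (simp add: inv_mult_group nat_pow_inv)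
    also have "\<dots> = inv w [^] p \<otimes> inv d" using wd by (intro Dcent Wpow Wc Dc)
    finally show "inv a \<in> E" using wd by (simp add: EI Wc Dc)
    fix b assume "b \<in> E"
    then obtain u f where uf: "u \<in> W" "f \<in> D" "b = u [^] p \<otimes> f" by (auto simp: E_def)
    let ?z = "z w u [^] (p * (p - 1) div 2)"
    have zD: "?z \<in> D" using z wd uf by (auto intro: Dp)
    have G': "u \<in> carrier G" "f \<in> carrier G" "?z \<in> carrier G" using uf zD c DW by auto
    have "a \<otimes> b = w [^] p \<otimes> (d \<otimes> u [^] p) \<otimes> f" using wd uf G G' by (simp add: m_assoc)
    also have "d \<otimes> u [^] p = u [^] p \<otimes> d" using wd uf by (intro Dcent Wpow)
    also have "w [^] p \<otimes> (u [^] p \<otimes> d) \<otimes> f = (w \<otimes> u) [^] p \<otimes> (inv ?z \<otimes> d \<otimes> f)"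
      unfolding class2(2)[OF wd(1) uf(1)] using G G' by (simp add: m_assoc)
    finally show "a \<otimes> b \<in> E" using wd uf zD by (simp add: EI Wc Dc)
  qed
  have nE: "normalizes R E" "normalizes T E" "normalizes W E"
  proof -
    have "cj t s \<in> E" if t: "t \<in> W \<or> t \<in> R \<or> t \<in> T" and s: "s \<in> E" for t s
    proof -
      have tG: "t \<in> carrier G" using t T cR c by auto
      obtain w d where wd: "w \<in> W" "d \<in> D" "s = w [^] p \<otimes> d" using s by (auto simp: E_def)
      have "cj t s = cj t w [^] p \<otimes> cj t d" using wd tG c DW by (auto simp: cj_mult cj_pow subset_iff)
      moreover have "cj t w \<in> W" "cj t d \<in> D" using t wd cjW nD by (auto simp: normalizes_def)
      ultimately show ?thesis by (simp add: EI)
    qed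
    thus "normalizes R E" "normalizes T E" "normalizes W E" by (auto simp: normalizes_def)
  qed
  have EW: "E \<subset> W"
  proof -
    have "E \<noteq> W"
    proof
      assume "E = W"
      \<comment> \<open>Iterating W = W^p D gives W = W^(p^n) D for all n. At p^n = |W| this becomes
        W = D, although D is proper.\<close>
      have *: "\<exists>u\<in>W. \<exists>d\<in>D. w = u [^] (p ^ n) \<otimes> d" if "w \<in> W" for w and n :: nat
        using that
      proof (induction n)
        case 0
        thus ?case using c Dc by (intro bexI[of _ w] bexI[of _ \<one>]) auto
      next
        case (Suc n)
        then obtain u d where ud: "u \<in> W" "d \<in> D" "w = u [^] (p ^ n) \<otimes> d" by blast
        have "u \<in> E" using ud(1) \<open>E = W\<close> by simp
        then obtain u' d' where ud': "u' \<in> W" "d' \<in> D" "u = u' [^] p \<otimes> d'"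
          by (auto simp: E_def)
        have G: "u' \<in> carrier G" "d' \<in> carrier G" "d \<in> carrier G" using ud ud' c DW by auto
        have "u' [^] p \<otimes> d' = d' \<otimes> u' [^] p" using ud' by (intro Dcent[symmetric] Wpow)
        hence "u [^] (p ^ n) = (u' [^] p) [^] (p ^ n) \<otimes> d' [^] (p ^ n)"
          unfolding ud'(3) using G by (intro pow_mult_distrib) auto
        hence "w = u' [^] (p ^ Suc n) \<otimes> (d' [^] (p ^ n) \<otimes> d)"
          using ud(3) G by (simp add: nat_pow_pow m_assoc)
        thus ?case using ud ud' Dc Dp by blast
      qed
      obtain k where k: "card W = p ^ k" using Wp by (auto simp: pgr_def)
      have "w \<in> D" if w: "w \<in> W" for w
      proof -
        obtain u d where ud: "u \<in> W" "d \<in> D" "w = u [^] (p ^ k) \<otimes> d" using *[OF w] by blast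
        thus ?thesis using pow_card_subgroup[OF W(1) ud(1)] k DW c by auto
      qed
      thus False using DW by auto
    qed
    moreover have "E \<subseteq> W" unfolding E_def using DW by (auto intro!: Wc Wpow)
    ultimately show ?thesis by auto
  qed
  have powE: "w [^] p \<in> E" if "w \<in> W" for w
  proof -
    have "w [^] p = w [^] p \<otimes> \<one>" using that c by simp
    thus ?thesis using EI[OF that Dc(3)] by simp
  qed
  \<comment> \<open>b^p lies in the proper subgroup E, which is central in W; comparison with b^p a
    = a b^p z^p gives z^p = 1.\<close>
  have zp: "z a b [^] p = \<one>" if "a \<in> W" "b \<in> W" for a b
  proof -
    have G: "a \<in> carrier G" "b \<in> carrier G" "z a b \<in> carrier G" using that z[OF that] c DW by auto
    have "cj a (b [^] p) = b [^] p" using central[OF Es EW nE that(1) powE[OF that(2)]] .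
    hence "a \<otimes> b [^] p = b [^] p \<otimes> a" using G cj_eq_iff_commute by simp
    hence "a \<otimes> b [^] p = a \<otimes> b [^] p \<otimes> z a b [^] p" using class2(1)[OF that, of p] by simp
    thus ?thesis using G l_cancel_one'[of "a \<otimes> b [^] p" "z a b [^] p"] by simp
  qed
  have Sp: "s [^] p = \<one>" if s: "s \<in> S" for s
  proof -
    obtain g w where gw: "g \<in> R" "w \<in> W" "s = cj g w \<otimes> inv w" using s by (auto simp: S_def)
    have G: "g \<in> carrier G" "w \<in> carrier G" "cj g w \<in> W" "inv w \<in> W" using gw cR c cjW Wc by auto
    \<comment> \<open>Oddness of p is needed here: the exponent is a multiple of p, so the
      commutator term of s^p disappears.\<close>
    have "p * (p - 1) div 2 = p * ((p - 1) div 2)" using p(2) by (auto elim!: oddE)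
    hence "z (cj g w) (inv w) [^] (p * (p - 1) div 2) = \<one>"
      using zp[OF G(3,4)] z(1)[OF G(3,4)] DW c by (auto simp: nat_pow_pow[symmetric])
    hence "s [^] p = cj g w [^] p \<otimes> inv w [^] p"
      unfolding gw(3) class2(2)[OF G(3,4)] using G by simp
    also have "cj g w [^] p = cj g (w [^] p)" using G by (simp add: cj_pow)
    also have "\<dots> = w [^] p" using proper[OF Es EW nE(1,2) gw(1) powE[OF gw(2)]] .
    finally show ?thesis using G by (simp add: nat_pow_inv)
  qed
  have "generate G S \<subseteq> generate G {y \<in> U. y [^] p = \<one>}"
    using Sp SW W(2) by (intro mono_generate) auto
  hence "W \<subseteq> generate G {y \<in> U. y [^] p = \<one>}" using genS by simp
  moreover have "centralizes R D" using proper[OF Ds DW nD(1,2)] by (auto simp: centralizes_def)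
  ultimately show thesis using Wp W(2) TW RW ncW Ds DW nD DI by (intro that[of W D]) auto
qed

section \<open>Actions of r-groups under the Engel condition\<close>

lemma coprime_prime_pgr:
  assumes "Factorial_Ring.prime p" "Factorial_Ring.prime r" "p \<noteq> r" "pgr r R"
  shows "\<not> p dvd card R"
  using assms unfolding pgr_def by (metis prime_dvd_power primes_dvd_imp_eq)

lemma commuting_on_of_commutator:
  assumes "a \<in> carrier G" "b \<in> carrier G" "u \<in> carrier G"
    and "\<And>v. v \<in> U \<Longrightarrow> cj (cj a b \<otimes> inv b) v = v" and "cj b (cj a u) \<in> U"
  shows "cj a (cj b u) = cj b (cj a u)"
proof -
  have "cj a (cj b u) = cj (cj a b \<otimes> inv b) (cj b (cj a u))" using assms(1-3) by (simp add: word_simps)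
  thus ?thesis using assms(4,5) by simp
qed

lemma engel_subset: "engel p P \<Longrightarrow> Q \<subseteq> P \<Longrightarrow> engel p Q"
proof -
  assume P: "engel p P" and QP: "Q \<subseteq> P"
  have "generate G {y \<in> Q. y [^] p = \<one>} \<subseteq> generate G {y \<in> P. y [^] p = \<one>}"
    using QP by (intro mono_generate) auto
  thus "engel p Q" using P QP unfolding engel_def by blast
qed

text \<open>The common overgroup P is there because the Engel condition is applied to x in T and to
  products of elements of order p in U. The assumption \<open>fixed\<close> is all that remains of
  the larger group: C_R(T) centralizes U.\<close>

lemma engel_centralizes:
  assumes p: "Factorial_Ring.prime p" "odd p" and r: "Factorial_Ring.prime r" "p \<noteq> r"
    and U: "pgr p U" and T: "pgr p T" and R: "pgr r R"
    and TU: "normalizes T U" and TR: "normalizes T R" and RU: "normalizes R U"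
    and P: "U \<subseteq> P" "T \<subseteq> P" "engel p P"
    and fixed: "\<And>g. g \<in> R \<Longrightarrow> \<forall>t\<in>T. cj t g = g \<Longrightarrow> \<forall>u\<in>U. cj g u = u"
  shows "centralizes R U"
proof (rule ccontr)
  assume nc: "\<not> centralizes R U"
  have Us: "subgroup U G" and Ts: "subgroup T G" using U T by (auto simp: pgr_def)
  have cU: "u \<in> carrier G" if "u \<in> U" for u using that Us by (simp add: mem_sub)
  have cT: "t \<in> carrier G" if "t \<in> T" for t using that Ts by (simp add: mem_sub)
  obtain A where A: "subgroup A G" "A \<subseteq> R" "normalizes T A \<and> \<not> centralizes A U"
    and min: "\<And>D. subgroup D G \<Longrightarrow> D \<subset> A \<Longrightarrow> \<not> (normalizes T D \<and> \<not> centralizes D U)"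
    using minimal_subgroup[of R "\<lambda>A. normalizes T A \<and> \<not> centralizes A U"] TR nc R
    by (auto simp: pgr_def)
  have TA: "normalizes T A" and ncA: "\<not> centralizes A U" using A by auto
  have Ar: "pgr r A" using pgr_mono[OF r(1) R A(1,2)] .
  have pA: "\<not> p dvd card A" using coprime_prime_pgr[OF p(1) r Ar] .
  have cA: "a \<in> carrier G" if "a \<in> A" for a using that A by (simp add: mem_sub)
  have AU: "normalizes A U" using RU A by (auto simp: normalizes_def)
  note Ac = subgroup.m_closed[OF A(1)] subgroup.m_inv_closed[OF A(1)] subgroup.one_closed[OF A(1)]
  have cjA: "cj g a \<in> A" if "g \<in> A \<or> g \<in> T" "a \<in> A" for g a
    using that TA normalizes_self[OF A(1)] by (auto simp: normalizes_def)
  have proper: "cj a u = u" if "subgroup D G" "D \<subset> A" "normalizes T D" "a \<in> D" "u \<in> U" for D a u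
    using min[of D] that by (auto simp: centralizes_def)
  have "{\<one>} \<subset> A"
  proof -
    have "A \<noteq> {\<one>}" using ncA cU by (auto simp: centralizes_def)
    thus ?thesis using Ac by auto
  qed
  then obtain M where M: "subgroup M G" "M \<subset> A" "\<forall>a\<in>A. \<forall>b\<in>A. cj a b \<otimes> inv b \<in> M"
    using pgr_maximal_normal[OF r(1) Ar triv_subgroup] by blast
  \<comment> \<open>The commutators of the r-group A generate a proper T-invariant subgroup, which
    centralizes U by minimality of A; hence A acts on U as an abelian group.\<close>
  define K where "K = {cj a b \<otimes> inv b |a b. a \<in> A \<and> b \<in> A}"
  have KG: "K \<subseteq> carrier G" unfolding K_def using cA by auto
  have Ks: "subgroup (generate G K) G" using KG by (rule generate_is_subgroup)
  have "generate G K \<subseteq> M" using M by (intro generate_subgroup_incl) (auto simp: K_def)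
  hence KA: "generate G K \<subset> A" using M by auto
  have K_cj: "cj t s \<in> K" if t: "t \<in> T" and s: "s \<in> K" for t s
  proof -
    obtain a b where ab: "a \<in> A" "b \<in> A" "s = cj a b \<otimes> inv b" using s by (auto simp: K_def)
    have "cj t s = cj (cj t a) (cj t b) \<otimes> inv (cj t b)" using ab cT[OF t] cA by (simp add: word_simps)
    moreover have "cj t a \<in> A" "cj t b \<in> A" using t ab cjA by auto
    ultimately show ?thesis unfolding K_def by blast
  qed
  have nK: "normalizes T (generate G K)"
    unfolding normalizes_def using cT K_cj KG by (auto intro!: cj_generate)
  have comm: "cj a (cj b u) = cj b (cj a u)" if ab: "a \<in> A" "b \<in> A" and u: "u \<in> U" for a b u
  proof (rule commuting_on_of_commutator[where U = U])
    show "cj (cj a b \<otimes> inv b) v = v" if "v \<in> U" for v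
      using ab by (intro proper[OF Ks KA nK _ that] generate.incl) (auto simp: K_def)
    show "cj b (cj a u) \<in> U" using ab u AU by (auto simp: normalizes_def)
  qed (use ab u cA cU in auto)
  have TG: "T \<subseteq> carrier G" using cT by auto
  obtain W D where W: "pgr p W" "W \<subseteq> U" "normalizes T W" "normalizes A W" "\<not> centralizes A W"
    and D: "subgroup D G" "D \<subseteq> W" "normalizes W D" "normalizes T D" "normalizes A D" "centralizes A D"
    and WD: "\<And>u v. u \<in> W \<Longrightarrow> v \<in> W \<Longrightarrow> cj u v \<otimes> inv v \<in> D"
    and WO: "W \<subseteq> generate G {y \<in> U. y [^] p = \<one>}"
    using minimal_noncentralized_subgroup[OF p U A(1) pA TG TU TA AU ncA] by blast
  have cW: "w \<in> carrier G" if "w \<in> W" for w using that W cU by auto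
  have WP: "W \<subseteq> generate G {y \<in> P. y [^] p = \<one>}"
  proof -
    have "generate G {y \<in> U. y [^] p = \<one>} \<subseteq> generate G {y \<in> P. y [^] p = \<one>}"
      using P(1) by (intro mono_generate) auto
    thus ?thesis using WO by blast
  qed
  obtain e where e: "card T = p ^ e" using T by (auto simp: pgr_def)
  define C where "C = {a \<in> A. \<forall>w\<in>W. cj a w = w}"
  have Cs: "subgroup C G" unfolding C_def using A(1) cW by (intro subgroup_centralizer) auto
  have CA: "C \<subseteq> A" by (auto simp: C_def)
  note Cc = subgroup.m_closed[OF Cs] subgroup.m_inv_closed[OF Cs] subgroup.one_closed[OF Cs]
  \<comment> \<open>The Hall--Higman argument makes [A, T] trivial on W / D only; since A
    centralizes D, \<open>coprime_fixed\<close> lifts this to W.\<close>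
  have AT_C: "b \<otimes> inv (cj x b) \<in> C" if x: "x \<in> T" and b: "b \<in> A" for x b
  proof -
    let ?c = "b \<otimes> inv (cj x b)"
    have cin: "?c \<in> A" using x b by (auto intro!: Ac cjA)
    have "cj ?c w = w" if w: "w \<in> W" for w
    proof -
      have "cj ?c w \<otimes> inv w \<in> D"
      proof (rule hall_higman_abelian_section[OF p(1) W(1) D(1-3) WD A(1) W(4) D(5) pA cT[OF x]])
        show "x [^] (p ^ e) = \<one>" using pow_card_subgroup[OF Ts x] e by simp
        show "cj x w \<in> W" if "w \<in> W" for w using W(3) x that by (auto simp: normalizes_def)
        show "cj x w \<in> D" if "w \<in> D" for w using D(4) x that by (auto simp: normalizes_def)
        show "cj x a \<in> A" if "a \<in> A" for a using x that by (auto intro: cjA)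
        show "cj a (cj b w) = cj b (cj a w)" if "a \<in> A" "b \<in> A" "w \<in> W" for a b w
          using that W(2) by (intro comm) auto
        show "ecom x (p - 1) w \<in> D" if "w \<in> W" for w
        proof -
          have "ecom x (p - 1) w = \<one>" using P(3) P(2) x WP that by (auto simp: engel_def)
          thus ?thesis using subgroup.one_closed[OF D(1)] by simp
        qed
      qed (use b w in auto)
      hence "cj ?c (cj ?c w \<otimes> inv w) = cj ?c w \<otimes> inv w" using D(6) cin by (auto simp: centralizes_def)
      moreover have "cj ?c w \<in> W" using W(4) cin w by (auto simp: normalizes_def)
      ultimately show ?thesis
        using coprime_fixed[OF p(1) W(1) cA[OF cin] pow_card_subgroup[OF A(1) cin] pA w] by blast
    qed
    thus ?thesis using cin by (auto simp: C_def)
  qed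
  have TC: "normalizes T C" unfolding normalizes_def
  proof (intro ballI)
    fix t a assume t: "t \<in> T" and a: "a \<in> C"
    have "cj (cj t a) w = w" if w: "w \<in> W" for w
    proof -
      have G: "t \<in> carrier G" "a \<in> carrier G" "w \<in> carrier G" using cT[OF t] a cA cW[OF w] by (auto simp: C_def)
      have "cj (inv t) w \<in> W" using W(3) t w by (auto simp: normalizes_def intro: subgroup.m_inv_closed[OF Ts])
      hence "cj a (cj (inv t) w) = cj (inv t) w" using a by (auto simp: C_def)
      moreover have "cj (cj t a) w = cj t (cj a (cj (inv t) w))" using G by (simp add: word_simps)
      ultimately show ?thesis using G by simp
    qed
    thus "cj t a \<in> C" using t a cjA by (auto simp: C_def)
  qed
  define Y where "Y = C <#> T"
  have Ys: "subgroup Y G" unfolding Y_def using Cs Ts TC by (rule subgroup_set_mult)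
  have TY: "T \<subseteq> Y" unfolding Y_def using Cs Ts by (rule subset_set_mult2)
  have sylT: "syl p T Y"
  proof -
    have "card Y * card (C \<inter> T) = card C * card T" unfolding Y_def by (rule card_set_mult[OF Cs Ts])
    hence "card Y dvd card C * card T" by (metis dvd_triv_left)
    hence "card Y div card T dvd card C" using card_sub_dvd[OF Ts Ys TY] card_sub_pos[OF Ts]
      by (auto elim!: dvdE)
    moreover have "card C dvd card A" using Cs A CA by (intro card_sub_dvd)
    ultimately have "\<not> p dvd card Y div card T" using pA by (meson dvd_trans)
    thus ?thesis using T Ys TY by (auto simp: syl_def)
  qed
  \<comment> \<open>A Frattini argument in Y = CT. As [A, T] lies in C, the conjugate of T under g
    lies in Y and is Sylow there; some y = tb with b in C carries it back to T. So bg normalizes T,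
    and [bg, T] lies in A \<inter> T = 1. Thus bg is in C_A(T), centralizes U by
    \<open>fixed\<close>, and falls into C.\<close>
  have "g \<in> C" if g: "g \<in> A" for g
  proof -
    have gG: "g \<in> carrier G" using cA[OF g] .
    have "cj g ` T \<subseteq> Y"
    proof clarify
      fix t assume t: "t \<in> T"
      have "cj g t = (g \<otimes> inv (cj t g)) \<otimes> t" using gG cT[OF t] by (simp add: word_simps)
      thus "cj g t \<in> Y" unfolding Y_def using AT_C[OF t g] t by (auto intro: set_multI)
    qed
    moreover have "pgr p (cj g ` T)" using T gG by (rule pgr_cj)
    moreover have "card (cj g ` T) = card T" using gG TG by (rule card_cj_image)
    ultimately have "syl p (cj g ` T) Y" using syl_of_card[OF sylT] by blast
    then obtain y where y: "y \<in> Y" "T = cj y ` cj g ` T" using syl_conjugate[OF p(1) _ sylT] by blast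
    obtain a t where at: "a \<in> C" "t \<in> T" "y = a \<otimes> t" using y(1) by (auto simp: Y_def set_mult_iff)
    define b where "b = cj (inv t) a"
    have bC: "b \<in> C" unfolding b_def using TC at by (auto simp: normalizes_def intro: subgroup.m_inv_closed[OF Ts])
    have G: "a \<in> carrier G" "t \<in> carrier G" "b \<in> carrier G" using at bC cT cA CA by auto
    have ytb: "y = t \<otimes> b" using G at by (simp add: b_def word_simps)
    have bg: "b \<otimes> g \<in> A" using bC g CA Ac by auto
    have "cj (b \<otimes> g) s \<in> T" if s: "s \<in> T" for s
    proof -
      have "cj y (cj g s) \<in> T" using y(2) s by blast
      hence "cj (inv t) (cj y (cj g s)) \<in> T"
        using normalizesD[OF normalizes_self[OF Ts]] at subgroup.m_inv_closed[OF Ts] by blast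
      moreover have "cj (inv t) (cj y (cj g s)) = cj (b \<otimes> g) s"
        unfolding ytb using G gG cT[OF s] by (simp add: word_simps)
      ultimately show ?thesis by simp
    qed
    note bgT = this
    have "cj s (b \<otimes> g) = b \<otimes> g" if s: "s \<in> T" for s
    proof -
      let ?h = "b \<otimes> g"
      have hG: "?h \<in> carrier G" using G gG by simp
      have "cj ?h s \<otimes> inv s \<in> T" using bgT[OF s] s
        by (intro subgroup.m_closed[OF Ts] subgroup.m_inv_closed[OF Ts])
      moreover have "cj ?h s \<otimes> inv s = ?h \<otimes> cj s (inv ?h)" using hG cT[OF s] by (simp add: word_simps)
      moreover have "?h \<otimes> cj s (inv ?h) \<in> A" using bg s by (auto intro!: Ac cjA)
      moreover have "coprime (card A) (card T)" using p(1) T pA by (rule pgr_coprime)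
      ultimately have "cj ?h s \<otimes> inv s = \<one>" using subgroup_inter_trivial[OF A(1) Ts] by metis
      hence "cj ?h s = s" using hG cT[OF s] by (intro cj_fixedI)
      thus ?thesis using cj_fixed_sym[OF hG cT[OF s]] by simp
    qed
    hence "\<forall>u\<in>U. cj (b \<otimes> g) u = u" using bg A(2) by (intro fixed) auto
    hence "b \<otimes> g \<in> C" using bg W(2) by (auto simp: C_def)
    hence "inv b \<otimes> (b \<otimes> g) \<in> C" using bC by (auto intro: Cc)
    thus ?thesis using G gG by simp
  qed
  hence "centralizes A W" by (auto simp: C_def centralizes_def)
  thus False using W(5) by simp
qed

end

section \<open>Local determination of nilpotency\<close>

context fin_group begin

lemma nrm_cj_image:
  assumes H: "subgroup H G" and h: "h \<in> H" and P: "P \<subseteq> carrier G"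
  shows "nrm H (cj h ` P) = cj h ` nrm H P"
proof -
  have c: "x \<in> carrier G" if "x \<in> H" for x using that H by (simp add: mem_sub)
  note Hc = subgroup.m_closed[OF H] subgroup.m_inv_closed[OF H]
  have sub: "cj g ` nrm H A \<subseteq> nrm H (cj g ` A)" if g: "g \<in> H" and A: "A \<subseteq> carrier G" for g A
  proof clarify
    fix x assume x: "x \<in> nrm H A"
    hence xH: "x \<in> H" by (simp add: nrm_def)
    have "cj (cj g x) (cj g a) \<in> cj g ` A" if a: "a \<in> A" for a
    proof -
      have "cj (cj g x) (cj g a) = cj g (cj x a)" using a A c[OF xH] c[OF g] by (auto simp: word_simps subset_iff)
      thus ?thesis using x a by (auto simp: nrm_def)
    qed
    thus "cj g x \<in> nrm H (cj g ` A)" using xH g normalizesD[OF normalizes_self[OF H]] by (auto simp: nrm_def)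
  qed
  have "nrm H (cj h ` P) \<subseteq> cj h ` nrm H P"
  proof
    fix x assume x: "x \<in> nrm H (cj h ` P)"
    have "cj (inv h) ` cj h ` P = P" using c[OF h] P by (force simp: image_image subset_iff)
    moreover have "cj h ` P \<subseteq> carrier G" using c[OF h] P by auto
    ultimately have "cj (inv h) x \<in> nrm H P" using sub[of "inv h" "cj h ` P"] x h Hc by auto
    moreover have "x = cj h (cj (inv h) x)" using c h x by (auto simp: nrm_def)
    ultimately show "x \<in> cj h ` nrm H P" by blast
  qed
  thus ?thesis using sub[OF h P] by blast
qed

lemma pnil_cj_image:
  assumes N: "pnil p N" and g: "g \<in> carrier G"
  shows "pnil p (cj g ` N)"
proof -
  obtain K where K: "rel_complement p {\<one>} K N" using N by (auto simp: pnil_def)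
  note Kd = rel_complementD[OF K]
  have c: "x \<in> carrier G" if "x \<in> N" for x using that Kd by (simp add: mem_sub)
  have cards: "card (cj g ` K) = card K" "card (cj g ` N) = card N"
    using g Kd by (auto simp: card_cj_image subgroup.subset)
  have "cj (cj g n) (cj g k) \<in> cj g ` K" if "n \<in> N" "k \<in> K" for n k
  proof -
    have "cj (cj g n) (cj g k) = cj g (cj n k)" using that c g Kd(3) by (auto simp: word_simps subset_iff)
    thus ?thesis using that Kd(4) by (auto simp: normalizes_def)
  qed
  hence "rel_complement p {\<one>} (cj g ` K) (cj g ` N)"
    using K Kd cards g by (auto simp: rel_complement_def syl_one_iff normalizes_def intro!: subgroup_cj_image)
  thus ?thesis by (auto simp: pnil_def)
qed

lemma prime_power_of_unique_prime_factor:
  assumes p: "Factorial_Ring.prime p" and t: "t > (0::nat)"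
    and q: "\<And>q. Factorial_Ring.prime q \<Longrightarrow> q dvd t \<Longrightarrow> q = p"
  shows "\<exists>k. t = p ^ k"
proof -
  obtain m where m: "t = p ^ multiplicity p t * m" "\<not> p dvd m"
    using multiplicity_decompose'[of t p] t p by (metis gr_implies_not0 not_prime_unit)
  have "m = 1"
  proof (rule ccontr)
    assume "m \<noteq> 1"
    then obtain q where "Factorial_Ring.prime q" "q dvd m" using prime_factor_nat by blast
    thus False using q[of q] m by (metis dvd_mult)
  qed
  thus ?thesis using m by auto
qed

text \<open>M maps onto the p-group H / K, hence so does its Sylow subgroup T; so H = KT.\<close>

lemma syl_frattini_product:
  assumes p: "Factorial_Ring.prime p" and K: "rel_complement p U K H"
    and M: "subgroup M G" "M \<subseteq> H" "K <#> M = H" and T: "syl p T M"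
  shows "card H * card (K \<inter> T) = card K * card T"
proof -
  note Kd = rel_complementD[OF K]
  have Ts: "subgroup T G" "T \<subseteq> M" "T \<subseteq> H" using sylD[OF T] M by auto
  obtain n where n: "card H = card K * p ^ n" using K by (auto simp: rel_complement_def)
  obtain m where m: "card T = p ^ m * card (K \<inter> T)" "card (K <#> T) = card K * p ^ m"
    using normal_p_index_product[OF p Kd(2-4,1) n Ts(1,3)] by blast
  obtain m' where m': "card M = p ^ m' * card (K \<inter> M)" "card (K <#> M) = card K * p ^ m'"
    using normal_p_index_product[OF p Kd(2-4,1) n M(1,2)] by blast
  have "m' = n" using m'(2) n M(3) card_sub_pos[OF Kd(2)] prime_gt_1_nat[OF p] by simp
  have sub: "subgroup (K \<inter> T) G" "subgroup (K \<inter> M) G" using Kd(2) Ts(1) M(1) by (auto intro: subgroups_Inter_pair)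
  have "card (K \<inter> T) dvd card (K \<inter> M)" using sub Ts by (intro card_sub_dvd) auto
  then obtain s where s: "card (K \<inter> M) = card (K \<inter> T) * s" by auto
  have "n \<le> m"
  proof (rule ccontr)
    assume "\<not> n \<le> m"
    then obtain j where "n = m + Suc j" by (metis add_Suc_right less_imp_Suc_add not_le)
    hence "card M = card T * (p * (p ^ j * s))" using m'(1) m(1) s \<open>m' = n\<close> by (simp add: power_add algebra_simps)
    hence "card M div card T = p * (p ^ j * s)" using card_sub_pos[OF Ts(1)] by simp
    thus False using T by (auto simp: syl_def)
  qed
  hence "card H \<le> card (K <#> T)" using n m(2) p by (auto intro!: power_increasing simp: prime_ge_1_nat Suc_leI prime_gt_0_nat)
  moreover have "K <#> T \<subseteq> H" using Kd Ts by (intro set_mult_subset) auto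
  ultimately have "card (K <#> T) = card H" using card_mono[OF fin_sub[OF Kd(1)]] by (metis le_antisym)
  thus ?thesis using card_set_mult[OF Kd(2) Ts(1)] by simp
qed

text \<open>C_K(U) contains a Sylow r-subgroup of K for every r \<noteq> p, so its index in K, and
  then in H, is a power of p. Its own Sylow p-subgroup U \<inter> C_K(U) is central in it.\<close>

lemma pnil_of_centralizing:
  assumes p: "Factorial_Ring.prime p" and K: "rel_complement p U K H" and HU: "normalizes H U"
    and cent: "\<And>r R. Factorial_Ring.prime r \<Longrightarrow> r \<noteq> p \<Longrightarrow> pgr r R \<Longrightarrow> R \<subseteq> K \<Longrightarrow> centralizes R U"
  shows "pnil p H"
proof -
  note Kd = rel_complementD[OF K]
  have c: "x \<in> carrier G" if "x \<in> H" for x using that Kd by (simp add: mem_sub)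
  have cU: "x \<in> carrier G" if "x \<in> U" for x using that Kd by (simp add: mem_sub)
  define C where "C = {k \<in> K. \<forall>u\<in>U. cj k u = u}"
  have Cs: "subgroup C G" unfolding C_def using Kd cU by (intro subgroup_centralizer) auto
  have CK: "C \<subseteq> K" by (auto simp: C_def)
  have HC: "normalizes H C" unfolding normalizes_def
  proof (intro ballI)
    fix h k assume h: "h \<in> H" and k: "k \<in> C"
    have "cj (cj h k) u = u" if u: "u \<in> U" for u
    proof -
      have G: "h \<in> carrier G" "k \<in> carrier G" "u \<in> carrier G" using c h k CK Kd(3) cU u by auto
      have "cj (inv h) u \<in> U" using HU h u by (auto simp: normalizes_def intro: subgroup.m_inv_closed[OF Kd(1)])
      hence "cj k (cj (inv h) u) = cj (inv h) u" using k by (auto simp: C_def)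
      moreover have "cj (cj h k) u = cj h (cj k (cj (inv h) u))" using G by (simp add: word_simps)
      ultimately show ?thesis using G by simp
    qed
    thus "cj h k \<in> C" using h k Kd(4) by (auto simp: C_def normalizes_def)
  qed
  obtain t where t: "card K = card C * t" using card_sub_dvd[OF Cs Kd(2) CK] by auto
  have t0: "t > 0" using t card_sub_pos[OF Kd(2)] by (cases t) auto
  have "q = p" if q: "Factorial_Ring.prime q" "q dvd t" for q
  proof (rule ccontr)
    assume qp: "q \<noteq> p"
    obtain R where R: "syl q R K" using syl_exists[OF q(1) Kd(2)] by auto
    have "R \<subseteq> C" using cent[OF q(1) qp sylD(1)[OF R] sylD(4)[OF R]] sylD(4)[OF R]
      by (auto simp: C_def centralizes_def)
    hence "card R dvd card C" using sylD(2)[OF R] Cs by (intro card_sub_dvd)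
    then obtain s where "card C = card R * s" by auto
    hence "card K div card R = s * t" using t card_sub_pos[OF sylD(2)[OF R]] by (simp add: mult.assoc)
    thus False using R q by (auto simp: syl_def)
  qed
  then obtain j where j: "t = p ^ j" using prime_power_of_unique_prime_factor[OF p t0] by blast
  let ?Z = "U \<inter> C"
  have Zs: "subgroup ?Z G" using Kd(6) Cs by (rule subgroups_Inter_pair)
  have sylZ: "syl p ?Z C"
  proof -
    have CU: "normalizes C U" using HU CK Kd(3) by (auto simp: normalizes_def)
    have UC: "subgroup (U <#> C) G" using Kd(6) Cs CU by (rule subgroup_set_mult)
    have UCK: "U <#> C \<subseteq> K" using Kd CK by (intro set_mult_subset) auto
    obtain a where a: "card (U <#> C) = card U * a"
      using card_sub_dvd[OF Kd(6) UC subset_set_mult1[OF Kd(6) Cs]] by auto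
    obtain b where b: "card K = card (U <#> C) * b" using card_sub_dvd[OF UC Kd(2) UCK] by auto
    have "card K div card U = a * b" using a b card_sub_pos[OF Kd(6)] by (simp add: mult.assoc)
    hence "\<not> p dvd a" using Kd(5) by (auto simp: syl_def)
    moreover have "card C = a * card ?Z"
      using card_set_mult[OF Kd(6) Cs] a card_sub_pos[OF Kd(6)] by (simp add: mult.assoc)
    hence "card C div card ?Z = a" using card_sub_pos[OF Zs] by simp
    moreover have "pgr p ?Z" using pgr_mono[OF p Kd(8) Zs] by auto
    ultimately show ?thesis using Cs by (auto simp: syl_def)
  qed
  have triv: "cj g x = x" if "g \<in> C" "x \<in> ?Z" for g x using that by (auto simp: C_def)
  have cZ: "x \<in> carrier G" if "x \<in> ?Z" for x using that cU by auto
  \<comment> \<open>Fusion in C is trivial on the central subgroup Z, so the transfer kernel for M =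
    {1} is a normal p-complement, as in Burnside's theorem.\<close>
  have "\<exists>N. subgroup N G \<and> N \<subseteq> C \<and> normalizes C N \<and> {\<one>} \<subseteq> N \<and> N \<inter> ?Z = {\<one>} \<and>
      card C * card {\<one>} = card N * card ?Z"
  proof (rule normal_subgroup_of_fusion[OF p sylZ triv_subgroup])
    show "{\<one>} \<subseteq> ?Z" using subgroup.one_closed[OF Zs] by auto
    show "normalizes ?Z {\<one>}" using cU by (auto simp: normalizes_def)
    show "cj a b \<otimes> inv b \<in> {\<one>}" if "a \<in> ?Z" "b \<in> ?Z" for a b
      using triv[of a b] that cZ by auto
    show "cj g x \<otimes> inv x \<in> {\<one>}" if "x \<in> ?Z" "g \<in> C" "cj g x \<in> ?Z" for x g
      using triv[of g x] that cZ by auto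
  qed
  then obtain N where N: "subgroup N G" "N \<subseteq> C" "normalizes C N" "card C = card N * card ?Z" by auto
  have "card C div card ?Z = card N" using N(4) card_sub_pos[OF Zs] by simp
  hence "\<not> p dvd card N" using sylZ by (auto simp: syl_def)
  moreover obtain i where "card ?Z = p ^ i" using sylD(1)[OF sylZ] by (auto simp: pgr_def)
  ultimately have "rel_complement p {\<one>} N C" using N Cs by (auto simp: rel_complement_def syl_one_iff)
  hence "pnil p C" by (auto simp: pnil_def)
  moreover obtain n where "card H = card K * p ^ n" using K by (auto simp: rel_complement_def)
  hence "card H = card C * p ^ (j + n)" using t j by (simp add: power_add mult.assoc)
  ultimately show ?thesis using pnil_extend[OF p _ Kd(1) _ HC] CK Kd(3) by blast
qed

text \<open>The induction stays inside one group, so the Engel condition on its p-subgroups is at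
  hand for every H.\<close>

theorem pnil_of_nrm_pnil:
  assumes p: "Factorial_Ring.prime p" "odd p" and eng: "\<And>Q. pgr p Q \<Longrightarrow> engel p Q"
  shows "syl p S H \<Longrightarrow> pnil p (nrm H S) \<Longrightarrow> pnil p H"
proof (induction "card H" arbitrary: H S rule: less_induct)
  case less
  have H: "subgroup H G" using less.prems(1) by (rule sylD)
  have c: "x \<in> carrier G" if "x \<in> H" for x using that H by (simp add: mem_sub)
  have fH: "finite H" using H by (rule fin_sub)
  have IH: "pnil p N" if "subgroup N G" "N \<subset> H" "syl p Q N" "pnil p (nrm N Q)" for N Q
    using less.hyps[OF _ that(3,4)] psubset_card_mono[OF fH that(2)] by blast
  have all_syl: "pnil p (nrm H P)" if P: "syl p P H" for P
  proof -
    obtain h where h: "h \<in> H" "P = cj h ` S" using syl_conjugate[OF p(1) less.prems(1) P] by auto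
    have "nrm H P = cj h ` nrm H S"
      unfolding h(2) using H h sylD(2)[OF less.prems(1)] by (intro nrm_cj_image) (auto simp: mem_sub)
    thus ?thesis using pnil_cj_image[OF less.prems(2) c[OF h(1)]] by simp
  qed
  let ?S = "{U. pgr p U \<and> U \<subseteq> H \<and> normalizes H U}"
  have "finite ?S" using fH by (auto intro: finite_subset[of _ "Pow H"])
  moreover have "{\<one>} \<in> ?S" using subgroup.one_closed[OF H] c by (auto simp: pgr_one normalizes_def)
  ultimately obtain U where U: "U \<in> ?S" and maxU: "\<forall>V\<in>?S. U \<subseteq> V \<longrightarrow> U = V"
    using finite_has_maximal[of ?S] by blast
  have Up: "pgr p U" "U \<subseteq> H" "normalizes H U" using U by auto
  have Us: "subgroup U G" using Up by (simp add: pgr_def)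
  have nrm_sub: "subgroup (nrm N V) G" if "subgroup N G" "subgroup V G" for N V
    using that by (auto intro!: subgroup_nrm subgroup.subset)
  \<comment> \<open>An inner induction, upward in the order of a Sylow subgroup Q of N_H(V).
    Maximality of U makes N_H(V) proper in H, so the outer induction reduces its p-nilpotency to
    that of N_H(Q). If Q is Sylow in H, this is the hypothesis; otherwise normalizers grow, N_H(Q)
    has a larger Sylow subgroup, and the inner induction applies with Q in place of V.\<close>
  have loc_syl: "syl p Q (nrm H V) \<Longrightarrow> pgr p V \<Longrightarrow> U \<subset> V \<Longrightarrow> V \<subseteq> H \<Longrightarrow> pnil p (nrm H V)" for V Q
  proof (induction "card H - card Q" arbitrary: V Q rule: less_induct)
    case (less Q V)
    let ?N = "nrm H V"
    have Vs: "subgroup V G" using less.prems(2) by (rule pgr_subgroup)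
    have Ns: "subgroup ?N G" using H Vs by (rule nrm_sub)
    have NH: "?N \<subset> H"
    proof -
      have "?N \<noteq> H"
      proof
        assume "?N = H"
        hence "normalizes H V" using normalizes_nrm[of H V] by simp
        thus False using maxU less.prems by blast
      qed
      thus ?thesis using nrm_subset by blast
    qed
    have VN: "V \<subseteq> ?N" using subgroup_subset_nrm[OF Vs less.prems(4)] .
    have VQ: "V \<subseteq> Q"
      using normal_pgr_subset_syl[OF p(1) less.prems(2) VN normalizes_nrm less.prems(1)] .
    have Qs: "subgroup Q G" "Q \<subseteq> H" using sylD[OF less.prems(1)] NH by auto
    obtain P where P: "syl p P H" "Q \<subseteq> P" using syl_extends[OF p(1) sylD(1)[OF less.prems(1)] Qs(2) H] by auto
    have "pnil p (nrm H Q)"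
    proof (cases "Q = P")
      case True
      thus ?thesis using all_syl P by simp
    next
      case False
      hence QP: "Q \<subset> P" using P by auto
      obtain g where g: "g \<in> P - Q" "\<forall>q\<in>Q. cj g q \<in> Q"
        using normalizer_grows[OF p(1) sylD(1)[OF P(1)] Qs(1) QP] by auto
      have "pgr p (nrm P Q)"
        using pgr_mono[OF p(1) sylD(1)[OF P(1)] nrm_sub[OF sylD(2)[OF P(1)] Qs(1)] nrm_subset] .
      moreover have "nrm P Q \<subseteq> nrm H Q" using sylD(4)[OF P(1)] by (auto simp: nrm_def)
      ultimately obtain T where T: "syl p T (nrm H Q)" "nrm P Q \<subseteq> T"
        using syl_extends[OF p(1) _ _ nrm_sub[OF H Qs(1)]] by blast
      have "Q \<subseteq> nrm P Q" using Qs(1) P(2) by (rule subgroup_subset_nrm)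
      hence "Q \<subset> T" using T(2) g by (auto simp: nrm_def)
      hence "card Q < card T" using fin_sub[OF sylD(2)[OF T(1)]] by (rule psubset_card_mono[rotated])
      moreover have "T \<subseteq> H" using sylD(4)[OF T(1)] nrm_subset by blast
      hence "card T \<le> card H" using fH by (rule card_mono[rotated])
      ultimately have "card H - card T < card H - card Q" by simp
      from less.hyps[OF this T(1) sylD(1)[OF less.prems(1)]] show ?thesis using less.prems(3) VQ Qs by blast
    qed
    moreover have "nrm ?N Q \<subseteq> nrm H Q" using NH by (auto simp: nrm_def)
    ultimately have "pnil p (nrm ?N Q)" using pnil_mono[OF p(1) _ nrm_sub[OF Ns Qs(1)]] by blast
    thus ?case using IH[OF Ns NH less.prems(1)] by blast
  qed
  have loc: "pnil p (nrm H V)" if V: "pgr p V" "U \<subset> V" "V \<subseteq> H" for V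
  proof -
    obtain Q where "syl p Q (nrm H V)" using syl_exists[OF p(1) nrm_sub[OF H pgr_subgroup[OF V(1)]]] by auto
    thus ?thesis using loc_syl V by blast
  qed
  obtain K where K: "rel_complement p U K H"
    using rel_complement_exists[OF p(1) Up(1) H Up(2,3) loc] by blast
  note Kd = rel_complementD[OF K]
  have cent: "centralizes R0 U" if r: "Factorial_Ring.prime r" "r \<noteq> p" and R0: "pgr r R0" "R0 \<subseteq> K" for r R0
  proof -
    \<comment> \<open>The Frattini argument needs a full Sylow subgroup of K, so the r-subgroup is
      enlarged first.\<close>
    obtain R where R: "syl r R K" "R0 \<subseteq> R" using syl_extends[OF r(1) R0 Kd(2)] by auto
    have Rs: "subgroup R G" "R \<subseteq> H" using sylD[OF R(1)] Kd by auto
    define M where "M = nrm H R"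
    have Ms: "subgroup M G" "M \<subseteq> H" unfolding M_def using nrm_sub[OF H Rs(1)] nrm_subset by auto
    have KM: "K <#> M = H"
    proof
      show "K <#> M \<subseteq> H" using H Kd(3) Ms(2) by (rule set_mult_subset)
      show "H \<subseteq> K <#> M"
      proof
        fix h assume h: "h \<in> H"
        obtain k where k: "k \<in> K" "k \<otimes> h \<in> M" using frattini[OF r(1) H Kd(3,4) R(1) h] by (auto simp: M_def)
        have "h = inv k \<otimes> (k \<otimes> h)" using k h c Kd(3) by auto
        thus "h \<in> K <#> M" using k subgroup.m_inv_closed[OF Kd(2)] unfolding set_mult_iff by blast
      qed
    qed
    obtain T where T: "syl p T M" using syl_exists[OF p(1) Ms(1)] by auto
    have Ts: "subgroup T G" "pgr p T" "T \<subseteq> M" using sylD[OF T] by auto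
    have TU: "normalizes T U" and RU: "normalizes R U" using Up(3) Ts Ms Rs by (auto simp: normalizes_def)
    have TR: "normalizes T R" using Ts by (auto simp: normalizes_def M_def nrm_def)
    define P where "P = U <#> T"
    have Pp: "pgr p P" unfolding P_def using p(1) Up(1) Ts(2) TU by (rule pgr_set_mult)
    have UP: "U \<subseteq> P" and TP: "T \<subseteq> P"
      unfolding P_def using subset_set_mult1[OF Us Ts(1)] subset_set_mult2[OF Us Ts(1)] by auto
    have PH: "P \<subseteq> H" unfolding P_def using H Up(2) Ts Ms by (intro set_mult_subset) auto
    \<comment> \<open>U is the normal Sylow subgroup of K, so U \<inter> T = K \<inter> T; hence the
      index of UT in H equals that of U in K.\<close>
    have sylP: "syl p P H"
    proof -
      have KT: "subgroup (K \<inter> T) G" using Kd(2) Ts(1) by (rule subgroups_Inter_pair)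
      have "K \<inter> T \<subseteq> U"
      proof (rule normal_syl_contains[OF p(1) Kd(5)])
        show "normalizes K U" using Up(3) Kd(3) by (rule normalizes_mono)
        show "pgr p (K \<inter> T)" using pgr_mono[OF p(1) Ts(2) KT] by auto
      qed auto
      hence eq: "U \<inter> T = K \<inter> T" using Kd(7) by auto
      obtain s where s: "card K = card U * s" using card_sub_dvd[OF Us Kd(2,7)] by auto
      have "card H * card (K \<inter> T) = card U * s * card T"
        using syl_frattini_product[OF p(1) K Ms KM T] s by simp
      also have "\<dots> = s * card P * card (K \<inter> T)"
        using card_set_mult[OF Us Ts(1)] eq by (simp add: P_def mult.assoc mult.left_commute)
      finally have "card H = s * card P" using card_sub_pos[OF KT] by simp
      hence "card H div card P = s" using card_sub_pos[OF pgr_subgroup[OF Pp]] by simp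
      moreover have "card K div card U = s" using s card_sub_pos[OF Us] by simp
      ultimately have "\<not> p dvd card H div card P" using Kd(5) by (simp add: syl_def)
      thus ?thesis using Pp PH H by (simp add: syl_def)
    qed
    have pR: "\<not> p dvd card R" using coprime_prime_pgr[OF p(1) r(1)] r(2) sylD(1)[OF R(1)] by blast
    have "\<forall>u\<in>U. cj g u = u" if g: "g \<in> R" and gT: "\<forall>t\<in>T. cj t g = g" for g
    proof -
      \<comment> \<open>A subgroup of order prime to p in a p-nilpotent group centralizes every
        normal p-subgroup; here it is C_R(T) in N_H(UT), acting on UT.\<close>
      define Z where "Z = {g \<in> R. \<forall>t\<in>T. cj g t = t}"
      have cT: "t \<in> carrier G" if "t \<in> T" for t using that Ts by (simp add: mem_sub)
      have Zs: "subgroup Z G" unfolding Z_def using Rs(1) cT by (intro subgroup_centralizer) auto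
      have "card Z dvd card R" using Zs Rs(1) by (intro card_sub_dvd) (auto simp: Z_def)
      hence pZ: "\<not> p dvd card Z" using pR by (meson dvd_trans)
      have gZ: "g \<in> Z" using g gT cj_fixed_sym c Rs(2) cT by (auto simp: Z_def)
      have ZN: "Z \<subseteq> nrm H P"
      proof
        fix k assume k: "k \<in> Z"
        hence kH: "k \<in> H" using Rs by (auto simp: Z_def)
        have "cj k y \<in> P" if y: "y \<in> P" for y
        proof -
          obtain u t where ut: "u \<in> U" "t \<in> T" "y = u \<otimes> t" using y by (auto simp: P_def set_mult_iff)
          have "cj k y = cj k u \<otimes> t" using ut k kH c Up(2) cT by (auto simp: cj_mult Z_def)
          thus ?thesis using ut kH Up(3) by (auto simp: P_def normalizes_def intro: set_multI)
        qed
        thus "k \<in> nrm H P" using kH by (auto simp: nrm_def)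
      qed
      have "P \<subseteq> nrm H P" using pgr_subgroup[OF Pp] PH by (rule subgroup_subset_nrm)
      hence "cj g y = y" if "y \<in> P" for y
        using pnil_centralizes[OF p(1) all_syl[OF sylP] Zs ZN pZ Pp _ normalizes_nrm gZ that] by blast
      thus ?thesis using UP by blast
    qed
    hence "centralizes R U"
      using r(2) by (intro engel_centralizes[OF p r(1) _ Up(1) Ts(2) sylD(1)[OF R(1)] TU TR RU UP TP eng[OF Pp]]) auto
    thus ?thesis using R(2) by (auto simp: centralizes_def)
  qed
  show ?case by (rule pnil_of_centralizing[OF p(1) K Up(3)]) (rule cent)
qed

end

section \<open>The upper central series and the Engel condition\<close>

context group begin

text \<open>Describing the next term by commutators requires the current one to be normal, and
  normality of the next term is read off from that description; hence the joint proof.\<close>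

lemma upper_central_normal: "upper_central G k \<lhd> G"
  and upper_central_Suc_iff: "w \<in> upper_central G (Suc k) \<longleftrightarrow>
    w \<in> carrier G \<and> (\<forall>x\<in>carrier G. cj x w \<otimes> inv w \<in> upper_central G k)"
proof -
  have iff: "w \<in> upper_central G (Suc k) \<longleftrightarrow>
      w \<in> carrier G \<and> (\<forall>x\<in>carrier G. cj x w \<otimes> inv w \<in> upper_central G k)"
    if "upper_central G k \<lhd> G" for k w
  proof -
    let ?Z = "upper_central G k"
    interpret Z: normal ?Z G by (rule that)
    have eq: "?Z #> (w \<otimes> x) = ?Z #> (x \<otimes> w) \<longleftrightarrow> cj x w \<otimes> inv w \<in> ?Z"
      if "w \<in> carrier G" "x \<in> carrier G" for x
    proof -
      have m: "x \<otimes> w \<in> carrier G" "w \<otimes> x \<in> carrier G" using that by auto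
      have "(x \<otimes> w) \<otimes> inv (w \<otimes> x) = cj x w \<otimes> inv w" using that by (simp add: word_simps)
      moreover have "?Z #> (w \<otimes> x) = ?Z #> (x \<otimes> w) \<longleftrightarrow> (x \<otimes> w) \<otimes> inv (w \<otimes> x) \<in> ?Z"
        using m Z.rcos_module[OF is_group m(2,1)] rcos_self[OF m(1) Z.is_subgroup]
          repr_independence[OF _ m(2) Z.is_subgroup] by metis
      ultimately show ?thesis by simp
    qed
    have "w \<in> upper_central G (Suc k) \<longleftrightarrow>
        w \<in> carrier G \<and> (\<forall>x\<in>carrier G. ?Z #> (w \<otimes> x) = ?Z #> (x \<otimes> w))"
      by (auto simp: center_def carrier_FactGroup Z.rcos_sum)
    thus ?thesis using eq by blast
  qed
  have normal: "upper_central G k \<lhd> G" for k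
  proof (induction k)
    case 0
    show ?case by (simp add: one_is_normal)
  next
    case (Suc k)
    let ?Z = "upper_central G k" and ?Y = "upper_central G (Suc k)"
    interpret Z: normal ?Z G by (rule Suc)
    note Y = iff[OF Suc]
    have Zn: "cj g z \<in> ?Z" if "g \<in> carrier G" "z \<in> ?Z" for g z
      using Z.inv_op_closed2[OF that] by (simp add: cj_def)
    show ?case
    proof (rule normal_invI)
      show "subgroup ?Y G"
      proof (rule subgroupI)
        show "?Y \<subseteq> carrier G" using Y by blast
        have "\<one> \<in> ?Y" unfolding Y by auto
        thus "?Y \<noteq> {}" by blast
        fix a assume a: "a \<in> ?Y"
        hence aG: "a \<in> carrier G" using Y by blast
        have "cj x (inv a) \<otimes> inv (inv a) = cj (inv a) (inv (cj x a \<otimes> inv a))" if "x \<in> carrier G" for x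
          using that aG by (simp add: word_simps)
        moreover have "cj (inv a) (inv (cj x a \<otimes> inv a)) \<in> ?Z" if "x \<in> carrier G" for x
          using that a aG unfolding Y by (intro Zn Z.m_inv_closed) auto
        ultimately show "inv a \<in> ?Y" unfolding Y using aG by auto
        fix b assume b: "b \<in> ?Y"
        hence bG: "b \<in> carrier G" using Y by blast
        have "cj x (a \<otimes> b) \<otimes> inv (a \<otimes> b) = (cj x a \<otimes> inv a) \<otimes> cj a (cj x b \<otimes> inv b)"
          if "x \<in> carrier G" for x using that aG bG by (simp add: word_simps)
        moreover have "(cj x a \<otimes> inv a) \<otimes> cj a (cj x b \<otimes> inv b) \<in> ?Z" if "x \<in> carrier G" for x
        proof -
          have "cj x a \<otimes> inv a \<in> ?Z" "cj x b \<otimes> inv b \<in> ?Z" using that a b unfolding Y by blast+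
          thus ?thesis using Z.m_closed Zn[OF aG] by blast
        qed
        ultimately show "a \<otimes> b \<in> ?Y" unfolding Y using aG bG by auto
      qed
      fix g w assume g: "g \<in> carrier G" and w: "w \<in> ?Y"
      hence wG: "w \<in> carrier G" using Y by blast
      have "cj x (cj g w) \<otimes> inv (cj g w) = cj g (cj (cj (inv g) x) w \<otimes> inv w)" if "x \<in> carrier G" for x
        using that g wG by (simp add: word_simps)
      moreover have "cj g (cj (cj (inv g) x) w \<otimes> inv w) \<in> ?Z" if "x \<in> carrier G" for x
        using that g w unfolding Y by (intro Zn) auto
      ultimately have "cj g w \<in> ?Y" unfolding Y using g wG by auto
      thus "g \<otimes> w \<otimes> inv g \<in> ?Y" by (simp only: cj_def)
    qed
  qed
  show "upper_central G k \<lhd> G" by (rule normal)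
  show "w \<in> upper_central G (Suc k) \<longleftrightarrow>
      w \<in> carrier G \<and> (\<forall>x\<in>carrier G. cj x w \<otimes> inv w \<in> upper_central G k)"
    by (rule iff[OF normal])
qed

text \<open>Each commutator with x descends one step of the series; this turns p-centrality of
  height p - 1 into the Engel condition.\<close>

lemma ecom_upper_central:
  "w \<in> upper_central G k \<Longrightarrow> x \<in> carrier G \<Longrightarrow> ecom x k w = \<one>"
proof (induction k arbitrary: w)
  case (Suc k)
  hence "cj x w \<otimes> inv w \<in> upper_central G k" using upper_central_Suc_iff by blast
  thus ?case using Suc ecom_shift by metis
qed simp

end

context fin_group begin

text \<open>P is an abstract group, possibly over another type, so the condition has to be carried
  into G along an embedding.\<close>

lemma engel_hom_image:
  assumes P: "group P" and \<phi>: "\<phi> \<in> hom P G" "inj_on \<phi> (carrier P)" and h: "p_central_of_height p (p - 1) P"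
  shows "engel p (\<phi> ` carrier P)"
proof -
  interpret P: group P by (rule P)
  interpret \<phi>: group_hom P G \<phi> using \<phi>(1) by unfold_locales
  let ?O = "{z \<in> carrier P. z [^]\<^bsub>P\<^esub> p = \<one>\<^bsub>P\<^esub>}"
  have "{y \<in> \<phi> ` carrier P. y [^] p = \<one>} = \<phi> ` ?O"
  proof -
    have "\<phi> z [^] p = \<one> \<longleftrightarrow> z [^]\<^bsub>P\<^esub> p = \<one>\<^bsub>P\<^esub>" if "z \<in> carrier P" for z
      using that \<phi>(2) by (metis P.nat_pow_closed P.one_closed \<phi>.hom_nat_pow \<phi>.hom_one inj_onD)
    thus ?thesis by auto
  qed
  moreover have "generate G (\<phi> ` ?O) = \<phi> ` generate P ?O" by (rule \<phi>.generate_img) auto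
  ultimately have gen: "generate G {y \<in> \<phi> ` carrier P. y [^] p = \<one>} = \<phi> ` Omega1 p P"
    by (simp add: Omega1_def)
  have cjP: "cj (\<phi> x) (\<phi> w) = \<phi> (P.cj x w)" if "x \<in> carrier P" "w \<in> carrier P" for x w
    using that by (simp add: cj_def P.cj_def)
  have ecomP: "ecom (\<phi> x) k (\<phi> w) = \<phi> (P.ecom x k w) \<and> P.ecom x k w \<in> carrier P"
    if "x \<in> carrier P" "w \<in> carrier P" for x w k
    using that by (induction k) (auto simp: cjP)
  show ?thesis
    unfolding engel_def gen
  proof (intro ballI)
    fix w x assume "w \<in> \<phi> ` Omega1 p P" "x \<in> \<phi> ` carrier P"
    then obtain w0 x0 where w0: "w0 \<in> Omega1 p P" "w = \<phi> w0" "x0 \<in> carrier P" "x = \<phi> x0" by auto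
    hence "w0 \<in> upper_central P (p - 1)" using h by (auto simp: p_central_of_height_def)
    moreover from this have "w0 \<in> carrier P"
      using P.upper_central_normal by (meson P.mem_sub normal_imp_subgroup)
    ultimately show "ecom x (p - 1) w = \<one>"
      using P.ecom_upper_central[OF _ w0(3)] ecomP[OF w0(3)] w0 by simp
  qed
qed

section \<open>Translation to the notions of the theorem\<close>

lemma normalizer_eq_nrm:
  assumes S: "subgroup S G"
  shows "normalizer G S = nrm (carrier G) S"
proof -
  have SG: "S \<subseteq> carrier G" using S by (rule subgroup.subset)
  have "l_coset G g S #> inv g = S \<longleftrightarrow> (\<forall>s\<in>S. cj g s \<in> S)" if "g \<in> carrier G" for g
  proof -
    have "l_coset G g S #> inv g = cj g ` S" by (auto simp: l_coset_def r_coset_def cj_def)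
    thus ?thesis using cj_image_eq[OF that SG] by auto
  qed
  thus ?thesis using SG by (auto simp: normalizer_def stabilizer_def nrm_def)
qed

lemma pnil_of_p_nilpotent:
  assumes p: "Factorial_Ring.prime p" and N: "subgroup N G" and nil: "p_nilpotent p (G\<lparr>carrier := N\<rparr>)"
  shows "pnil p N"
proof -
  obtain S K where S: "subgroup S (G\<lparr>carrier := N\<rparr>)" "card S = p ^ multiplicity p (card N)"
    and K: "K \<lhd> G\<lparr>carrier := N\<rparr>" "K <#> S = N" "K \<inter> S = {\<one>}"
    using nil by (auto simp: p_nilpotent_def sylow_subgroup_def order_def)
  interpret K: normal K "G\<lparr>carrier := N\<rparr>" by (rule K(1))
  have Ks: "subgroup K G" "K \<subseteq> N" and Ss: "subgroup S G"
    using incl_subgroup[OF N K.is_subgroup] incl_subgroup[OF N S(1)] K.subset by auto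
  have NK: "normalizes N K" unfolding normalizes_def
  proof (intro ballI)
    fix g k assume "g \<in> N" "k \<in> K"
    thus "cj g k \<in> K" using K.inv_op_closed2[of g k] m_inv_consistent[OF N, of g] by (simp add: cj_def)
  qed
  have card: "card N = card K * card S" using card_set_mult[OF Ks(1) Ss] K(2,3) by simp
  \<comment> \<open>Otherwise p|S| would divide |N|, although |S| is the full power of p in
    |N|.\<close>
  have "\<not> p dvd card K"
  proof
    assume "p dvd card K"
    hence "p * card S dvd card N" unfolding card by (intro mult_dvd_mono dvd_refl)
    hence "p ^ Suc (multiplicity p (card N)) dvd card N" using S(2) by simp
    moreover have "card N \<noteq> 0" using card_sub_pos[OF N] by simp
    ultimately have "Suc (multiplicity p (card N)) \<le> multiplicity p (card N)"
      using p by (intro multiplicity_geI) (auto simp: prime_elem_not_unit)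
    thus False by simp
  qed
  hence "rel_complement p {\<one>} K N" using N Ks NK card S(2) by (auto simp: rel_complement_def syl_one_iff)
  thus ?thesis by (auto simp: pnil_def)
qed

lemma p_nilpotent_of_pnil:
  assumes p: "Factorial_Ring.prime p" and S: "sylow_subgroup p S G" and nil: "pnil p (carrier G)"
  shows "p_nilpotent p G"
proof -
  obtain K where K: "rel_complement p {\<one>} K (carrier G)" using nil by (auto simp: pnil_def)
  note Kd = rel_complementD[OF K]
  have Ss: "subgroup S G" and cS: "card S = p ^ multiplicity p (order G)"
    using S by (auto simp: sylow_subgroup_def)
  have pK: "\<not> p dvd card K" using Kd(5) by (simp add: syl_one_iff)
  obtain n where n: "order G = card K * p ^ n" using K by (auto simp: rel_complement_def order_def)
  have "multiplicity p (card K * p ^ n) = n"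
    using pK p card_sub_pos[OF Kd(2)]
    by (simp add: prime_elem_multiplicity_mult_distrib not_dvd_imp_multiplicity_0 prime_gt_0_nat)
  hence cS: "card S = p ^ n" using cS n by simp
  hence "pgr p S" using Ss by (auto simp: pgr_def)
  hence cop: "coprime (card K) (card S)" using pgr_coprime[OF p _ pK] by blast
  have int: "K \<inter> S = {\<one>}"
    using subgroup_inter_trivial[OF Kd(2) Ss cop] subgroup.one_closed[OF Kd(2)] subgroup.one_closed[OF Ss] by blast
  hence "card (K <#> S) = card (carrier G)"
    using card_set_mult[OF Kd(2) Ss] n cS by (simp add: order_def)
  hence "K <#> S = carrier G"
    using Kd(2) Ss by (intro card_subset_eq fin set_mult_subset subgroup_self) (auto simp: subgroup.subset)
  moreover have "K \<lhd> G"
    using Kd(2,4) by (intro normal_invI) (auto simp: normalizes_def cj_def)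
  ultimately show ?thesis using S int unfolding p_nilpotent_def by blast
qed

end

theorem theoremD:
  fixes p :: nat and P :: "('a, 'm) monoid_scheme"
  assumes "Factorial_Ring.prime p" and "odd p"
    and "p_group p P"
    and "p_central_of_height p (p - 1) P"
  shows "determines_p_nilpotency_locally TYPE('b) p P"
  unfolding determines_p_nilpotency_locally_def
proof (intro allI impI, elim conjE)
  fix G :: "'b monoid" and S
  assume G: "group G" "finite (carrier G)" and S: "sylow_subgroup p S G"
    and iso: "P \<cong> G\<lparr>carrier := S\<rparr>" and nil: "p_nilpotent p (G\<lparr>carrier := normalizer G S\<rparr>)"
  interpret fin_group G using G by (simp add: fin_group_def fin_group_axioms_def)
  have P: "group P" using assms(3) by (simp add: p_group_def)
  have Ss: "subgroup S G" and cS: "card S = p ^ multiplicity p (order G)"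
    using S by (auto simp: sylow_subgroup_def)
  have syl: "syl p S (carrier G)"
  proof -
    obtain m where "order G = p ^ multiplicity p (order G) * m" "\<not> p dvd m"
      using multiplicity_decompose'[of "order G" p] assms(1) order_gt_0_iff_finite fin
      by (metis gr_implies_not0 not_prime_unit)
    hence "\<not> p dvd order G div card S" using cS assms(1)
      by (metis nonzero_mult_div_cancel_left not_prime_0 power_not_zero)
    thus ?thesis using Ss cS by (auto simp: syl_def pgr_def order_def subgroup_self subgroup.subset)
  qed
  obtain f where f: "f \<in> hom P (G\<lparr>carrier := S\<rparr>)" "bij_betw f (carrier P) S"
    using iso by (auto simp: is_iso_def iso_def)
  \<comment> \<open>A conjugate of S contains Q and is an embedded copy of P, so Q inherits the
    Engel condition from it.\<close>
  have engel: "engel p Q" if Q: "pgr p Q" for Q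
  proof -
    have QG: "Q \<subseteq> carrier G" using Q by (simp add: pgr_def subgroup.subset)
    obtain g where g: "g \<in> carrier G" "Q \<subseteq> cj g ` S"
      using sylow_contains_conjugate[OF assms(1) syl Q QG] by auto
    have fS: "f x \<in> S" "f x \<in> carrier G" if "x \<in> carrier P" for x
      using f(2) that Ss by (auto simp: bij_betw_def mem_sub)
    have "cj g \<circ> f \<in> hom P G" using f(1) g(1) fS by (auto simp: hom_def cj_mult)
    moreover have "inj_on (cj g \<circ> f) (carrier P)"
      using f(2) g(1) Ss by (intro comp_inj_on) (auto simp: bij_betw_def inj_on_cj subgroup.subset)
    ultimately have "engel p ((cj g \<circ> f) ` carrier P)" using P assms(4) by (intro engel_hom_image)
    moreover have "(cj g \<circ> f) ` carrier P = cj g ` S" using f(2) by (auto simp: bij_betw_def image_comp[symmetric])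
    ultimately show ?thesis using engel_subset g(2) by metis
  qed
  have "pnil p (nrm (carrier G) S)"
    using pnil_of_p_nilpotent[OF assms(1) subgroup_nrm[OF subgroup_self subgroup.subset[OF Ss]]] nil
    by (simp add: normalizer_eq_nrm[OF Ss])
  hence "pnil p (carrier G)" using pnil_of_nrm_pnil[OF assms(1,2) engel syl] by blast
  thus "p_nilpotent p G" using p_nilpotent_of_pnil[OF assms(1) S] by blast
qed

end
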